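(* There exists a pair $(\rho,\mathbf A)$ of a density $\rho$ and a vector potential $\mathbf A$ such that the strict inequality $G(\rho,\mathbf A) > G_{\mathrm D}(\rho,\mathbf A)$ holds, where $G$ is the Grayce--Harris functional and $G_{\mathrm D}(\rho,\mathbf A)=\sup_{\mathbf k}\{F_{\mathrm D}(\rho,\mathbf k)+\int \mathbf k\cdot\mathbf A\,\mathrm d\mathbf r\}$ is the functional obtained from Diener's functional $F_{\mathrm D}$.
   Context: Setting: $N$ electrons in $\mathbb R^3$ (spin is ignored), atomic units. For a scalar potential $v:\mathbb R^3\to\mathbb R$ and a vector potential $\mathbf A:\mathbb R^3\to\mathbb R^3$, the Hamiltonian is $H(v,\mathbf A)=\frac12\sum_j(-\mathrm i\nabla_j+\mathbf A(\mathbf r_j))^2+\sum_j v(\mathbf r_j)+W$, with $W=\sum_{i<j}|\mathbf r_i-\mathbf r_j|^{-1}$, and $H_0=H(0,\mathbf 0)$. States $\Gamma$ are mixed $N$-electron states (density matrices). For a pure state $\psi$, the density is $\rho_\psi(\mathbf r_1)=N\int|\psi|^2\,\mathrm d\mathbf r_2\cdots\mathrm d\mathbf r_N$ and the paramagnetic current density is $\mathbf j^{\mathrm p}_\psi(\mathbf r_1)=N\,\mathrm{Im}\int\bar\psi\nabla_1\psi\,\mathrm d\mathbf r_2\cdots\mathrm d\mathbf r_N$; these are extended to mixed states by convex combination and denoted $\rho_\Gamma,\mathbf j^{\mathrm p}_\Gamma$. $\Gamma\mapsto\rho$ means $\rho_\Gamma=\rho$, and $\Gamma\mapsto(\rho,\mathbf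 j^{\mathrm p})$ means $\rho_\Gamma=\rho$ and $\mathbf j^{\mathrm p}_\Gamma=\mathbf j^{\mathrm p}$. Here $\rho$ denotes an $N$-electron density, $N=\int\rho\,\mathrm d\mathbf r$. Vignale--Rasolt functional: $F_{\mathrm{VR}}(\rho,\mathbf j^{\mathrm p})=\inf_{\Gamma\mapsto(\rho,\mathbf j^{\mathrm p})}\mathrm{tr}(H_0\Gamma)$. Grayce--Harris functional: $G(\rho,\mathbf A)=\inf_{\Gamma\mapsto\rho}\mathrm{tr}(H(0,\mathbf A)\Gamma)=\int\frac12\rho|\mathbf A|^2\,\mathrm d\mathbf r+\inf_{\mathbf j^{\mathrm p}}\{F_{\mathrm{VR}}(\rho,\mathbf j^{\mathrm p})+\int\mathbf j^{\mathrm p}\cdot\mathbf A\,\mathrm d\mathbf r\}$. Diener's functional: for a density $\rho$ and an arbitrary current density (vector field) $\mathbf k$, $F_{\mathrm D}(\rho,\mathbf k)=\inf_{\mathbf j^{\mathrm p}}\{F_{\mathrm{VR}}(\rho,\mathbf j^{\mathrm p})-\int\frac{|\mathbf j^{\mathrm p}-\mathbf k|^2}{2\rho}\,\mathrm d\mathbf r\}=\inf_{\Gamma\mapsto\rho}\{\mathrm{tr}(H_0\Gamma)-\int\frac{|\mathbf j^{\mathrm p}_\Gamma-\mathbf k|^2}{2\rho}\,\mathrm d\mathbf r\}$ (the value $-\infty$ is allowed). The supremum in $G_{\mathrm D}$ is over all current densities $\mathbf k$. *)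

theory Defs
  imports "HOL-Analysis.Analysis"
begin

type_synonym point = "real^3"
type_synonym field = "point \<Rightarrow> point"
type_synonym wavefun = "(nat \<Rightarrow> point) \<Rightarrow> complex"

text \<open>
  Configurations of the particles with labels in \<open>I\<close> are functions that are extensional on \<open>I\<close>;
  \<open>N\<close> electrons carry the labels \<open>0, \<dots>, N - 1\<close>.
\<close>

definition conf :: "nat set \<Rightarrow> (nat \<Rightarrow> point) measure" where
  "conf I = PiM I (\<lambda>_. lborel)"


subsection \<open>First-order Sobolev space on the configuration space\<close>

definition L2 :: "nat \<Rightarrow> wavefun set" where
  "L2 N = {\<psi> \<in> borel_measurable (conf {..<N}).
             integrable (conf {..<N}) (\<lambda>x. (cmod (\<psi> x))\<^sup>2)}"

definition shift :: "nat \<Rightarrow> 3 \<Rightarrow> (nat \<Rightarrow> point) \<Rightarrow> real \<Rightarrow> (nat \<Rightarrow> point)" where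
  "shift j a x h = x(j := x j + h *\<^sub>R axis a 1)"

definition partial_deriv :: "nat \<Rightarrow> 3 \<Rightarrow> ((nat \<Rightarrow> point) \<Rightarrow> real) \<Rightarrow> (nat \<Rightarrow> point) \<Rightarrow> real" where
  "partial_deriv j a \<phi> x = deriv (\<lambda>h. \<phi> (shift j a x h)) 0"

text \<open>Test functions: continuously differentiable with compact support.\<close>

definition test_function :: "nat \<Rightarrow> ((nat \<Rightarrow> point) \<Rightarrow> real) \<Rightarrow> bool" where
  "test_function N \<phi> \<longleftrightarrow>
     continuous_on (space (conf {..<N})) \<phi> \<and>
     (\<forall>j<N. \<forall>a.
        (\<forall>x\<in>space (conf {..<N}). (\<lambda>h. \<phi> (shift j a x h)) differentiable (at 0)) \<and>
        continuous_on (space (conf {..<N})) (partial_deriv j a \<phi>)) \<and>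
     (\<exists>R. \<forall>x\<in>space (conf {..<N}). (\<exists>j<N. norm (x j) > R) \<longrightarrow> \<phi> x = 0)"

definition is_weak_partial :: "nat \<Rightarrow> nat \<Rightarrow> 3 \<Rightarrow> wavefun \<Rightarrow> wavefun \<Rightarrow> bool" where
  "is_weak_partial N j a \<psi> g \<longleftrightarrow>
     (\<forall>\<phi>. test_function N \<phi> \<longrightarrow>
        (LINT x|conf {..<N}. partial_deriv j a \<phi> x *\<^sub>R \<psi> x) =
        - (LINT x|conf {..<N}. \<phi> x *\<^sub>R g x))"

definition H1 :: "nat \<Rightarrow> wavefun set" where
  "H1 N = {\<psi> \<in> L2 N. \<forall>j<N. \<forall>a. \<exists>g\<in>L2 N. is_weak_partial N j a \<psi> g}"

text \<open>
  Component \<open>a\<close> of the weak gradient with respect to particle \<open>j\<close>. It is unique up to null sets,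
  and everything below depends only on the almost-everywhere class.
\<close>

definition wgrad :: "nat \<Rightarrow> wavefun \<Rightarrow> nat \<Rightarrow> 3 \<Rightarrow> wavefun" where
  "wgrad N \<psi> j a = (SOME g. g \<in> L2 N \<and> is_weak_partial N j a \<psi> g)"


subsection \<open>Pure states\<close>

definition antisymmetric :: "nat \<Rightarrow> wavefun \<Rightarrow> bool" where
  "antisymmetric N \<psi> \<longleftrightarrow>
     (\<forall>p. p permutes {..<N} \<longrightarrow>
        (AE x in conf {..<N}. \<psi> (x \<circ> p) = of_int (sign p) * \<psi> x))"

definition inner_L2 :: "nat \<Rightarrow> wavefun \<Rightarrow> wavefun \<Rightarrow> complex" where
  "inner_L2 N \<psi> \<eta> = (LINT x|conf {..<N}. cnj (\<psi> x) * \<eta> x)"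

text \<open>
  The quadratic form of \<open>H(0, A)\<close>, that is
  \<open>1/2 \<Sum>\<^sub>j \<parallel>(-\<i> \<nabla>\<^sub>j + A(r\<^sub>j)) \<psi>\<parallel>\<^sup>2 + \<langle>\<psi>, W \<psi>\<rangle>\<close>.
  All terms are non-negative, so it takes values in \<open>[0, \<infinity>]\<close>.
\<close>

definition kinetic :: "nat \<Rightarrow> field \<Rightarrow> wavefun \<Rightarrow> ennreal" where
  "kinetic N A \<psi> =
     (\<Sum>j<N. \<Sum>a\<in>UNIV. \<integral>\<^sup>+x.
        ennreal (1/2 * (cmod (- \<i> * wgrad N \<psi> j a x + of_real (A (x j) $ a) * \<psi> x))\<^sup>2)
      \<partial>conf {..<N})"

definition coulomb :: "nat \<Rightarrow> wavefun \<Rightarrow> ennreal" where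
  "coulomb N \<psi> =
     (\<integral>\<^sup>+x. ennreal ((\<Sum>j<N. \<Sum>i<j. 1 / norm (x i - x j)) * (cmod (\<psi> x))\<^sup>2) \<partial>conf {..<N})"

definition pure_energy :: "nat \<Rightarrow> field \<Rightarrow> wavefun \<Rightarrow> ennreal" where
  "pure_energy N A \<psi> = kinetic N A \<psi> + coulomb N \<psi>"

definition pure_density :: "nat \<Rightarrow> wavefun \<Rightarrow> point \<Rightarrow> real" where
  "pure_density N \<psi> r = real N * (LINT x|conf {1..<N}. (cmod (\<psi> (x(0 := r))))\<^sup>2)"

definition pure_current :: "nat \<Rightarrow> wavefun \<Rightarrow> field" where
  "pure_current N \<psi> r =
     (\<chi> a. real N *
        Im (LINT x|conf {1..<N}. cnj (\<psi> (x(0 := r))) * wgrad N \<psi> 0 a (x(0 := r))))"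


subsection \<open>Mixed states\<close>

text \<open>
  The pair \<open>(w, \<psi>)\<close> stands for the density matrix \<open>\<Gamma> = \<Sum>\<^sub>i w\<^sub>i |\<psi>\<^sub>i\<rangle>\<langle>\<psi>\<^sub>i|\<close>, given by its
  spectral resolution. Entries with \<open>w\<^sub>i = 0\<close> are ignored, so pure and finite-rank states are
  included.
\<close>

type_synonym mixed = "(nat \<Rightarrow> real) \<times> (nat \<Rightarrow> wavefun)"

definition density_matrix :: "nat \<Rightarrow> mixed \<Rightarrow> bool" where
  "density_matrix N \<Gamma> \<longleftrightarrow> (case \<Gamma> of (w, \<psi>) \<Rightarrow>
     (\<forall>i. 0 \<le> w i) \<and> w sums 1 \<and>
     (\<forall>i. w i > 0 \<longrightarrow> \<psi> i \<in> H1 N \<and> antisymmetric N (\<psi> i)) \<and>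
     (\<forall>i k. w i > 0 \<longrightarrow> w k > 0 \<longrightarrow> inner_L2 N (\<psi> i) (\<psi> k) = (if i = k then 1 else 0)))"

text \<open>\<open>tr (H(0, A) \<Gamma>)\<close> in the sense of quadratic forms\<close>

definition energy :: "nat \<Rightarrow> field \<Rightarrow> mixed \<Rightarrow> ennreal" where
  "energy N A \<Gamma> = (case \<Gamma> of (w, \<psi>) \<Rightarrow> \<Sum>i. ennreal (w i) * pure_energy N A (\<psi> i))"

definition state_density :: "nat \<Rightarrow> mixed \<Rightarrow> point \<Rightarrow> real" where
  "state_density N \<Gamma> r = (case \<Gamma> of (w, \<psi>) \<Rightarrow> \<Sum>i. w i * pure_density N (\<psi> i) r)"

definition state_current :: "nat \<Rightarrow> mixed \<Rightarrow> field" where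
  "state_current N \<Gamma> r = (case \<Gamma> of (w, \<psi>) \<Rightarrow> \<Sum>i. w i *\<^sub>R pure_current N (\<psi> i) r)"

text \<open>States have finite energy with respect to \<open>H\<^sub>0 = H(0, 0)\<close>.\<close>

definition states :: "nat \<Rightarrow> mixed set" where
  "states N = {\<Gamma>. density_matrix N \<Gamma> \<and> energy N (\<lambda>_. 0) \<Gamma> < \<infinity>}"

definition states_with_density :: "nat \<Rightarrow> (point \<Rightarrow> real) \<Rightarrow> mixed set" where
  "states_with_density N \<rho> = {\<Gamma> \<in> states N. AE r in lborel. state_density N \<Gamma> r = \<rho> r}"

definition states_with_density_current :: "nat \<Rightarrow> (point \<Rightarrow> real) \<Rightarrow> field \<Rightarrow> mixed set" where
  "states_with_density_current N \<rho> j =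
     {\<Gamma> \<in> states_with_density N \<rho>. AE r in lborel. state_current N \<Gamma> r = j r}"


subsection \<open>Densities and density functionals\<close>

definition electron_number :: "(point \<Rightarrow> real) \<Rightarrow> nat" where
  "electron_number \<rho> = (THE N. real N = (LINT r|lborel. \<rho> r))"

definition electron_density :: "(point \<Rightarrow> real) \<Rightarrow> bool" where
  "electron_density \<rho> \<longleftrightarrow>
     (\<forall>r. 0 \<le> \<rho> r) \<and> integrable lborel \<rho> \<and>
     (\<exists>N>0. real N = (LINT r|lborel. \<rho> r) \<and> states_with_density N \<rho> \<noteq> {})"

text \<open>
  Vector potentials that are admissible for \<open>\<rho>\<close>: the diamagnetic term
  \<open>\<integral> 1/2 \<rho> |A|\<^sup>2\<close> is finite.
\<close>

definition vector_potential :: "(point \<Rightarrow> real) \<Rightarrow> field \<Rightarrow> bool" where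
  "vector_potential \<rho> A \<longleftrightarrow>
     A \<in> borel_measurable borel \<and> integrable lborel (\<lambda>r. \<rho> r * (norm (A r))\<^sup>2)"

definition F_VR :: "(point \<Rightarrow> real) \<Rightarrow> field \<Rightarrow> ereal" where
  "F_VR \<rho> j =
     (INF \<Gamma>\<in>states_with_density_current (electron_number \<rho>) \<rho> j.
        enn2ereal (energy (electron_number \<rho>) (\<lambda>_. 0) \<Gamma>))"

definition G :: "(point \<Rightarrow> real) \<Rightarrow> field \<Rightarrow> ereal" where
  "G \<rho> A =
     (INF \<Gamma>\<in>states_with_density (electron_number \<rho>) \<rho>.
        enn2ereal (energy (electron_number \<rho>) A \<Gamma>))"

text \<open>
  Division in \<open>ennreal\<close> has \<open>0 / 0 = 0\<close> and \<open>c / 0 = \<infinity>\<close> for \<open>c > 0\<close>, the appropriate convention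
  on the zero set of \<open>\<rho>\<close>.
\<close>

definition current_distance :: "(point \<Rightarrow> real) \<Rightarrow> field \<Rightarrow> field \<Rightarrow> ennreal" where
  "current_distance \<rho> j k =
     (\<integral>\<^sup>+r. ennreal ((norm (j r - k r))\<^sup>2) / ennreal (2 * \<rho> r) \<partial>lborel)"

text \<open>
  If no state has density \<open>\<rho>\<close> and current \<open>j\<close>, then \<open>F_VR \<rho> j = \<infinity>\<close>. In \<open>ereal\<close> we have
  \<open>\<infinity> - \<infinity> = \<infinity>\<close>, so such \<open>j\<close> never contribute to the infimum.
\<close>

definition F_D :: "(point \<Rightarrow> real) \<Rightarrow> field \<Rightarrow> ereal" where
  "F_D \<rho> k =
     (INF j\<in>borel_measurable borel. F_VR \<rho> j - enn2ereal (current_distance \<rho> j k))"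

text \<open>
  The supremum runs over the \<open>k\<close> for which \<open>\<integral> k \<bullet> A\<close> exists. For \<open>A\<close> admissible for \<open>\<rho>\<close> this
  excludes only fields with \<open>\<integral> |k|\<^sup>2 / \<rho> = \<infinity>\<close>, for which \<open>F_D \<rho> k = -\<infinity>\<close>.
\<close>

definition G_D :: "(point \<Rightarrow> real) \<Rightarrow> field \<Rightarrow> ereal" where
  "G_D \<rho> A =
     (SUP k\<in>{k \<in> borel_measurable borel. integrable lborel (\<lambda>r. k r \<bullet> A r)}.
        F_D \<rho> k + ereal (LINT r|lborel. k r \<bullet> A r))"

end

theory Submission
  imports Defs
begin

text \<open>
  Take one electron and a potential \<open>A\<close> that carries half a flux quantum through a tube along the
  third axis, together with an amplitude \<open>f \<ge> 0\<close> vanishing on the tube; put \<open>\<rho> = f\<^sup>2\<close>. The states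
  \<open>f\<close> and \<open>e\<^sup>i\<^sup>\<phi> f\<close>, where \<open>\<phi>\<close> winds once around the tube and \<open>\<nabla>\<phi> = - 2 A\<close>, have density \<open>\<rho>\<close> and currents
  \<open>0\<close> and \<open>- 2 \<rho> A\<close>. For every \<open>k\<close> the average of the two corresponding upper bounds for
  \<open>F_D \<rho> k + \<integral> k \<bullet> A\<close> is at most the Dirichlet energy \<open>1/2 \<integral> |\<nabla>f|\<^sup>2\<close>, hence so is \<open>G_D \<rho> A\<close>.
  On the other hand, transport around a loop that encloses the tube multiplies a wave function by
  \<open>- 1\<close>, so its increments along the loop are at least as large as the function itself. This bounds
  \<open>G \<rho> A\<close> from below by a multiple of the mass of \<open>\<rho>\<close> near the loop, divided by the square of its length.
  Since a line has capacity zero in three dimensions, a logarithmic cutoff makes the Dirichlet energy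
  smaller than this bound.
\<close>

subsection \<open>Windows and the fundamental lemma of the calculus of variations\<close>

text \<open>Half a flux quantum is chosen because \<open>2 A\<close> is then a pure gauge off the
  tube. The two states have physical currents \<open>\<rho> A\<close> and \<open>- \<rho> A\<close>
  and the same energy in the field, while Diener's functional must serve both with a single
  \<open>k\<close>. Averaging the two bounds leaves the Dirichlet energy minus the integral of
  \<open>|k|^2 / (2 \<rho>)\<close>: the diamagnetic energy cancels, so the strength of
  \<open>A\<close> does not enter. The lower bound has to cover every mixed state of density
  \<open>\<rho>\<close>. It is linear in \<open>|\<psi>|^2\<close>, hence reduces to single
  orbitals, but these are only Sobolev functions whose gradient is picked by \<open>SOME\<close>.
  This calls for two facts about weak derivatives: uniqueness, to identify the gradients of the
  explicit states, and a bound for finite increments, to transport along a loop. No polar angle is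
  used. The potential is the gradient of a step in the second coordinate, switched on only where the
  first coordinate is positive. Its line integrals along the sides of a rectangle are explicit, and
  its flux sits on a slit inside the hole of \<open>f\<close>.\<close>

definition pos2 :: "real \<Rightarrow> real" where
  "pos2 x = (max 0 x)\<^sup>2"

lemma pos2_ge_0: "0 \<le> pos2 x"
  by (simp add: pos2_def)

lemma pos2_eq_0: "x \<le> 0 \<Longrightarrow> pos2 x = 0"
  by (simp add: pos2_def)

lemma pos2_eq_power2: "0 \<le> x \<Longrightarrow> pos2 x = x\<^sup>2"
  by (simp add: pos2_def max_def)

lemma pos2_pos_iff: "0 < pos2 x \<longleftrightarrow> 0 < x"
  by (auto simp: pos2_def max_def)

lemma DERIV_pos2: "(pos2 has_real_derivative 2 * max 0 x) (at x)"
proof -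
  consider "x < 0" | "x = 0" | "x > 0" by linarith
  then show ?thesis
  proof cases
    case 1
    have "((\<lambda>_. 0) has_real_derivative 2 * max 0 x) (at x)"
      using 1 by simp
    then show ?thesis
      by (rule has_field_derivative_transform_within_open[where S = "{..<0}"]) (use 1 in \<open>auto simp: pos2_eq_0\<close>)
  next
    case 2
    have bound: "norm (pos2 h / h) \<le> norm h" for h
    proof (cases "h = 0")
      case False
      have "pos2 h \<le> h\<^sup>2"
        by (simp add: pos2_def max_def)
      then show ?thesis
        using False by (simp add: pos2_ge_0 pos_divide_le_eq power2_eq_square[symmetric])
    qed simp
    have "((\<lambda>h. pos2 h / h) \<longlongrightarrow> 0) (at 0)"
    proof (rule Lim_null_comparison)
      show "((\<lambda>h::real. norm h) \<longlongrightarrow> 0) (at 0)"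
        by (rule tendsto_norm_zero) (rule tendsto_ident_at)
    qed (simp only: bound eventually_True)
    then show ?thesis
      using 2 by (simp add: DERIV_def pos2_eq_0)
  next
    case 3
    have "((\<lambda>y. y\<^sup>2) has_real_derivative 2 * max 0 x) (at x)"
      using 3 by (auto intro!: derivative_eq_intros)
    then show ?thesis
      by (rule has_field_derivative_transform_within_open[where S = "{0<..}"]) (use 3 in \<open>auto simp: pos2_eq_power2\<close>)
  qed
qed

lemmas DERIV_pos2' [derivative_intros] = DERIV_chain2[OF DERIV_pos2]

lemma continuous_on_pos2 [continuous_intros]:
  "continuous_on S f \<Longrightarrow> continuous_on S (\<lambda>x. pos2 (f x))"
  unfolding pos2_def by (intro continuous_intros)

text \<open>Test functions need only be continuously differentiable, so squares of positive parts
  suffice. The map \<open>t / (1 + t)\<close> keeps the values in [0, 1], and the factor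
  \<open>n\<close> pushes them to 1 at every interior point.\<close>

definition window :: "nat \<Rightarrow> real \<Rightarrow> real \<Rightarrow> real \<Rightarrow> real" where
  "window n l u x = real n * (pos2 (x - l) * pos2 (u - x)) / (1 + real n * (pos2 (x - l) * pos2 (u - x)))"

definition window_deriv :: "nat \<Rightarrow> real \<Rightarrow> real \<Rightarrow> real \<Rightarrow> real" where
  "window_deriv n l u x =
     real n * (2 * max 0 (x - l) * pos2 (u - x) - pos2 (x - l) * (2 * max 0 (u - x)))
       / (1 + real n * (pos2 (x - l) * pos2 (u - x)))\<^sup>2"

lemma window_denominator_pos: "0 < 1 + real n * (pos2 (x - l) * pos2 (u - x))"
  by (simp add: add_pos_nonneg pos2_ge_0)

lemma window_denominator_nonzero: "1 + real n * (pos2 (x - l) * pos2 (u - x)) \<noteq> 0"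
  using window_denominator_pos[of n x l u] by simp

lemma window_bounds: "0 \<le> window n l u x" "window n l u x \<le> 1"
  using window_denominator_pos[of n x l u] by (auto simp: window_def pos2_ge_0)

lemma window_outside: "x \<notin> {l<..<u} \<Longrightarrow> window n l u x = 0"
  by (auto simp: window_def pos2_eq_0)

lemma DERIV_window: "(window n l u has_real_derivative window_deriv n l u x) (at x)"
proof -
  define w where "w x = real n * (pos2 (x - l) * pos2 (u - x))" for x
  have w: "(w has_real_derivative real n * (2 * max 0 (x - l) * pos2 (u - x) - pos2 (x - l) * (2 * max 0 (u - x)))) (at x)"
    unfolding w_def by (auto intro!: derivative_eq_intros simp: algebra_simps)
  have nz: "1 + w x \<noteq> 0"
    using window_denominator_pos[of n x l u] by (simp add: w_def)
  have "((\<lambda>x. w x / (1 + w x)) has_real_derivative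
      real n * (2 * max 0 (x - l) * pos2 (u - x) - pos2 (x - l) * (2 * max 0 (u - x))) / (1 + w x)\<^sup>2) (at x)"
    using nz by (auto intro!: derivative_eq_intros w simp: power2_eq_square algebra_simps)
  then show ?thesis
    by (simp add: w_def window_def[abs_def] window_deriv_def)
qed

lemma continuous_on_window [continuous_intros]:
  "continuous_on S f \<Longrightarrow> continuous_on S (\<lambda>x. window n l u (f x))"
  unfolding window_def
  by (intro continuous_intros ballI) (simp_all add: window_denominator_nonzero)

lemma continuous_on_window_deriv [continuous_intros]:
  "continuous_on S f \<Longrightarrow> continuous_on S (\<lambda>x. window_deriv n l u (f x))"
  unfolding window_deriv_def
  by (intro continuous_intros ballI) (simp_all add: window_denominator_nonzero)

lemma window_tendsto: "(\<lambda>n. window n l u x) \<longlonglongrightarrow> indicator {l<..<u} x"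
proof (cases "x \<in> {l<..<u}")
  case True
  define c where "c = pos2 (x - l) * pos2 (u - x)"
  have c: "c > 0"
    using True by (simp add: c_def pos2_pos_iff)
  have "(\<lambda>n. 1 - 1 / (1 + c * real n)) \<longlonglongrightarrow> 1 - 0"
    using c by (intro tendsto_diff tendsto_const real_tendsto_divide_at_top[of _ 1]
        filterlim_tendsto_add_at_top[of _ 1] filterlim_tendsto_pos_mult_at_top[of _ c] filterlim_real_sequentially) auto
  moreover have "1 - 1 / (1 + c * real n) = window n l u x" for n
  proof -
    have "1 + c * real n > 0" using c by (simp add: add_pos_nonneg)
    then show ?thesis unfolding window_def c_def[symmetric] by (simp add: field_simps)
  qed
  ultimately show ?thesis
    using True by simp
qed (simp add: window_outside)

text \<open>Test functions in product form: their primitive along one coordinate is explicit.\<close>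

definition box_window :: "nat \<Rightarrow> real^'n \<Rightarrow> real^'n \<Rightarrow> real^'n \<Rightarrow> real" where
  "box_window n l u r = (\<Prod>a\<in>UNIV. window n (l $ a) (u $ a) (r $ a))"

lemma box_window_bounds: "0 \<le> box_window n l u r" "box_window n l u r \<le> 1"
  unfolding box_window_def by (auto intro!: prod_nonneg prod_le_1 window_bounds)

lemma box_window_outside: "r \<notin> box l u \<Longrightarrow> box_window n l u r = 0"
  unfolding box_window_def mem_box_cart by (force intro: window_outside)

lemma continuous_on_box_window: "continuous_on S (box_window n l u)"
  unfolding box_window_def[abs_def] by (intro continuous_intros)

lemma borel_measurable_box_window [measurable]: "box_window n l u \<in> borel_measurable borel"
  by (intro borel_measurable_continuous_onI continuous_on_box_window)

lemma box_window_tendsto: "(\<lambda>n. box_window n l u r) \<longlonglongrightarrow> indicator (box l u) r"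
proof -
  have "(\<lambda>n. \<Prod>a\<in>UNIV. window n (l $ a) (u $ a) (r $ a)) \<longlonglongrightarrow> (\<Prod>a\<in>UNIV. indicator {l $ a<..<u $ a} (r $ a))"
    by (intro tendsto_prod window_tendsto)
  moreover have "(\<Prod>a\<in>UNIV. indicator {l $ a<..<u $ a} (r $ a)) = (indicator (box l u) r :: real)"
    by (auto simp: indicator_def mem_box_cart)
  ultimately show ?thesis
    by (simp add: box_window_def)
qed

text \<open>The positive and negative parts of \<open>f\<close>, taken as densities, define measures
  that agree on boxes. Boxes form an intersection-stable generator and have finite measure, so the
  measures coincide, and densities are unique almost everywhere.\<close>

lemma AE_eq_0_if_box_integrals_0_real:
  fixes f :: "'a::euclidean_space \<Rightarrow> real"
  assumes f: "\<And>l u. integrable lborel (\<lambda>x. indicator (box l u) x * f x)"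
    and meas [measurable]: "f \<in> borel_measurable borel"
    and zero: "\<And>l u. (LINT x|lborel. indicator (box l u) x * f x) = 0"
  shows "AE x in lborel. f x = 0"
proof -
  let ?E = "range (\<lambda>(a, b). box a b::'a set)"
  have em: "emeasure (density lborel (\<lambda>x. ennreal (g x))) (box l u) = ennreal (LINT x|lborel. indicator (box l u) x * g x)"
    if "integrable lborel (\<lambda>x. indicator (box l u) x * g x)" "\<And>x. g x \<ge> 0" 
      and [measurable]: "g \<in> borel_measurable borel" for g :: "'a \<Rightarrow> real" and l u
  proof -
    have "(\<integral>\<^sup>+x. ennreal (g x) * indicator (box l u) x \<partial>lborel) = (\<integral>\<^sup>+x. ennreal (indicator (box l u) x * g x) \<partial>lborel)"
      by (intro nn_integral_cong) (auto simp: indicator_def)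
    also have "\<dots> = ennreal (LINT x|lborel. indicator (box l u) x * g x)"
      using that by (intro nn_integral_eq_integral) auto
    finally show ?thesis
      by (simp add: emeasure_density)
  qed
  have int_p: "integrable lborel (\<lambda>x. indicator (box l u) x * max 0 (f x))" for l u
    by (rule Bochner_Integration.integrable_bound[OF f[of l u]]) (auto simp: indicator_def)
  have int_n: "integrable lborel (\<lambda>x. indicator (box l u) x * max 0 (- f x))" for l u
    by (rule Bochner_Integration.integrable_bound[OF f[of l u]]) (auto simp: indicator_def)
  have eq: "(LINT x|lborel. indicator (box l u) x * max 0 (f x)) = (LINT x|lborel. indicator (box l u) x * max 0 (- f x))" for l u
  proof -
    have "(LINT x|lborel. indicator (box l u) x * max 0 (f x)) - (LINT x|lborel. indicator (box l u) x * max 0 (- f x))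
        = (LINT x|lborel. indicator (box l u) x * max 0 (f x) - indicator (box l u) x * max 0 (- f x))"
      using int_p int_n by simp
    also have "\<dots> = (LINT x|lborel. indicator (box l u) x * f x)"
      by (intro Bochner_Integration.integral_cong) (auto simp: indicator_def)
    finally show ?thesis
      using zero[of l u] by simp
  qed
  have dens: "density lborel (\<lambda>x. ennreal (max 0 (f x))) = density lborel (\<lambda>x. ennreal (max 0 (- f x)))"
  proof (rule measure_eqI_generator_eq)
    show "Int_stable ?E"
      by (auto simp: Int_stable_def box_Int_box)
    show "?E \<subseteq> Pow UNIV" "sets (density lborel (\<lambda>x. ennreal (max 0 (f x)))) = sigma_sets UNIV ?E"
      "sets (density lborel (\<lambda>x. ennreal (max 0 (- f x)))) = sigma_sets UNIV ?E"
      by (simp_all add: borel_eq_box)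
    let ?A = "\<lambda>n::nat. box (- (real n *\<^sub>R One)) (real n *\<^sub>R One) :: 'a set"
    show "range ?A \<subseteq> ?E" "(\<Union>i. ?A i) = UNIV"
      unfolding UN_box_eq_UNIV by auto
    show "emeasure (density lborel (\<lambda>x. ennreal (max 0 (f x)))) (?A i) \<noteq> \<infinity>" for i
      by (subst em[OF int_p]) auto
    show "emeasure (density lborel (\<lambda>x. ennreal (max 0 (f x)))) X = emeasure (density lborel (\<lambda>x. ennreal (max 0 (- f x)))) X"
      if "X \<in> ?E" for X
      using that by (auto simp: em[OF int_p] em[OF int_n] eq)
  qed
  have "AE x in lborel. ennreal (max 0 (f x)) = ennreal (max 0 (- f x))"
    by (rule sigma_finite_measure.density_unique[OF sigma_finite_lborel _ _ dens]) auto
  then show ?thesis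
    by eventually_elim (auto simp: max_def ennreal_eq_0_iff split: if_splits)
qed

lemma AE_eq_0_if_box_integrals_0:
  fixes f :: "'a::euclidean_space \<Rightarrow> complex"
  assumes f: "\<And>l u. integrable lborel (\<lambda>x. indicator (box l u) x *\<^sub>R f x)"
    and meas [measurable]: "f \<in> borel_measurable borel"
    and zero: "\<And>l u. (LINT x|lborel. indicator (box l u) x *\<^sub>R f x) = 0"
  shows "AE x in lborel. f x = 0"
proof -
  have "AE x in lborel. Re (f x) = 0"
  proof (rule AE_eq_0_if_box_integrals_0_real)
    show "integrable lborel (\<lambda>x. indicator (box l u) x * Re (f x))" for l u
      using integrable_Re[OF f[of l u]] by simp
    show "(LINT x|lborel. indicator (box l u) x * Re (f x)) = 0" for l u
      using integral_Re[OF f[of l u]] zero[of l u] by simp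
  qed auto
  moreover have "AE x in lborel. Im (f x) = 0"
  proof (rule AE_eq_0_if_box_integrals_0_real)
    show "integrable lborel (\<lambda>x. indicator (box l u) x * Im (f x))" for l u
      using integrable_Im[OF f[of l u]] by simp
    show "(LINT x|lborel. indicator (box l u) x * Im (f x)) = 0" for l u
      using integral_Im[OF f[of l u]] zero[of l u] by simp
  qed auto
  ultimately show ?thesis
    by eventually_elim (simp add: complex_eq_iff)
qed

text \<open>The fundamental lemma in the form needed later: windows tend pointwise to indicators of
  boxes and are dominated by them, so vanishing window integrals give vanishing box
  integrals.\<close>

lemma AE_eq_0_if_window_integrals_0:
  fixes f :: "real^'n \<Rightarrow> complex"
  assumes f: "\<And>l u. integrable lborel (\<lambda>x. indicator (box l u) x *\<^sub>R f x)"
    and meas [measurable]: "f \<in> borel_measurable borel"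
    and zero: "\<And>n l u. (LINT x|lborel. box_window n l u x *\<^sub>R f x) = 0"
  shows "AE x in lborel. f x = 0"
proof (rule AE_eq_0_if_box_integrals_0[OF f meas])
  fix l u
  have "(\<lambda>n. LINT x|lborel. box_window n l u x *\<^sub>R f x) \<longlonglongrightarrow> (LINT x|lborel. indicator (box l u) x *\<^sub>R f x)"
  proof (rule integral_dominated_convergence[where w = "\<lambda>x. norm (indicator (box l u) x *\<^sub>R f x)"])
    show "integrable lborel (\<lambda>x. norm (indicator (box l u) x *\<^sub>R f x))"
      using f by (rule integrable_norm)
    show "AE x in lborel. (\<lambda>n. box_window n l u x *\<^sub>R f x) \<longlonglongrightarrow> indicator (box l u) x *\<^sub>R f x"
      by (intro AE_I2 tendsto_scaleR box_window_tendsto tendsto_const)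
    show "AE x in lborel. norm (box_window n l u x *\<^sub>R f x) \<le> norm (indicator (box l u) x *\<^sub>R f x)" for n
    proof (rule AE_I2)
      fix x show "norm (box_window n l u x *\<^sub>R f x) \<le> norm (indicator (box l u) x *\<^sub>R f x)"
        using box_window_bounds[of n l u x] box_window_outside[of x l u n]
        by (cases "x \<in> box l u") (auto intro!: mult_left_le_one_le)
    qed
  qed auto
  then show "(LINT x|lborel. indicator (box l u) x *\<^sub>R f x) = 0"
    by (simp add: zero LIMSEQ_const_iff)
qed

subsection \<open>Weak partial derivatives\<close>

text \<open>A relation rather than \<open>deriv\<close>, so that it asserts differentiability as
  well as the value. Together with \<open>test_fun\<close> and \<open>weak_partial\<close> it
  restates the notions on configurations directly on Euclidean space;
  \<open>is_weak_partial_1_iff\<close> links the two.\<close>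

definition has_partial :: "'n \<Rightarrow> (real^'n \<Rightarrow> 'b::real_normed_vector) \<Rightarrow> (real^'n \<Rightarrow> 'b) \<Rightarrow> bool" where
  "has_partial a u u' \<longleftrightarrow> (\<forall>r. ((\<lambda>h. u (r + h *\<^sub>R axis a 1)) has_vector_derivative u' r) (at 0))"

definition test_fun :: "(real^'n \<Rightarrow> real) \<Rightarrow> bool" where
  "test_fun \<Phi> \<longleftrightarrow> continuous_on UNIV \<Phi> \<and>
     (\<forall>a. \<exists>\<Phi>'. has_partial a \<Phi> \<Phi>' \<and> continuous_on UNIV \<Phi>') \<and>
     (\<exists>K. \<forall>r. K < norm r \<longrightarrow> \<Phi> r = 0)"

definition weak_partial :: "'n \<Rightarrow> (real^'n \<Rightarrow> complex) \<Rightarrow> (real^'n \<Rightarrow> complex) \<Rightarrow> bool" where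
  "weak_partial a \<psi> g \<longleftrightarrow> (\<forall>\<Phi> \<Phi>'. test_fun \<Phi> \<longrightarrow> has_partial a \<Phi> \<Phi>' \<longrightarrow>
     (LINT r|lborel. \<Phi>' r *\<^sub>R \<psi> r) = - (LINT r|lborel. \<Phi> r *\<^sub>R g r))"

lemma has_partial_unique: "has_partial a u u' \<Longrightarrow> has_partial a u u'' \<Longrightarrow> u' = u''"
  unfolding has_partial_def by (intro ext) (blast intro: vector_derivative_unique_at)

lemma has_partial_at:
  assumes "has_partial a u u'"
  shows "((\<lambda>h. u (r + h *\<^sub>R axis a 1)) has_vector_derivative u' (r + t *\<^sub>R axis a 1)) (at t)"
proof -
  have "((\<lambda>h. u ((r + t *\<^sub>R axis a 1) + h *\<^sub>R axis a 1)) has_vector_derivative u' (r + t *\<^sub>R axis a 1)) (at (t - t))"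
    using assms by (simp add: has_partial_def)
  then have "(((\<lambda>h. u ((r + t *\<^sub>R axis a 1) + h *\<^sub>R axis a 1)) \<circ> (\<lambda>h. h - t)) has_vector_derivative 1 *\<^sub>R u' (r + t *\<^sub>R axis a 1)) (at t)"
    by (intro vector_diff_chain_at) (auto intro!: derivative_eq_intros)
  then show ?thesis
    by (simp add: o_def algebra_simps)
qed

lemma has_partial_increment_le:
  assumes "has_partial a u u'" "\<And>r. norm (u' r) \<le> M"
  shows "norm (u (r + t *\<^sub>R axis a 1) - u r) \<le> M * \<bar>t\<bar>"
proof -
  have "norm (u (r + t *\<^sub>R axis a 1) - u (r + 0 *\<^sub>R axis a 1)) \<le> M * norm (t - 0)"
  proof (rule differentiable_bound[where S = UNIV])
    show "((\<lambda>h. u (r + h *\<^sub>R axis a 1)) has_derivative (\<lambda>h. h *\<^sub>R u' (r + x *\<^sub>R axis a 1))) (at x within UNIV)" for x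
      using has_partial_at[OF assms(1), of r x] by (simp add: has_vector_derivative_def)
    show "onorm (\<lambda>h. h *\<^sub>R u' (r + x *\<^sub>R axis a 1)) \<le> M" for x
      using assms(2) by (subst onorm_scaleR_left) (auto simp: onorm_id)
  qed auto
  then show ?thesis by simp
qed

lemma has_partial_zero_outside:
  assumes "has_partial a u u'" and zero: "\<And>r. K < norm r \<Longrightarrow> u r = 0" and r: "K < norm r"
  shows "u' r = 0"
proof -
  have "((\<lambda>_. 0) has_vector_derivative u' r) (at 0)"
  proof (rule has_vector_derivative_transform_within_open)
    show "((\<lambda>h. u (r + h *\<^sub>R axis a 1)) has_vector_derivative u' r) (at 0)"
      using assms(1) by (simp add: has_partial_def)
    show "open {h. K < norm (r + h *\<^sub>R axis a 1)}"
      by (intro open_Collect_less continuous_intros)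
  qed (use r zero in auto)
  then show ?thesis
    by (rule vector_derivative_unique_at) simp
qed

lemma bounded_if_zero_outside:
  fixes u :: "real^'n \<Rightarrow> 'b::real_normed_vector"
  assumes "continuous_on UNIV u" "\<And>r. K < norm r \<Longrightarrow> u r = 0"
  obtains M where "0 \<le> M" "\<And>r. norm (u r) \<le> M"
proof -
  have "compact (u ` cball 0 K)"
    by (intro compact_continuous_image continuous_on_subset[OF assms(1)]) auto
  then obtain M where M: "\<And>r. r \<in> cball 0 K \<Longrightarrow> norm (u r) \<le> M"
    using compact_imp_bounded bounded_iff by (metis imageI)
  have "norm (u r) \<le> max 0 M" for r
    using M[of r] assms(2)[of r] by (cases "K < norm r") auto
  then show thesis
    by (intro that[of "max 0 M"]) auto
qed

text \<open>On the supporting ball \<open>|\<psi>| \<le> 1 + |\<psi>|^2\<close>, which is integrable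
  there because the ball has finite measure.\<close>

lemma integrable_compact_support_mult:
  fixes \<psi> :: "real^'n \<Rightarrow> complex"
  assumes [measurable]: "\<phi> \<in> borel_measurable borel" "\<psi> \<in> borel_measurable borel"
    and M: "\<And>r. \<bar>\<phi> r\<bar> \<le> M" and K: "\<And>r. K < norm r \<Longrightarrow> \<phi> r = 0"
    and L2: "integrable lborel (\<lambda>r. (cmod (\<psi> r))\<^sup>2)"
  shows "integrable lborel (\<lambda>r. \<phi> r *\<^sub>R \<psi> r)"
proof (rule Bochner_Integration.integrable_bound)
  have "integrable lborel (\<lambda>r::real^'n. indicator (cball 0 K) r * M)"
    by (intro integrable_mult_left integrable_real_indicator) (use emeasure_lborel_cball_finite in \<open>auto simp: infinity_ennreal_def\<close>)
  then show "integrable lborel (\<lambda>r. indicator (cball 0 K) r * M + M * (cmod (\<psi> r))\<^sup>2)"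
    using L2 by (intro Bochner_Integration.integrable_add integrable_mult_right) auto
  show "AE r in lborel. norm (\<phi> r *\<^sub>R \<psi> r) \<le> norm (indicator (cball 0 K) r * M + M * (cmod (\<psi> r))\<^sup>2)"
  proof (rule AE_I2)
    fix r :: "real^'n"
    have M0: "0 \<le> M" using M[of r] by linarith
    have "cmod (\<psi> r) \<le> 1 + (cmod (\<psi> r))\<^sup>2"
      using zero_le_power2[of "cmod (\<psi> r) - 1"] zero_le_power2[of "cmod (\<psi> r)"] unfolding power2_diff
      by (simp add: power2_eq_square) (use norm_ge_zero[of "\<psi> r"] in linarith)
    then have "\<bar>\<phi> r\<bar> * cmod (\<psi> r) \<le> M * (1 + (cmod (\<psi> r))\<^sup>2)"
      using M M0 by (intro mult_mono) auto
    then show "norm (\<phi> r *\<^sub>R \<psi> r) \<le> norm (indicator (cball 0 K) r * M + M * (cmod (\<psi> r))\<^sup>2)"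
      using M0 K[of r] by (cases "K < norm r") (auto simp: algebra_simps)
  qed
qed auto

section \<open>Translation invariance and integrals of derivatives\<close>

lemma lborel_integral_translate:
  fixes f :: "'a::euclidean_space \<Rightarrow> 'b::{banach, second_countable_topology}"
  assumes [measurable]: "f \<in> borel_measurable borel"
  shows "(LINT x|lborel. f (x + v)) = (LINT x|lborel. f x)"
proof -
  have "(LINT x|lborel. f x) = (LINT x|distr lborel borel ((+) v). f x)"
    by (simp add: lborel_distr_plus)
  also have "\<dots> = (LINT x|lborel. f (x + v))"
    by (subst integral_distr) (auto simp: add.commute)
  finally show ?thesis ..
qed

lemma lborel_nn_integral_translate:
  fixes f :: "'a::euclidean_space \<Rightarrow> ennreal"
  assumes [measurable]: "f \<in> borel_measurable borel"
  shows "(\<integral>\<^sup>+x. f (x + v) \<partial>lborel) = (\<integral>\<^sup>+x. f x \<partial>lborel)"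
proof -
  have "(\<integral>\<^sup>+x. f x \<partial>lborel) = (\<integral>\<^sup>+x. f x \<partial>distr lborel borel ((+) v))"
    by (simp add: lborel_distr_plus)
  also have "\<dots> = (\<integral>\<^sup>+x. f (x + v) \<partial>lborel)"
    by (subst nn_integral_distr) (auto simp: add.commute)
  finally show ?thesis ..
qed

lemma lborel_integrable_translate:
  fixes f :: "'a::euclidean_space \<Rightarrow> 'b::{banach, second_countable_topology}"
  assumes "integrable lborel f"
  shows "integrable lborel (\<lambda>x. f (x + v))"
proof -
  have [measurable]: "f \<in> borel_measurable borel"
    using borel_measurable_integrable[OF assms] by simp
  have "integrable (distr lborel borel ((+) v)) f"
    using assms by (simp add: lborel_distr_plus)
  then show ?thesis
    by (subst (asm) integrable_distr_eq) (auto simp: add.commute)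
qed

lemma has_vector_derivative_quotient_tendsto:
  assumes "(f has_vector_derivative D) (at 0)"
  shows "((\<lambda>h. (f h - f 0) /\<^sub>R h) \<longlongrightarrow> D) (at 0)"
proof -
  have "((\<lambda>h. norm (f h - f 0 - h *\<^sub>R D) / norm h) \<longlongrightarrow> 0) (at 0)"
    using assms by (simp add: has_vector_derivative_def has_derivative_at)
  moreover have "\<forall>\<^sub>F h in at 0. norm (f h - f 0 - h *\<^sub>R D) / norm h = norm ((f h - f 0) /\<^sub>R h - D)"
    unfolding eventually_at_filter
  proof (intro always_eventually allI impI)
    fix h :: real assume "h \<noteq> 0"
    then have "(f h - f 0) /\<^sub>R h - D = (f h - f 0 - h *\<^sub>R D) /\<^sub>R h"
      by (simp add: scaleR_diff_right)
    then show "norm (f h - f 0 - h *\<^sub>R D) / norm h = norm ((f h - f 0) /\<^sub>R h - D)"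
      by (simp add: divide_inverse mult.commute)
  qed
  ultimately have "((\<lambda>h. norm ((f h - f 0) /\<^sub>R h - D)) \<longlongrightarrow> 0) (at 0)"
    by (rule Lim_transform_eventually)
  then show ?thesis
    using tendsto_norm_zero_iff LIM_zero_iff by blast
qed

text \<open>By translation invariance every difference quotient of \<open>u\<close> has integral zero.\<close>

lemma integral_partial_eq_0:
  fixes u :: "real^'n \<Rightarrow> complex"
  assumes u: "has_partial a u u'"
    and meas [measurable]: "u \<in> borel_measurable borel" "u' \<in> borel_measurable borel"
    and M: "\<And>r. cmod (u r) \<le> M" "\<And>r. cmod (u' r) \<le> M"
    and K: "\<And>r. K < norm r \<Longrightarrow> u r = 0"
  shows "(LINT r|lborel. u' r) = 0"
proof -
  define v where "v n r = real (Suc n) *\<^sub>R (u (r + (1 / real (Suc n)) *\<^sub>R axis a 1) - u r)" for n r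
  have [measurable]: "v n \<in> borel_measurable borel" for n
    unfolding v_def by measurable
  have M0: "0 \<le> M" using M(1)[of 0] norm_ge_zero order_trans by blast
  have int_ball: "integrable lborel (\<lambda>r::real^'n. indicator (cball 0 c) r * M)" for c
    by (intro integrable_mult_left integrable_real_indicator) (use emeasure_lborel_cball_finite in \<open>auto simp: infinity_ennreal_def\<close>)
  have int_u: "integrable lborel u"
  proof (rule Bochner_Integration.integrable_bound[OF int_ball[of K]])
    have "norm (u r) \<le> norm (indicator (cball 0 K) r * M)" for r
      using M(1)[of r] K[of r] M0 by (cases "K < norm r") auto
    then show "AE r in lborel. norm (u r) \<le> norm (indicator (cball 0 K) r * M)" by simp
  qed auto
  have v0: "(LINT r|lborel. v n r) = 0" for n
    unfolding v_def using int_u by (simp add: lborel_integral_translate lborel_integrable_translate)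
  have "(\<lambda>n. LINT r|lborel. v n r) \<longlonglongrightarrow> (LINT r|lborel. u' r)"
  \<comment> \<open>The mean value bound \<open>M\<close> controls every quotient. The steps
    \<open>1 / Suc n\<close> are at most 1, so beyond radius \<open>K + 1\<close> both terms of the
    quotient vanish.\<close>
  proof (rule integral_dominated_convergence[where w = "\<lambda>r. indicator (cball 0 (K + 1)) r * M"])
    have "(\<lambda>n. v n r) \<longlonglongrightarrow> u' r" for r
    proof -
      have "((\<lambda>h. u (r + h *\<^sub>R axis a 1)) has_vector_derivative u' r) (at 0)"
        using u by (simp add: has_partial_def)
      from has_vector_derivative_quotient_tendsto[OF this]
      have "((\<lambda>h. (u (r + h *\<^sub>R axis a 1) - u r) /\<^sub>R h) \<longlongrightarrow> u' r) (at 0)"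
        by simp
      moreover have "filterlim (\<lambda>n. 1 / real (Suc n)) (at 0) sequentially"
        unfolding filterlim_at using LIMSEQ_inverse_real_of_nat by (auto simp: inverse_eq_divide)
      ultimately have "(\<lambda>n. (u (r + (1 / real (Suc n)) *\<^sub>R axis a 1) - u r) /\<^sub>R (1 / real (Suc n))) \<longlonglongrightarrow> u' r"
        by (rule filterlim_compose)
      then show ?thesis by (simp add: v_def)
    qed
    then show "AE r in lborel. (\<lambda>n. v n r) \<longlonglongrightarrow> u' r" by simp
    have "norm (v n r) \<le> indicator (cball 0 (K + 1)) r * M" for n r
    proof (cases "norm r \<le> K + 1")
      case True
      have "norm (u (r + (1 / real (Suc n)) *\<^sub>R axis a 1) - u r) \<le> M * \<bar>1 / real (Suc n)\<bar>"
        by (rule has_partial_increment_le[OF u M(2)])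
      then have "real (Suc n) * norm (u (r + (1 / real (Suc n)) *\<^sub>R axis a 1) - u r) \<le> real (Suc n) * (M * \<bar>1 / real (Suc n)\<bar>)"
        by (rule mult_left_mono) simp
      also have "\<dots> = M"
        by simp
      finally show ?thesis
        using True by (simp add: v_def del: of_nat_Suc)
    next
      case False
      have "norm r \<le> norm (r + (1 / real (Suc n)) *\<^sub>R axis a 1) + norm ((1 / real (Suc n)) *\<^sub>R axis a 1 :: real^'n)"
        using norm_triangle_ineq4[of "r + (1 / real (Suc n)) *\<^sub>R axis a 1" "(1 / real (Suc n)) *\<^sub>R axis a 1"] by simp
      moreover have "norm ((1 / real (Suc n)) *\<^sub>R axis a 1 :: real^'n) \<le> 1"
        by (simp add: norm_axis_1)
      ultimately have "K < norm (r + (1 / real (Suc n)) *\<^sub>R axis a 1)"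
        using False by linarith
      then show ?thesis
        using False K by (simp add: v_def)
    qed
    then show "AE r in lborel. norm (v n r) \<le> indicator (cball 0 (K + 1)) r * M" for n by simp
    show "integrable lborel (\<lambda>r::real^'n. indicator (cball 0 (K + 1)) r * M)"
      by (rule int_ball)
  qed auto
  then show ?thesis
    by (simp add: v0 LIMSEQ_const_iff)
qed

lemma has_partial_scaleR:
  assumes "has_partial a \<phi> \<phi>'" "has_partial a u u'"
  shows "has_partial a (\<lambda>r. \<phi> r *\<^sub>R u r) (\<lambda>r. \<phi>' r *\<^sub>R u r + \<phi> r *\<^sub>R u' r)"
proof -
  have "((\<lambda>h. \<phi> (r + h *\<^sub>R axis a 1) *\<^sub>R u (r + h *\<^sub>R axis a 1)) has_vector_derivative
      \<phi> (r + 0 *\<^sub>R axis a 1) *\<^sub>R u' r + \<phi>' r *\<^sub>R u (r + 0 *\<^sub>R axis a 1)) (at 0)" for r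
    using assms unfolding has_partial_def
    by (intro has_vector_derivative_scaleR) (auto simp: has_real_derivative_iff_has_vector_derivative)
  then show ?thesis by (simp add: has_partial_def add.commute)
qed

lemma test_funE:
  assumes "test_fun \<Phi>"
  obtains K M where "\<And>r. K < norm r \<Longrightarrow> \<Phi> r = 0" "\<And>r. \<bar>\<Phi> r\<bar> \<le> M" "\<Phi> \<in> borel_measurable borel"
proof -
  from assms obtain K where K: "\<And>r. K < norm r \<Longrightarrow> \<Phi> r = 0" and c: "continuous_on UNIV \<Phi>"
    by (auto simp: test_fun_def)
  obtain M where "\<And>r. norm (\<Phi> r) \<le> M"
    using bounded_if_zero_outside[OF c K] by blast
  with K c show thesis
    by (intro that[of K M]) (auto intro: borel_measurable_continuous_onI)
qed

lemma test_fun_partialE: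
  assumes "test_fun \<Phi>" "has_partial a \<Phi> \<Phi>'"
  obtains K M where "\<And>r. K < norm r \<Longrightarrow> \<Phi>' r = 0" "\<And>r. \<bar>\<Phi>' r\<bar> \<le> M" "\<Phi>' \<in> borel_measurable borel"
proof -
  from assms obtain K where K: "\<And>r. K < norm r \<Longrightarrow> \<Phi> r = 0" and c: "continuous_on UNIV \<Phi>'"
    unfolding test_fun_def using has_partial_unique by blast
  have K': "\<Phi>' r = 0" if "K < norm r" for r
    using has_partial_zero_outside[OF assms(2) K that] by blast
  obtain M where "\<And>r. norm (\<Phi>' r) \<le> M"
    using bounded_if_zero_outside[OF c K'] by blast
  with K' c show thesis
    by (intro that[of K M]) (auto intro: borel_measurable_continuous_onI)
qed

text \<open>Integration by parts: the product of \<open>u\<close> with a test function has bounded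
  support and bounded derivative, so the integral of its derivative is zero; the product rule splits
  it.\<close>

lemma weak_partial_classical:
  assumes u: "has_partial a u u'"
    and meas [measurable]: "u \<in> borel_measurable borel" "u' \<in> borel_measurable borel"
    and C: "\<And>r. cmod (u r) \<le> C" "\<And>r. cmod (u' r) \<le> C'"
    and L2: "integrable lborel (\<lambda>r. (cmod (u r))\<^sup>2)" "integrable lborel (\<lambda>r. (cmod (u' r))\<^sup>2)"
  shows "weak_partial a u u'"
  unfolding weak_partial_def
proof (intro allI impI)
  fix \<Phi> \<Phi>' assume \<Phi>: "test_fun \<Phi>" and \<Phi>': "has_partial a \<Phi> \<Phi>'"
  obtain K M where K: "\<And>r. K < norm r \<Longrightarrow> \<Phi> r = 0" and M: "\<And>r. \<bar>\<Phi> r\<bar> \<le> M" and [measurable]: "\<Phi> \<in> borel_measurable borel"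
    by (rule test_funE[OF \<Phi>]) (rule that)
  obtain K' M' where K': "\<And>r. K' < norm r \<Longrightarrow> \<Phi>' r = 0" and M': "\<And>r. \<bar>\<Phi>' r\<bar> \<le> M'" and [measurable]: "\<Phi>' \<in> borel_measurable borel"
    by (rule test_fun_partialE[OF \<Phi> \<Phi>']) (rule that)
  have nonneg: "0 \<le> M" "0 \<le> M'" "0 \<le> C" "0 \<le> C'"
    using M[of 0] M'[of 0] C(1)[of 0] C(2)[of 0] norm_ge_zero[of "u 0"] norm_ge_zero[of "u' 0"] by linarith+
  have "(LINT r|lborel. \<Phi>' r *\<^sub>R u r + \<Phi> r *\<^sub>R u' r) = 0"
  proof (rule integral_partial_eq_0[OF has_partial_scaleR[OF \<Phi>' u]])
    show "cmod (\<Phi> r *\<^sub>R u r) \<le> max (M * C) (M' * C + M * C')" for r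
    proof -
      have "cmod (\<Phi> r *\<^sub>R u r) \<le> M * C"
        using M C nonneg by (auto intro!: mult_mono)
      then show ?thesis by simp
    qed
    show "cmod (\<Phi>' r *\<^sub>R u r + \<Phi> r *\<^sub>R u' r) \<le> max (M * C) (M' * C + M * C')" for r
    proof -
      have "cmod (\<Phi>' r *\<^sub>R u r + \<Phi> r *\<^sub>R u' r) \<le> M' * C + M * C'"
        using M M' C nonneg by (intro norm_triangle_mono) (auto intro!: mult_mono)
      then show ?thesis by simp
    qed
    show "\<Phi> r *\<^sub>R u r = 0" if "K < norm r" for r
      using K that by simp
  qed auto
  moreover have "integrable lborel (\<lambda>r. \<Phi>' r *\<^sub>R u r)"
    by (rule integrable_compact_support_mult[OF _ _ M' K' L2(1)]) auto
  moreover have "integrable lborel (\<lambda>r. \<Phi> r *\<^sub>R u' r)"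
    by (rule integrable_compact_support_mult[OF _ _ M K L2(2)]) auto
  ultimately show "(LINT r|lborel. \<Phi>' r *\<^sub>R u r) = - (LINT r|lborel. \<Phi> r *\<^sub>R u' r)"
    by (simp add: eq_neg_iff_add_eq_0)
qed

section \<open>Product rule for weak derivatives\<close>

lemma test_fun_mult:
  assumes "test_fun \<Phi>" "continuous_on UNIV c" "\<And>b. \<exists>c'. has_partial b c c' \<and> continuous_on UNIV c'"
  shows "test_fun (\<lambda>r. \<Phi> r * c r)"
  unfolding test_fun_def
proof (intro conjI allI)
  have c\<Phi>: "continuous_on UNIV \<Phi>"
    using assms(1) by (simp add: test_fun_def)
  then show "continuous_on UNIV (\<lambda>r. \<Phi> r * c r)"
    using assms(2) by (intro continuous_intros)
  show "\<exists>K. \<forall>r. K < norm r \<longrightarrow> \<Phi> r * c r = 0"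
    using assms(1) unfolding test_fun_def by (metis mult_zero_left)
  fix a
  obtain \<Phi>' c' where "has_partial a \<Phi> \<Phi>'" "continuous_on UNIV \<Phi>'" "has_partial a c c'" "continuous_on UNIV c'"
    using assms(1,3) unfolding test_fun_def by blast
  then show "\<exists>\<Phi>'. has_partial a (\<lambda>r. \<Phi> r * c r) \<Phi>' \<and> continuous_on UNIV \<Phi>'"
    using has_partial_scaleR[of a \<Phi> \<Phi>' c c'] c\<Phi> assms(2)
    by (intro exI[of _ "\<lambda>r. \<Phi>' r * c r + \<Phi> r * c' r"]) (auto intro!: continuous_intros)
qed

lemma weak_partialD:
  assumes "weak_partial a \<psi> g" "test_fun \<Phi>" "has_partial a \<Phi> \<Phi>'"
  shows "(LINT r|lborel. \<Phi>' r *\<^sub>R \<psi> r) = - (LINT r|lborel. \<Phi> r *\<^sub>R g r)"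
  using assms by (simp add: weak_partial_def)

lemma has_partial_Re: "has_partial a u u' \<Longrightarrow> has_partial a (\<lambda>r. Re (u r)) (\<lambda>r. Re (u' r))"
  unfolding has_partial_def by (intro allI bounded_linear.has_vector_derivative[OF bounded_linear_Re]) simp

lemma has_partial_Im: "has_partial a u u' \<Longrightarrow> has_partial a (\<lambda>r. Im (u r)) (\<lambda>r. Im (u' r))"
  unfolding has_partial_def by (intro allI bounded_linear.has_vector_derivative[OF bounded_linear_Im]) simp

lemma integrable_test_fun_mult:
  assumes "test_fun \<Phi>" "\<psi> \<in> borel_measurable borel" "integrable lborel (\<lambda>r. (cmod (\<psi> r))\<^sup>2)"
  shows "integrable lborel (\<lambda>r. \<Phi> r *\<^sub>R \<psi> r)"
  by (rule test_funE[OF assms(1)]) (rule integrable_compact_support_mult[OF _ assms(2) _ _ assms(3)])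

lemma integrable_test_fun_partial_mult:
  assumes "test_fun \<Phi>" "has_partial a \<Phi> \<Phi>'" "\<psi> \<in> borel_measurable borel" "integrable lborel (\<lambda>r. (cmod (\<psi> r))\<^sup>2)"
  shows "integrable lborel (\<lambda>r. \<Phi>' r *\<^sub>R \<psi> r)"
  by (rule test_fun_partialE[OF assms(1,2)]) (rule integrable_compact_support_mult[OF _ assms(3) _ _ assms(4)])

text \<open>The factor \<open>c\<close> is moved onto the test function: \<open>\<Phi> c\<close> is
  again a test function, and testing \<open>g\<close> with it produces the extra term with
  \<open>c'\<close>.\<close>

lemma weak_partial_mult_real:
  assumes w: "weak_partial a \<psi> g"
    and \<psi>: "\<psi> \<in> borel_measurable borel" "integrable lborel (\<lambda>r. (cmod (\<psi> r))\<^sup>2)"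
    and c: "continuous_on UNIV c" "\<And>b. \<exists>c'. has_partial b c c' \<and> continuous_on UNIV c'" "has_partial a c c'"
    and \<Phi>: "test_fun \<Phi>" and \<Phi>': "has_partial a \<Phi> \<Phi>'"
  shows "integrable lborel (\<lambda>r. (\<Phi>' r * c r) *\<^sub>R \<psi> r)"
    "integrable lborel (\<lambda>r. (\<Phi> r * c' r) *\<^sub>R \<psi> r)"
    "(LINT r|lborel. (\<Phi>' r * c r) *\<^sub>R \<psi> r) = - (LINT r|lborel. (\<Phi> r * c' r) *\<^sub>R \<psi> r) - (LINT r|lborel. (\<Phi> r * c r) *\<^sub>R g r)"
proof -
  have c': "continuous_on UNIV c'"
    using c(2)[of a] c(3) has_partial_unique by blast
  have [measurable]: "c \<in> borel_measurable borel" "c' \<in> borel_measurable borel" "\<psi> \<in> borel_measurable borel"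
    using c(1) c' \<psi> by (auto intro: borel_measurable_continuous_onI)
  have \<Phi>c: "test_fun (\<lambda>r. \<Phi> r * c r)"
    by (rule test_fun_mult[OF \<Phi> c(1,2)])
  have \<Phi>c': "has_partial a (\<lambda>r. \<Phi> r * c r) (\<lambda>r. \<Phi>' r * c r + \<Phi> r * c' r)"
    using has_partial_scaleR[OF \<Phi>' c(3)] by simp
  obtain K M where K: "\<And>r. K < norm r \<Longrightarrow> \<Phi> r = 0" and [measurable]: "\<Phi> \<in> borel_measurable borel"
    by (rule test_funE[OF \<Phi>]) (rule that)
  have "continuous_on UNIV (\<lambda>r. \<Phi> r * c' r)"
    using \<Phi> c' by (auto simp: test_fun_def intro!: continuous_intros)
  from bounded_if_zero_outside[OF this, of K] K
  obtain M where M: "\<And>r. \<bar>\<Phi> r * c' r\<bar> \<le> M"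
    by (metis mult_zero_left real_norm_def)
  show i2: "integrable lborel (\<lambda>r. (\<Phi> r * c' r) *\<^sub>R \<psi> r)"
    by (rule integrable_compact_support_mult[OF _ _ M _ \<psi>(2), where K = K]) (auto simp: K)
  have i12: "integrable lborel (\<lambda>r. (\<Phi>' r * c r + \<Phi> r * c' r) *\<^sub>R \<psi> r)"
    by (rule integrable_test_fun_partial_mult[OF \<Phi>c \<Phi>c' \<psi>])
  have "integrable lborel (\<lambda>r. (\<Phi>' r * c r + \<Phi> r * c' r) *\<^sub>R \<psi> r - (\<Phi> r * c' r) *\<^sub>R \<psi> r)"
    by (intro Bochner_Integration.integrable_diff i2 i12)
  then show i1: "integrable lborel (\<lambda>r. (\<Phi>' r * c r) *\<^sub>R \<psi> r)"
    by (simp add: scaleR_add_left)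
  have "(LINT r|lborel. (\<Phi>' r * c r + \<Phi> r * c' r) *\<^sub>R \<psi> r) = - (LINT r|lborel. (\<Phi> r * c r) *\<^sub>R g r)"
    by (rule weak_partialD[OF w \<Phi>c \<Phi>c'])
  then show "(LINT r|lborel. (\<Phi>' r * c r) *\<^sub>R \<psi> r) = - (LINT r|lborel. (\<Phi> r * c' r) *\<^sub>R \<psi> r) - (LINT r|lborel. (\<Phi> r * c r) *\<^sub>R g r)"
    using i1 i2 by (simp add: scaleR_add_left eq_diff_eq eq_neg_iff_add_eq_0 ac_simps)
qed

lemma integral_add_ii:
  fixes f g :: "'a \<Rightarrow> complex"
  assumes "integrable M f" "integrable M g"
  shows "integrable M (\<lambda>x. f x + \<i> * g x)"
    "(LINT x|M. f x + \<i> * g x) = (LINT x|M. f x) + \<i> * (LINT x|M. g x)"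
  using assms by simp_all

text \<open>Test functions are real, so a complex factor such as a gauge phase is treated through
  its real and imaginary parts and reassembled by linearity.\<close>

lemma weak_partial_mult:
  assumes w: "weak_partial a \<psi> g"
    and \<psi>: "\<psi> \<in> borel_measurable borel" "integrable lborel (\<lambda>r. (cmod (\<psi> r))\<^sup>2)"
    and g: "g \<in> borel_measurable borel" "integrable lborel (\<lambda>r. (cmod (g r))\<^sup>2)"
    and c: "continuous_on UNIV c" "\<And>b. \<exists>c'. has_partial b c c' \<and> continuous_on UNIV c'" "has_partial a c c'"
  shows "weak_partial a (\<lambda>r. c r * \<psi> r) (\<lambda>r. c' r * \<psi> r + c r * g r)"
  unfolding weak_partial_def
proof (intro allI impI)
  fix \<Phi> \<Phi>' assume \<Phi>: "test_fun \<Phi>" and \<Phi>': "has_partial a \<Phi> \<Phi>'"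
  have re: "continuous_on UNIV (\<lambda>r. Re (c r))" "\<exists>c'. has_partial b (\<lambda>r. Re (c r)) c' \<and> continuous_on UNIV c'" for b
    using c(1,2) has_partial_Re by (blast intro!: continuous_intros)+
  have im: "continuous_on UNIV (\<lambda>r. Im (c r))" "\<exists>c'. has_partial b (\<lambda>r. Im (c r)) c' \<and> continuous_on UNIV c'" for b
    using c(1,2) has_partial_Im by (blast intro!: continuous_intros)+
  note R = weak_partial_mult_real[OF w \<psi> re has_partial_Re[OF c(3)] \<Phi> \<Phi>']
  note I = weak_partial_mult_real[OF w \<psi> im has_partial_Im[OF c(3)] \<Phi> \<Phi>']
  have Rg: "integrable lborel (\<lambda>r. (\<Phi> r * Re (c r)) *\<^sub>R g r)"
    by (rule integrable_test_fun_mult[OF test_fun_mult[OF \<Phi> re] g])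
  have Ig: "integrable lborel (\<lambda>r. (\<Phi> r * Im (c r)) *\<^sub>R g r)"
    by (rule integrable_test_fun_mult[OF test_fun_mult[OF \<Phi> im] g])
  have split: "x *\<^sub>R (z * y) = (x * Re z) *\<^sub>R y + \<i> * ((x * Im z) *\<^sub>R y)" for x :: real and y z :: complex
    by (simp add: complex_eq_iff algebra_simps)
  note intR = integral_add_ii[OF R(1) I(1)] and int1 = integral_add_ii[OF R(2) I(2)] and int2 = integral_add_ii[OF Rg Ig]
  have "(LINT r|lborel. \<Phi> r *\<^sub>R (c' r * \<psi> r + c r * g r)) =
      (LINT r|lborel. \<Phi> r *\<^sub>R (c' r * \<psi> r)) + (LINT r|lborel. \<Phi> r *\<^sub>R (c r * g r))"
    using int1(1) int2(1) by (simp only: split[symmetric] scaleR_add_right Bochner_Integration.integral_add)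
  then show "(LINT r|lborel. \<Phi>' r *\<^sub>R (c r * \<psi> r)) = - (LINT r|lborel. \<Phi> r *\<^sub>R (c' r * \<psi> r + c r * g r))"
    using intR(2) int1(2) int2(2) R(3) I(3) by (simp only: split[symmetric]) (simp add: algebra_simps)
qed

section \<open>Test functions in product form and uniqueness\<close>

lemma has_partial_prod:
  fixes \<omega> :: "'n::finite \<Rightarrow> real \<Rightarrow> real"
  assumes "\<And>x. (\<omega> a has_real_derivative \<omega>' x) (at x)"
  shows "has_partial a (\<lambda>r. \<Prod>b\<in>UNIV. \<omega> b (r $ b)) (\<lambda>r. \<omega>' (r $ a) * (\<Prod>b\<in>UNIV - {a}. \<omega> b (r $ b)))"
  unfolding has_partial_def
proof
  fix r :: "real^'n"
  have eq: "(\<Prod>b\<in>UNIV. \<omega> b ((r + h *\<^sub>R axis a 1) $ b)) = \<omega> a (r $ a + h) * (\<Prod>b\<in>UNIV - {a}. \<omega> b (r $ b))" for h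
    by (subst prod.remove[of _ a]) (auto simp: axis_def intro!: prod.cong)
  have "((\<lambda>h. \<omega> a (r $ a + h)) has_real_derivative \<omega>' (r $ a)) (at 0)"
    using assms[of "r $ a"] DERIV_shift[of "\<omega> a" "\<omega>' (r $ a)" 0 "r $ a"] by (simp add: add.commute)
  then show "((\<lambda>h. \<Prod>b\<in>UNIV. \<omega> b ((r + h *\<^sub>R axis a 1) $ b)) has_vector_derivative
      \<omega>' (r $ a) * (\<Prod>b\<in>UNIV - {a}. \<omega> b (r $ b))) (at 0)"
    unfolding eq has_real_derivative_iff_has_vector_derivative[symmetric]
    by (auto intro!: derivative_eq_intros)
qed

lemma test_fun_prod:
  fixes \<omega> \<omega>' :: "'n::finite \<Rightarrow> real \<Rightarrow> real"
  assumes der: "\<And>a x. (\<omega> a has_real_derivative \<omega>' a x) (at x)"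
    and cont: "\<And>a. continuous_on UNIV (\<omega>' a)"
    and K: "\<And>r :: real^'n. K < norm r \<Longrightarrow> (\<Prod>b\<in>UNIV. \<omega> b (r $ b)) = 0"
  shows "test_fun (\<lambda>r. \<Prod>b\<in>UNIV. \<omega> b (r $ b))"
proof -
  have c: "continuous_on UNIV (\<lambda>r::real^'n. f (r $ b))" if "continuous_on UNIV f" for f :: "real \<Rightarrow> real" and b
    by (rule continuous_on_compose2[OF that]) (auto intro!: continuous_intros)
  have c\<omega>: "continuous_on UNIV (\<omega> b)" for b
    using der by (meson DERIV_isCont continuous_at_imp_continuous_on)
  show ?thesis
    unfolding test_fun_def
  proof (intro conjI allI)
    show "\<exists>\<Phi>'. has_partial a (\<lambda>r. \<Prod>b\<in>UNIV. \<omega> b (r $ b)) \<Phi>' \<and> continuous_on UNIV \<Phi>'" for a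
      by (intro exI conjI, rule has_partial_prod[of \<omega> a, OF der]) (intro continuous_intros c c\<omega> cont)
    show "\<exists>K. \<forall>r :: real^'n. K < norm r \<longrightarrow> (\<Prod>b\<in>UNIV. \<omega> b (r $ b)) = 0"
      using K by blast
  qed (intro continuous_intros c c\<omega>)
qed

lemma box_norm_bound:
  fixes l u :: "'a::euclidean_space"
  obtains K where "\<And>r. r \<in> box l u \<Longrightarrow> norm r \<le> K"
  using bounded_box[of l u] unfolding bounded_iff by blast

lemma test_fun_box_window: "test_fun (box_window n l u)"
proof -
  obtain K where K: "\<And>r. r \<in> box l u \<Longrightarrow> norm r \<le> K"
    by (rule box_norm_bound) (rule that)
  have "box_window n l u r = 0" if "K < norm r" for r
    using K[of r] that by (intro box_window_outside) auto
  then show ?thesis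
    unfolding box_window_def[abs_def]
    by (intro test_fun_prod[OF DERIV_window, where K = K]) (auto intro!: continuous_intros)
qed

lemma integrable_box_mult:
  fixes f :: "real^'n \<Rightarrow> complex"
  assumes [measurable]: "f \<in> borel_measurable borel" and L2: "integrable lborel (\<lambda>r. (cmod (f r))\<^sup>2)"
  shows "integrable lborel (\<lambda>x. indicator (box l u) x *\<^sub>R f x)"
proof -
  obtain K where K: "\<And>r. r \<in> box l u \<Longrightarrow> norm r \<le> K"
    by (rule box_norm_bound) (rule that)
  show ?thesis
    by (rule integrable_compact_support_mult[OF _ _ _ _ L2, of _ 1 K]) (auto simp: indicator_def dest: K)
qed

text \<open>\<open>wgrad\<close> is an arbitrary choice among weak gradients; this is what makes
  energies and currents of explicit states computable.\<close>

lemma weak_partial_unique: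
  fixes g g' :: "real^'n \<Rightarrow> complex"
  assumes w: "weak_partial a \<psi> g" "weak_partial a \<psi> g'"
    and g: "g \<in> borel_measurable borel" "integrable lborel (\<lambda>r. (cmod (g r))\<^sup>2)"
    and g': "g' \<in> borel_measurable borel" "integrable lborel (\<lambda>r. (cmod (g' r))\<^sup>2)"
  shows "AE r in lborel. g r = g' r"
proof -
  have [measurable]: "g \<in> borel_measurable borel" "g' \<in> borel_measurable borel"
    by fact+
  have "AE r in lborel. g r - g' r = 0"
  proof (rule AE_eq_0_if_window_integrals_0)
    show "integrable lborel (\<lambda>x. indicator (box l u) x *\<^sub>R (g x - g' x))" for l u
      unfolding scaleR_diff_right by (intro Bochner_Integration.integrable_diff integrable_box_mult g g')
    show "(LINT x|lborel. box_window n l u x *\<^sub>R (g x - g' x)) = 0" for n l u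
    proof -
      obtain \<Phi>' where "has_partial a (box_window n l u) \<Phi>'"
        using test_fun_box_window unfolding test_fun_def by blast
      then have
        "(LINT x|lborel. \<Phi>' x *\<^sub>R \<psi> x) = - (LINT x|lborel. box_window n l u x *\<^sub>R g x)"
        "(LINT x|lborel. \<Phi>' x *\<^sub>R \<psi> x) = - (LINT x|lborel. box_window n l u x *\<^sub>R g' x)"
        by (rule weak_partialD[OF w(1) test_fun_box_window], rule weak_partialD[OF w(2) test_fun_box_window])
      then show ?thesis
        by (simp add: scaleR_diff_right integrable_test_fun_mult[OF test_fun_box_window g]
            integrable_test_fun_mult[OF test_fun_box_window g'])
    qed
  qed auto
  then show ?thesis by simp
qed

subsection \<open>Increments of functions with a weak derivative\<close>

lemma abs_box_window_le: "\<bar>box_window n l u r\<bar> \<le> 1"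
  using box_window_bounds[of n l u r] by simp

lemma window_primitive:
  obtains \<Omega> where "\<And>x. (\<Omega> has_real_derivative window n l u x) (at x)"
proof -
  have "isCont (window n l u) x" for x
    using DERIV_isCont[OF DERIV_window] .
  then obtain F where "\<And>x. (F has_vector_derivative window n l u x) (at x)"
    using einterval_antiderivative[of "-\<infinity>" \<infinity> "window n l u"] by auto
  then show thesis
    by (intro that) (simp add: has_real_derivative_iff_has_vector_derivative)
qed

text \<open>Averaging a window over the translates along a segment changes only its factor in
  coordinate \<open>a\<close>, which becomes \<open>\<Omega> x - \<Omega> (x - t)\<close> for a
  primitive \<open>\<Omega>\<close>. Its derivative is a difference of two translated windows, so
  testing a weak derivative with it yields an increment of \<open>\<psi>\<close>.\<close>

lemma segment_test_fun:
  fixes a :: "'n::finite"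
  assumes t: "0 \<le> t"
  obtains \<Phi> where "test_fun \<Phi>"
    "has_partial a \<Phi> (\<lambda>r. box_window n l u r - box_window n l u (r - t *\<^sub>R axis a 1))"
    "\<And>r. (LINT s|lborel. indicator {0..t} s * box_window n l u (r - s *\<^sub>R axis a 1)) = \<Phi> r"
proof -
  obtain \<Omega> where \<Omega>: "\<And>x. (\<Omega> has_real_derivative window n (l $ a) (u $ a) x) (at x)"
    by (rule window_primitive) (rule that)
  define \<omega> where "\<omega> b = (if b = a then \<lambda>x. \<Omega> x - \<Omega> (x - t) else window n (l $ b) (u $ b))" for b
  define \<omega>' where "\<omega>' b = (if b = a then \<lambda>x. window n (l $ a) (u $ a) x - window n (l $ a) (u $ a) (x - t) else window_deriv n (l $ b) (u $ b))" for b
  define \<Phi> where "\<Phi> r = (\<Prod>b\<in>UNIV. \<omega> b (r $ b))" for r :: "real^'n"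
  define P where "P r = (\<Prod>b\<in>UNIV - {a}. window n (l $ b) (u $ b) (r $ b))" for r :: "real^'n"
  have \<omega>: "(\<omega> b has_real_derivative \<omega>' b x) (at x)" for b x
    unfolding \<omega>_def \<omega>'_def using \<Omega>[of x] \<Omega>[of "x - t"] DERIV_shift[of \<Omega> _ x "- t"]
    by (auto intro!: DERIV_diff DERIV_window)
  have \<Phi>_eq: "\<Phi> r = (\<Omega> (r $ a) - \<Omega> (r $ a - t)) * P r" for r
    unfolding \<Phi>_def P_def by (subst prod.remove[of _ a]) (auto simp: \<omega>_def intro!: prod.cong)
  have window_eq: "box_window n l u (r - s *\<^sub>R axis a 1) = window n (l $ a) (u $ a) (r $ a - s) * P r" for r s
    unfolding box_window_def P_def by (subst prod.remove[of _ a]) (auto simp: axis_def intro!: prod.cong)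
  have integral: "(LINT s|lborel. indicator {0..t} s * box_window n l u (r - s *\<^sub>R axis a 1)) = \<Phi> r" for r
  proof -
    have "(LINT s|lborel. window n (l $ a) (u $ a) (r $ a - s) * P r * indicator {0..t} s)
        = (- \<Omega> (r $ a - t) * P r) - (- \<Omega> (r $ a - 0) * P r)"
    proof (rule integral_FTC_Icc_real[OF t])
      show "((\<lambda>s. - \<Omega> (r $ a - s) * P r) has_real_derivative window n (l $ a) (u $ a) (r $ a - s) * P r) (at s)" for s
        by (rule derivative_eq_intros DERIV_chain2[OF \<Omega>] refl | simp)+
      show "isCont (\<lambda>s. window n (l $ a) (u $ a) (r $ a - s) * P r) s" for s
        by (intro continuous_on_interior[of UNIV] continuous_intros) auto
    qed
    then show ?thesis
      by (simp add: window_eq \<Phi>_eq algebra_simps)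
  qed
  obtain K where K: "\<And>r. r \<in> box l u \<Longrightarrow> norm r \<le> K"
    by (rule box_norm_bound) (rule that)
  have zero: "\<Phi> r = 0" if r: "K + t < norm r" for r
  proof -
    have "indicator {0..t} s * box_window n l u (r - s *\<^sub>R axis a 1) = 0" for s
    proof (cases "s \<in> {0..t}")
      case True
      have "norm r \<le> norm (r - s *\<^sub>R axis a 1) + norm (s *\<^sub>R axis a 1 :: real^'n)"
        using norm_triangle_ineq[of "r - s *\<^sub>R axis a 1" "s *\<^sub>R axis a 1"] by simp
      then have "K < norm (r - s *\<^sub>R axis a 1)"
        using True r by (simp add: norm_axis_1)
      then show ?thesis
        using K[of "r - s *\<^sub>R axis a 1"] by (subst box_window_outside) auto
    qed simp
    then show ?thesis
      unfolding integral[symmetric] by (simp only: Bochner_Integration.integral_zero)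
  qed
  show thesis
  proof (rule that[of \<Phi>])
    show "test_fun \<Phi>"
      unfolding \<Phi>_def[abs_def]
    proof (rule test_fun_prod[OF \<omega>])
      show "continuous_on UNIV (\<omega>' b)" for b
        unfolding \<omega>'_def by (auto intro!: continuous_intros)
      show "(\<Prod>b\<in>UNIV. \<omega> b (r $ b)) = 0" if "K + t < norm r" for r :: "real^'n"
        using zero[OF that] by (simp add: \<Phi>_def)
    qed
    have "has_partial a \<Phi> (\<lambda>r. \<omega>' a (r $ a) * (\<Prod>b\<in>UNIV - {a}. \<omega> b (r $ b)))"
      unfolding \<Phi>_def[abs_def] by (rule has_partial_prod[OF \<omega>])
    moreover have "\<omega>' a (r $ a) * (\<Prod>b\<in>UNIV - {a}. \<omega> b (r $ b)) =
        box_window n l u r - box_window n l u (r - t *\<^sub>R axis a 1)" for r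
      using window_eq[of r 0] window_eq[of r t]
      by (simp add: \<omega>'_def \<omega>_def P_def left_diff_distrib)
    ultimately show "has_partial a \<Phi> (\<lambda>r. box_window n l u r - box_window n l u (r - t *\<^sub>R axis a 1))"
      by simp
  qed (rule integral)
qed

text \<open>Justifies the Fubini exchanges below. As \<open>|g| \<le> 1 + |g|^2\<close>, Tonelli and
  translation invariance bound the double integral by \<open>t\<close> times the volume of the box
  plus the squared norm of \<open>g\<close>.\<close>

lemma integrable_segment:
  fixes g :: "real^'n \<Rightarrow> complex"
  assumes g [measurable]: "g \<in> borel_measurable borel" and L2: "integrable lborel (\<lambda>r. (cmod (g r))\<^sup>2)"
  shows "integrable (lborel \<Otimes>\<^sub>M lborel) (\<lambda>(s, r). indicator {0..t} s *\<^sub>R (indicator (box l u) r *\<^sub>R g (r + s *\<^sub>R v)))"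
proof (rule integrableI_bounded)
  define C where "C = emeasure lborel (box l u) + (\<integral>\<^sup>+r. ennreal ((cmod (g r))\<^sup>2) \<partial>lborel)"
  show "(\<lambda>(s, r). indicator {0..t} s *\<^sub>R (indicator (box l u) r *\<^sub>R g (r + s *\<^sub>R v))) \<in> borel_measurable (lborel \<Otimes>\<^sub>M lborel)"
    by measurable
  have "C < \<infinity>"
    unfolding C_def using L2 emeasure_lborel_box_finite[of l u]
    by (auto simp: integrable_iff_bounded)
  have pointwise: "ennreal (norm (indicator {0..t} s *\<^sub>R (indicator (box l u) r *\<^sub>R g (r + s *\<^sub>R v)))) \<le>
      indicator {0..t} s * (indicator (box l u) r + ennreal ((cmod (g (r + s *\<^sub>R v)))\<^sup>2))" for s :: real and r
  proof -
    have "cmod z \<le> 1 + (cmod z)\<^sup>2" for z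
      using zero_le_power2[of "cmod z - 1"] unfolding power2_diff
      by (simp add: power2_eq_square) (use norm_ge_zero[of z] in linarith)
    then have "ennreal (cmod (g (r + s *\<^sub>R v))) \<le> 1 + ennreal ((cmod (g (r + s *\<^sub>R v)))\<^sup>2)"
      by (metis ennreal_1 ennreal_leI ennreal_plus zero_le_one zero_le_power2)
    then show ?thesis
      by (auto simp: indicator_def)
  qed
  have "(\<integral>\<^sup>+p. ennreal (norm ((\<lambda>(s, r). indicator {0..t} s *\<^sub>R (indicator (box l u) r *\<^sub>R g (r + s *\<^sub>R v))) p)) \<partial>(lborel \<Otimes>\<^sub>M lborel))
      \<le> (\<integral>\<^sup>+p. (\<lambda>(s, r). indicator {0..t} s * (indicator (box l u) r + ennreal ((cmod (g (r + s *\<^sub>R v)))\<^sup>2))) p \<partial>(lborel \<Otimes>\<^sub>M lborel))"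
    using pointwise by (intro nn_integral_mono) (auto split: prod.split)
  also have "\<dots> = (\<integral>\<^sup>+s. \<integral>\<^sup>+r. indicator {0..t} s * (indicator (box l u) r + ennreal ((cmod (g (r + s *\<^sub>R v)))\<^sup>2)) \<partial>lborel \<partial>lborel)"
    by (subst lborel.nn_integral_fst[symmetric]) auto
  also have "\<dots> = (\<integral>\<^sup>+s. indicator {0..t} s * C \<partial>lborel)"
  proof (intro nn_integral_cong)
    fix s :: real
    have "(\<integral>\<^sup>+r. ennreal ((cmod (g (r + s *\<^sub>R v)))\<^sup>2) \<partial>lborel) = (\<integral>\<^sup>+r. ennreal ((cmod (g r))\<^sup>2) \<partial>lborel)"
      by (rule lborel_nn_integral_translate) auto
    then show "(\<integral>\<^sup>+r. indicator {0..t} s * (indicator (box l u) r + ennreal ((cmod (g (r + s *\<^sub>R v)))\<^sup>2)) \<partial>lborel) = indicator {0..t} s * C"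
      by (simp add: nn_integral_cmult nn_integral_add C_def)
  qed
  also have "\<dots> < \<infinity>"
    using \<open>C < \<infinity>\<close> by (simp add: nn_integral_multc ennreal_mult_less_top emeasure_lborel_Icc_eq)
  finally show "(\<integral>\<^sup>+p. ennreal (norm ((\<lambda>(s, r). indicator {0..t} s *\<^sub>R (indicator (box l u) r *\<^sub>R g (r + s *\<^sub>R v))) p)) \<partial>(lborel \<Otimes>\<^sub>M lborel)) < \<infinity>" .
qed

lemma integral_scaleR_swap:
  fixes h :: "'a \<Rightarrow> 'b::{banach, second_countable_topology}"
  shows "(LINT s|M. f s *\<^sub>R (c *\<^sub>R h s)) = c *\<^sub>R (LINT s|M. f s *\<^sub>R h s)"
  by (simp only: scaleR_left_commute[of _ c] integral_scaleR_right)

text \<open>Cauchy-Schwarz on the segment, with the indicator of \<open>{0..t}\<close> as second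
  factor.\<close>

lemma norm_segment_integral_le:
  fixes g :: "real^'n \<Rightarrow> complex"
  assumes t: "0 \<le> t" and [measurable]: "g \<in> borel_measurable borel"
  shows "ennreal ((cmod (LINT s|lborel. indicator {0..t} s *\<^sub>R g (r + s *\<^sub>R v)))\<^sup>2) \<le>
    ennreal t * (\<integral>\<^sup>+s. indicator {0..t} s * ennreal ((cmod (g (r + s *\<^sub>R v)))\<^sup>2) \<partial>lborel)"
proof -
  let ?J = "LINT s|lborel. indicator {0..t} s *\<^sub>R g (r + s *\<^sub>R v)"
  have "ennreal (cmod ?J) \<le> (\<integral>\<^sup>+s. ennreal (cmod (indicator {0..t} s *\<^sub>R g (r + s *\<^sub>R v))) \<partial>lborel)"
  proof (cases "integrable lborel (\<lambda>s. indicator {0..t} s *\<^sub>R g (r + s *\<^sub>R v))")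
    case True
    then show ?thesis
      by (rule integral_norm_bound_ennreal)
  next
    \<comment> \<open>The Bochner integral of a non-integrable function is 0 by convention, so the
      bound is trivial here.\<close>
    case False
    then show ?thesis
      using not_integrable_integral_eq[OF False] by (simp del: norm_scaleR)
  qed
  also have "\<dots> = (\<integral>\<^sup>+s. indicator {0..t} s * (indicator {0..t} s * ennreal (cmod (g (r + s *\<^sub>R v)))) \<partial>lborel)"
    by (intro nn_integral_cong) (auto simp: indicator_def)
  finally have "(ennreal (cmod ?J))\<^sup>2 \<le> \<dots>\<^sup>2"
    by (rule power_mono) simp
  also have "\<dots> \<le> (\<integral>\<^sup>+s. (indicator {0..t} s)\<^sup>2 \<partial>lborel) * (\<integral>\<^sup>+s. (indicator {0..t} s * ennreal (cmod (g (r + s *\<^sub>R v))))\<^sup>2 \<partial>lborel)"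
    by (rule Cauchy_Schwarz_nn_integral) auto
  also have "(\<integral>\<^sup>+s. (indicator {0..t} s)\<^sup>2 \<partial>lborel) = (\<integral>\<^sup>+s. indicator {0..t} s \<partial>lborel)"
    by (intro nn_integral_cong) (auto simp: indicator_def)
  also have "\<dots> = ennreal t"
    using t by simp
  also have "(\<integral>\<^sup>+s. (indicator {0..t} s * ennreal (cmod (g (r + s *\<^sub>R v))))\<^sup>2 \<partial>lborel)
      = (\<integral>\<^sup>+s. indicator {0..t} s * ennreal ((cmod (g (r + s *\<^sub>R v)))\<^sup>2) \<partial>lborel)"
    by (intro nn_integral_cong) (auto simp: indicator_def ennreal_power)
  finally show ?thesis
    by (simp add: ennreal_power)
qed

text \<open>Fundamental theorem of calculus along almost every segment. Both sides are compared
  after testing with an arbitrary window: the increment is moved onto the window, where it is the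
  derivative of the test function from \<open>segment_test_fun\<close>.\<close>

lemma weak_partial_segment:
  fixes \<psi> g :: "real^'n \<Rightarrow> complex"
  assumes w: "weak_partial a \<psi> g" and t: "0 \<le> t"
    and \<psi>: "\<psi> \<in> borel_measurable borel" "integrable lborel (\<lambda>r. (cmod (\<psi> r))\<^sup>2)"
    and g: "g \<in> borel_measurable borel" "integrable lborel (\<lambda>r. (cmod (g r))\<^sup>2)"
  shows "AE r in lborel. \<psi> (r + t *\<^sub>R axis a 1) - \<psi> r = (LINT s|lborel. indicator {0..t} s *\<^sub>R g (r + s *\<^sub>R axis a 1))"
proof -
  have [measurable]: "\<psi> \<in> borel_measurable borel" "g \<in> borel_measurable borel"
    by fact+
  define e where "e = (axis a 1 :: real^'n)"
  define J where "J r = (LINT s|lborel. indicator {0..t} s *\<^sub>R g (r + s *\<^sub>R e))" for r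
  have [measurable]: "J \<in> borel_measurable borel"
    unfolding J_def by measurable
  define \<psi>t where "\<psi>t r = \<psi> (r + t *\<^sub>R e)" for r
  have \<psi>t: "\<psi>t \<in> borel_measurable borel" "integrable lborel (\<lambda>r. (cmod (\<psi>t r))\<^sup>2)"
    unfolding \<psi>t_def using lborel_integrable_translate[OF \<psi>(2)] by auto
  have [measurable]: "\<psi>t \<in> borel_measurable borel"
    by fact
  have box_J: "integrable lborel (\<lambda>r. indicator (box l u) r *\<^sub>R J r)" for l u
  proof -
    have "integrable lborel (\<lambda>r. LINT s|lborel. indicator {0..t} s *\<^sub>R (indicator (box l u) r *\<^sub>R g (r + s *\<^sub>R e)))"
      by (rule lborel_pair.integrable_snd) (rule integrable_segment[OF g])
    also have "(\<lambda>r. LINT s|lborel. indicator {0..t} s *\<^sub>R (indicator (box l u) r *\<^sub>R g (r + s *\<^sub>R e))) = (\<lambda>r. indicator (box l u) r *\<^sub>R J r)"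
      unfolding J_def by (simp only: integral_scaleR_swap)
    finally show ?thesis .
  qed
  have "AE r in lborel. (\<psi>t r - \<psi> r) - J r = 0"
  proof (rule AE_eq_0_if_window_integrals_0)
    show "integrable lborel (\<lambda>r. indicator (box l u) r *\<^sub>R ((\<psi>t r - \<psi> r) - J r))" for l u
      unfolding scaleR_diff_right
      by (intro Bochner_Integration.integrable_diff box_J integrable_box_mult \<psi> \<psi>t)
    fix n and l u :: "real^'n"
    let ?\<phi> = "box_window n l u"
    obtain \<Phi> where \<Phi>: "test_fun \<Phi>" "has_partial a \<Phi> (\<lambda>r. ?\<phi> r - ?\<phi> (r - t *\<^sub>R e))"
      and \<Phi>_eq: "\<And>r. (LINT s|lborel. indicator {0..t} s * ?\<phi> (r - s *\<^sub>R e)) = \<Phi> r"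
      by (rule segment_test_fun[OF t, of a n l u, folded e_def]) (rule that)
    obtain K where K: "\<And>r. r \<in> box l u \<Longrightarrow> norm r \<le> K"
      by (rule box_norm_bound) (rule that)
    have K_box: "?\<phi> r = 0" if "K < norm r" for r
      using K[of r] that by (intro box_window_outside) auto
    have int_\<psi>: "integrable lborel (\<lambda>r. ?\<phi> r *\<^sub>R \<psi> r)" "integrable lborel (\<lambda>r. ?\<phi> r *\<^sub>R \<psi>t r)"
      by (rule integrable_test_fun_mult[OF test_fun_box_window] \<psi> \<psi>t)+
    have int_\<psi>': "integrable lborel (\<lambda>r. ?\<phi> (r - t *\<^sub>R e) *\<^sub>R \<psi> r)"
      using lborel_integrable_translate[OF int_\<psi>(2), of "- t *\<^sub>R e"] by (simp add: \<psi>t_def)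
    have int_J: "integrable lborel (\<lambda>r. ?\<phi> r *\<^sub>R J r)"
    proof (rule Bochner_Integration.integrable_bound[OF box_J[of l u]])
      have "norm (?\<phi> r *\<^sub>R J r) \<le> norm (indicator (box l u) r *\<^sub>R J r)" for r
        using box_window_bounds[of n l u r] box_window_outside[of r l u n]
        by (cases "r \<in> box l u") (auto intro!: mult_left_le_one_le)
      then show "AE r in lborel. norm (?\<phi> r *\<^sub>R J r) \<le> norm (indicator (box l u) r *\<^sub>R J r)" by simp
    qed auto
    have int_seg: "integrable lborel (\<lambda>s. indicator {0..t} s * ?\<phi> (r - s *\<^sub>R e))" for r
    proof (rule Bochner_Integration.integrable_bound)
      show "integrable lborel (indicator {0..t} :: real \<Rightarrow> real)"
        by (intro integrable_real_indicator) (auto simp: emeasure_lborel_Icc_eq)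
      show "AE s in lborel. norm (indicator {0..t} s * ?\<phi> (r - s *\<^sub>R e)) \<le> norm (indicator {0..t} s :: real)"
        using abs_box_window_le by (intro AE_I2) (auto simp: indicator_def)
    qed measurable
    \<comment> \<open>Substituting \<open>r - t e\<close> for \<open>r\<close> moves the translation
      from \<open>\<psi>\<close> to the window.\<close>
    have "(LINT r|lborel. ?\<phi> r *\<^sub>R \<psi>t r) = (LINT r|lborel. ?\<phi> (r - t *\<^sub>R e) *\<^sub>R \<psi> r)"
      using lborel_integral_translate[of "\<lambda>r. ?\<phi> r *\<^sub>R \<psi>t r" "- t *\<^sub>R e"] by (simp add: \<psi>t_def)
    then have "(LINT r|lborel. ?\<phi> r *\<^sub>R \<psi>t r) - (LINT r|lborel. ?\<phi> r *\<^sub>R \<psi> r)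
        = - (LINT r|lborel. (?\<phi> r - ?\<phi> (r - t *\<^sub>R e)) *\<^sub>R \<psi> r)"
      using int_\<psi>(1) int_\<psi>' by (simp add: scaleR_diff_left)
    also have "\<dots> = (LINT r|lborel. \<Phi> r *\<^sub>R g r)"
      using weak_partialD[OF w \<Phi>] by simp
    also have "\<dots> = (LINT r|lborel. LINT s|lborel. (indicator {0..t} s * ?\<phi> (r - s *\<^sub>R e)) *\<^sub>R g r)"
      unfolding \<Phi>_eq[symmetric] by (rule Bochner_Integration.integral_cong[OF refl]) (rule integral_scaleR_left[OF int_seg, symmetric])
    also have "\<dots> = (LINT s|lborel. LINT r|lborel. (indicator {0..t} s * ?\<phi> (r - s *\<^sub>R e)) *\<^sub>R g r)"
    proof (rule lborel_pair.Fubini_integral)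
      show "integrable (lborel \<Otimes>\<^sub>M lborel) (\<lambda>(s, r). (indicator {0..t} s * ?\<phi> (r - s *\<^sub>R e)) *\<^sub>R g r)"
      \<comment> \<open>For shifts \<open>s\<close> in \<open>{0..t}\<close> the translated windows
        live within radius \<open>K + t\<close>, so a cube of half side \<open>K + t + 1\<close>
        contains all of them. The direction 0 leaves \<open>g\<close> untranslated in the
        majorant.\<close>
      proof (rule Bochner_Integration.integrable_bound[OF integrable_segment[OF g, of t "\<chi> i. - (K + t + 1)" "\<chi> i. K + t + 1" 0]])
        let ?B = "box (\<chi> i. - (K + t + 1)) (\<chi> i. K + t + 1) :: (real^'n) set"
        have "norm ((indicator {0..t} s * ?\<phi> (r - s *\<^sub>R e)) *\<^sub>R g r) \<le> norm (indicator {0..t} s *\<^sub>R (indicator ?B r *\<^sub>R g (r + s *\<^sub>R 0)))" for s r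
        proof (cases "s \<in> {0..t} \<and> r \<notin> ?B")
          case True
          then obtain i where i: "\<not> (- (K + t + 1) < r $ i \<and> r $ i < K + t + 1)"
            by (auto simp: mem_box_cart)
          then have "K + t < norm r"
            using component_le_norm_cart[of r i] by linarith
          moreover have "norm r \<le> norm (r - s *\<^sub>R e) + norm (s *\<^sub>R e)"
            using norm_triangle_ineq[of "r - s *\<^sub>R e" "s *\<^sub>R e"] by simp
          moreover have "norm (s *\<^sub>R e) \<le> t"
            using True by (simp add: e_def norm_axis_1)
          ultimately have "?\<phi> (r - s *\<^sub>R e) = 0"
            by (intro K_box) linarith
          then show ?thesis by simp
        next
          case False
          then show ?thesis
            using abs_box_window_le[of n l u "r - s *\<^sub>R e"]
            by (auto simp: indicator_def intro!: mult_left_le_one_le)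
        qed
        then show "AE p in lborel \<Otimes>\<^sub>M lborel. norm (case p of (s, r) \<Rightarrow> (indicator {0..t} s * ?\<phi> (r - s *\<^sub>R e)) *\<^sub>R g r)
            \<le> norm (case p of (s, r) \<Rightarrow> indicator {0..t} s *\<^sub>R (indicator ?B r *\<^sub>R g (r + s *\<^sub>R 0)))"
          by (intro AE_I2) (auto split: prod.split)
      qed measurable
    qed
    \<comment> \<open>For each fixed \<open>s\<close> the inner integral is translated by
      \<open>s e\<close>, which moves the shift from the window to \<open>g\<close>.\<close>
    also have "\<dots> = (LINT s|lborel. LINT r|lborel. indicator {0..t} s *\<^sub>R (?\<phi> r *\<^sub>R g (r + s *\<^sub>R e)))"
    proof (rule Bochner_Integration.integral_cong[OF refl])
      fix s :: real
      show "(LINT r|lborel. (indicator {0..t} s * ?\<phi> (r - s *\<^sub>R e)) *\<^sub>R g r) = (LINT r|lborel. indicator {0..t} s *\<^sub>R (?\<phi> r *\<^sub>R g (r + s *\<^sub>R e)))"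
        using lborel_integral_translate[of "\<lambda>r. (indicator {0..t} s * ?\<phi> (r - s *\<^sub>R e)) *\<^sub>R g r" "s *\<^sub>R e"] by simp
    qed
    also have "\<dots> = (LINT r|lborel. LINT s|lborel. indicator {0..t} s *\<^sub>R (?\<phi> r *\<^sub>R g (r + s *\<^sub>R e)))"
    proof (rule lborel_pair.Fubini_integral[symmetric])
      show "integrable (lborel \<Otimes>\<^sub>M lborel) (\<lambda>(s, r). indicator {0..t} s *\<^sub>R (?\<phi> r *\<^sub>R g (r + s *\<^sub>R e)))"
      proof (rule Bochner_Integration.integrable_bound[OF integrable_segment[OF g, of t l u e]])
        have "norm (indicator {0..t} s *\<^sub>R (?\<phi> r *\<^sub>R g (r + s *\<^sub>R e))) \<le> norm (indicator {0..t} s *\<^sub>R (indicator (box l u) r *\<^sub>R g (r + s *\<^sub>R e)))" for s r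
          using box_window_bounds[of n l u r] box_window_outside[of r l u n]
          by (cases "r \<in> box l u") (auto simp: indicator_def intro!: mult_left_le_one_le)
        then show "AE p in lborel \<Otimes>\<^sub>M lborel. norm (case p of (s, r) \<Rightarrow> indicator {0..t} s *\<^sub>R (?\<phi> r *\<^sub>R g (r + s *\<^sub>R e)))
            \<le> norm (case p of (s, r) \<Rightarrow> indicator {0..t} s *\<^sub>R (indicator (box l u) r *\<^sub>R g (r + s *\<^sub>R e)))"
          by (intro AE_I2) (auto split: prod.split)
      qed measurable
    qed
    also have "\<dots> = (LINT r|lborel. ?\<phi> r *\<^sub>R J r)"
      unfolding J_def by (simp only: integral_scaleR_swap)
    finally show "(LINT r|lborel. ?\<phi> r *\<^sub>R ((\<psi>t r - \<psi> r) - J r)) = 0"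
      using int_\<psi> int_J by (simp add: scaleR_diff_right)
  qed auto
  then show ?thesis
    by (simp add: \<psi>t_def J_def e_def)
qed

text \<open>One factor \<open>t\<close> comes from Cauchy-Schwarz on the segment, the other from
  integrating over \<open>s\<close> after Tonelli and a translation. Invariance of \<open>S\<close>
  along the axis lets the estimate be localised to a half-space, which is needed because the gauge
  differs on the two sides of the tube.\<close>

theorem weak_partial_translation:
  fixes \<psi> g :: "real^'n \<Rightarrow> complex"
  assumes w: "weak_partial a \<psi> g" and t: "0 \<le> t"
    and \<psi>: "\<psi> \<in> borel_measurable borel" "integrable lborel (\<lambda>r. (cmod (\<psi> r))\<^sup>2)"
    and g: "g \<in> borel_measurable borel" "integrable lborel (\<lambda>r. (cmod (g r))\<^sup>2)"
    and S [measurable]: "S \<in> sets borel" and inv: "\<And>r s. r + s *\<^sub>R axis a 1 \<in> S \<longleftrightarrow> r \<in> S"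
  shows "(\<integral>\<^sup>+r. indicator S r * ennreal ((cmod (\<psi> (r + t *\<^sub>R axis a 1) - \<psi> r))\<^sup>2) \<partial>lborel)
    \<le> ennreal (t\<^sup>2) * (\<integral>\<^sup>+r. indicator S r * ennreal ((cmod (g r))\<^sup>2) \<partial>lborel)"
proof -
  have [measurable]: "\<psi> \<in> borel_measurable borel" "g \<in> borel_measurable borel"
    by fact+
  define e where "e = (axis a 1 :: real^'n)"
  let ?I = "\<integral>\<^sup>+r. indicator S r * ennreal ((cmod (g r))\<^sup>2) \<partial>lborel"
  have "(\<integral>\<^sup>+r. indicator S r * ennreal ((cmod (\<psi> (r + t *\<^sub>R e) - \<psi> r))\<^sup>2) \<partial>lborel)
      \<le> (\<integral>\<^sup>+r. indicator S r * (ennreal t * (\<integral>\<^sup>+s. indicator {0..t} s * ennreal ((cmod (g (r + s *\<^sub>R e)))\<^sup>2) \<partial>lborel)) \<partial>lborel)"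
  proof (rule nn_integral_mono_AE)
    show "AE r in lborel. indicator S r * ennreal ((cmod (\<psi> (r + t *\<^sub>R e) - \<psi> r))\<^sup>2)
        \<le> indicator S r * (ennreal t * (\<integral>\<^sup>+s. indicator {0..t} s * ennreal ((cmod (g (r + s *\<^sub>R e)))\<^sup>2) \<partial>lborel))"
      using weak_partial_segment[OF w t \<psi> g]
    proof eventually_elim
      case (elim r)
      then show ?case
        using norm_segment_integral_le[OF t g(1), of r e] by (intro mult_left_mono) (simp_all add: e_def)
    qed
  qed
  also have "\<dots> = (\<integral>\<^sup>+r. \<integral>\<^sup>+s. ennreal t * (indicator {0..t} s * (indicator S (r + s *\<^sub>R e) * ennreal ((cmod (g (r + s *\<^sub>R e)))\<^sup>2))) \<partial>lborel \<partial>lborel)"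
  proof (rule nn_integral_cong)
    fix r
    show "indicator S r * (ennreal t * (\<integral>\<^sup>+s. indicator {0..t} s * ennreal ((cmod (g (r + s *\<^sub>R e)))\<^sup>2) \<partial>lborel))
      = (\<integral>\<^sup>+s. ennreal t * (indicator {0..t} s * (indicator S (r + s *\<^sub>R e) * ennreal ((cmod (g (r + s *\<^sub>R e)))\<^sup>2))) \<partial>lborel)"
      by (cases "r \<in> S") (simp_all add: inv[folded e_def] nn_integral_cmult)
  qed
  also have "\<dots> = (\<integral>\<^sup>+s. \<integral>\<^sup>+r. ennreal t * (indicator {0..t} s * (indicator S (r + s *\<^sub>R e) * ennreal ((cmod (g (r + s *\<^sub>R e)))\<^sup>2))) \<partial>lborel \<partial>lborel)"
    by (rule lborel_pair.Fubini') measurable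
  also have "\<dots> = (\<integral>\<^sup>+s. ennreal t * (indicator {0..t} s * ?I) \<partial>lborel)"
  proof (rule nn_integral_cong)
    fix s :: real
    have "(\<integral>\<^sup>+r. indicator S (r + s *\<^sub>R e) * ennreal ((cmod (g (r + s *\<^sub>R e)))\<^sup>2) \<partial>lborel) = ?I"
      by (rule lborel_nn_integral_translate[of "\<lambda>r. indicator S r * ennreal ((cmod (g r))\<^sup>2)"]) measurable
    then show "(\<integral>\<^sup>+r. ennreal t * (indicator {0..t} s * (indicator S (r + s *\<^sub>R e) * ennreal ((cmod (g (r + s *\<^sub>R e)))\<^sup>2))) \<partial>lborel)
        = ennreal t * (indicator {0..t} s * ?I)"
      by (subst nn_integral_cmult, measurable, subst nn_integral_cmult, measurable)
  qed
  also have "\<dots> = ennreal t * (ennreal t * ?I)"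
    using t by (simp add: nn_integral_cmult nn_integral_multc)
  also have "\<dots> = ennreal (t\<^sup>2) * ?I"
    using t by (simp add: power2_eq_square ennreal_mult mult.assoc)
  finally show ?thesis
    by (simp add: e_def)
qed

subsection \<open>One-particle states\<close>

declare One_nat_def [simp del]

lemma borel_measurable_vec_component [measurable]:
  fixes A :: "'a \<Rightarrow> real^'n"
  assumes [measurable]: "A \<in> borel_measurable M"
  shows "(\<lambda>x. A x $ a) \<in> borel_measurable M"
proof -
  have "(\<lambda>x. A x \<bullet> axis a 1) \<in> borel_measurable M"
    by measurable
  then show ?thesis
    by (simp add: inner_axis)
qed

text \<open>Configurations of one particle are functions extensional on \<open>{0}\<close>; on that
  space this is the inverse of evaluation at 0.\<close>

definition emb :: "point \<Rightarrow> nat \<Rightarrow> point" where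
  "emb r = (\<lambda>_. undefined)(0 := r)"

lemma emb_0 [simp]: "emb r 0 = r"
  by (simp add: emb_def)

lemma lessThan_1: "{..<1} = {0::nat}"
  by auto

lemma conf_1: "conf {..<1} = PiM {0} (\<lambda>_. lborel)"
  by (simp add: conf_def lessThan_1)

lemma space_conf_1: "x \<in> space (conf {..<1}) \<longleftrightarrow> emb (x 0) = x"
  by (auto simp: conf_1 space_PiM PiE_def extensional_def emb_def fun_eq_iff)

lemma emb_in_space: "emb r \<in> space (conf {..<1})"
  by (simp add: space_conf_1)

lemma measurable_emb [measurable]: "emb \<in> measurable borel (conf {..<1})"
proof -
  have "(\<lambda>r. \<lambda>i\<in>{0}. r) \<in> measurable borel (PiM {0::nat} (\<lambda>_. lborel :: point measure))"
    by measurable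
  also have "(\<lambda>r::point. \<lambda>i\<in>{0::nat}. r) = emb"
    by (auto simp: emb_def fun_eq_iff)
  finally show ?thesis
    by (simp add: conf_1)
qed

lemma measurable_coordinate_0 [measurable]: "(\<lambda>x. x 0) \<in> measurable (conf {..<1}) borel"
  using measurable_component_singleton[of 0 "{0}" "\<lambda>_. lborel :: point measure"] by (simp add: conf_1)

text \<open>Evaluation at 0 carries the one-factor product measure to Lebesgue measure and
  \<open>emb\<close> inverts it. Hence integrals of measurable functions over one-particle
  configurations become Lebesgue integrals.\<close>

lemma distr_emb: "distr lborel (conf {..<1}) emb = conf {..<1}"
proof -
  interpret product_sigma_finite "\<lambda>_::nat. lborel :: point measure" ..
  have "lborel = distr (conf {..<1}) lborel (\<lambda>x. x 0)"
    using distr_singleton[of 0] by (simp add: conf_1)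
  then have "distr lborel (conf {..<1}) emb = distr (distr (conf {..<1}) lborel (\<lambda>x. x 0)) (conf {..<1}) emb"
    by simp
  also have "\<dots> = distr (conf {..<1}) (conf {..<1}) (\<lambda>x. emb (x 0))"
    by (subst distr_distr) (auto simp: o_def)
  also have "\<dots> = distr (conf {..<1}) (conf {..<1}) (\<lambda>x. x)"
    by (rule distr_cong) (auto simp: space_conf_1)
  finally show ?thesis by simp
qed

lemma borel_measurable_conf_iff:
  "f \<in> borel_measurable (conf {..<1}) \<longleftrightarrow> (\<lambda>r. f (emb r)) \<in> borel_measurable borel"
proof
  assume [measurable]: "(\<lambda>r. f (emb r)) \<in> borel_measurable borel"
  have "(\<lambda>x. f (emb (x 0))) \<in> borel_measurable (conf {..<1})"
    by measurable
  also have "?this \<longleftrightarrow> f \<in> borel_measurable (conf {..<1})"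
    by (rule measurable_cong) (simp add: space_conf_1)
  finally show "f \<in> borel_measurable (conf {..<1})" .
next
  assume "f \<in> borel_measurable (conf {..<1})"
  then show "(\<lambda>r. f (emb r)) \<in> borel_measurable borel"
    by (rule measurable_compose[OF measurable_emb])
qed

lemma nn_integral_conf:
  assumes [measurable]: "f \<in> borel_measurable (conf {..<1})"
  shows "(\<integral>\<^sup>+x. f x \<partial>conf {..<1}) = (\<integral>\<^sup>+r. f (emb r) \<partial>lborel)"
  by (subst distr_emb[symmetric], subst nn_integral_distr) auto

lemma integral_conf:
  fixes f :: "_ \<Rightarrow> 'b::{banach, second_countable_topology}"
  assumes [measurable]: "f \<in> borel_measurable (conf {..<1})"
  shows "(LINT x|conf {..<1}. f x) = (LINT r|lborel. f (emb r))"
  by (subst distr_emb[symmetric], subst integral_distr) auto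

lemma integrable_conf_iff:
  fixes f :: "_ \<Rightarrow> 'b::{banach, second_countable_topology}"
  assumes [measurable]: "f \<in> borel_measurable (conf {..<1})"
  shows "integrable (conf {..<1}) f \<longleftrightarrow> integrable lborel (\<lambda>r. f (emb r))"
  by (subst distr_emb[symmetric], subst integrable_distr_eq) auto

lemma L2_1_iff:
  "\<psi> \<in> L2 1 \<longleftrightarrow> (\<lambda>r. \<psi> (emb r)) \<in> borel_measurable borel \<and> integrable lborel (\<lambda>r. (cmod (\<psi> (emb r)))\<^sup>2)"
proof (cases "\<psi> \<in> borel_measurable (conf {..<1})")
  case True
  then have "(\<lambda>x. (cmod (\<psi> x))\<^sup>2) \<in> borel_measurable (conf {..<1})"
    by measurable
  with True show ?thesis
    by (simp add: L2_def integrable_conf_iff borel_measurable_conf_iff)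
qed (simp add: L2_def borel_measurable_conf_iff)

lemma shift_emb: "shift 0 a (emb r) h = emb (r + h *\<^sub>R axis a 1)"
  by (simp add: shift_def emb_def)

lemma continuous_on_emb: "continuous_on UNIV emb"
proof (rule continuous_on_coordinatewise_then_product)
  fix i show "continuous_on UNIV (\<lambda>r. emb r i)"
    by (cases "i = 0") (auto simp: emb_def)
qed

lemma partial_deriv_comp_coordinate_0:
  assumes "has_partial a \<Phi> \<Phi>'"
  shows "partial_deriv 0 a (\<lambda>x. \<Phi> (x 0)) x = \<Phi>' (x 0)" "(\<lambda>h. \<Phi> (shift 0 a x h 0)) differentiable at 0"
proof -
  have "((\<lambda>h. \<Phi> (shift 0 a x h 0)) has_real_derivative \<Phi>' (x 0)) (at 0)"
    using assms by (simp add: has_partial_def shift_def has_real_derivative_iff_has_vector_derivative)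
  then show "partial_deriv 0 a (\<lambda>x. \<Phi> (x 0)) x = \<Phi>' (x 0)" "(\<lambda>h. \<Phi> (shift 0 a x h 0)) differentiable at 0"
    by (auto simp: partial_deriv_def real_differentiable_def intro: DERIV_imp_deriv)
qed

lemma test_function_comp_coordinate_0:
  assumes \<Phi>: "test_fun \<Phi>"
  shows "test_function 1 (\<lambda>x. \<Phi> (x 0))"
proof -
  have c0: "continuous_on S (\<lambda>x :: nat \<Rightarrow> point. f (x 0))" if "continuous_on UNIV f" for f :: "point \<Rightarrow> real" and S
    by (rule continuous_on_compose2[OF that]) (auto intro: continuous_on_subset[OF continuous_on_product_coordinates])
  show ?thesis
    unfolding test_function_def
  proof (intro conjI allI impI ballI)
    show "continuous_on (space (conf {..<1})) (\<lambda>x. \<Phi> (x 0))"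
      using \<Phi> by (intro c0) (simp add: test_fun_def)
    fix j a assume "j < (1::nat)"
    then have j: "j = 0" by simp
    obtain \<Phi>' where \<Phi>': "has_partial a \<Phi> \<Phi>'" "continuous_on UNIV \<Phi>'"
      using \<Phi> by (auto simp: test_fun_def)
    show "(\<lambda>h. \<Phi> (shift j a x h 0)) differentiable at 0" for x
      unfolding j by (rule partial_deriv_comp_coordinate_0(2)[OF \<Phi>'(1)])
    show "continuous_on (space (conf {..<1})) (partial_deriv j a (\<lambda>x. \<Phi> (x 0)))"
      using c0[OF \<Phi>'(2)] by (simp add: j partial_deriv_comp_coordinate_0(1)[OF \<Phi>'(1), abs_def])
  next
    obtain K where "\<And>r. K < norm r \<Longrightarrow> \<Phi> r = 0"
      using \<Phi> by (auto simp: test_fun_def)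
    then show "\<exists>R. \<forall>x\<in>space (conf {..<1}). (\<exists>j<1. R < norm (x j)) \<longrightarrow> \<Phi> (x 0) = 0"
      by (intro exI[of _ K]) auto
  qed
qed

lemma test_function_emb:
  assumes \<phi>: "test_function 1 \<phi>"
  shows "test_fun (\<lambda>r. \<phi> (emb r))"
    and "has_partial a (\<lambda>r. \<phi> (emb r)) (\<lambda>r. partial_deriv 0 a \<phi> (emb r))"
proof -
  have ce: "continuous_on UNIV (\<lambda>r. f (emb r))" if "continuous_on (space (conf {..<1})) f" for f :: "_ \<Rightarrow> real"
    by (rule continuous_on_compose2[OF that continuous_on_emb]) (auto simp: emb_in_space)
  have hp: "has_partial a (\<lambda>r. \<phi> (emb r)) (\<lambda>r. partial_deriv 0 a \<phi> (emb r))" for a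
    unfolding has_partial_def
  proof
    fix r
    have "(\<lambda>h. \<phi> (shift 0 a (emb r) h)) differentiable (at 0)"
      using \<phi> emb_in_space[of r] by (simp add: test_function_def)
    then have "((\<lambda>h. \<phi> (shift 0 a (emb r) h)) has_real_derivative partial_deriv 0 a \<phi> (emb r)) (at 0)"
      unfolding partial_deriv_def by (simp add: DERIV_deriv_iff_real_differentiable)
    then show "((\<lambda>h. \<phi> (emb (r + h *\<^sub>R axis a 1))) has_vector_derivative partial_deriv 0 a \<phi> (emb r)) (at 0)"
      by (simp add: shift_emb has_real_derivative_iff_has_vector_derivative)
  qed
  then show "has_partial a (\<lambda>r. \<phi> (emb r)) (\<lambda>r. partial_deriv 0 a \<phi> (emb r))" .
  show "test_fun (\<lambda>r. \<phi> (emb r))"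
    unfolding test_fun_def
  proof (intro conjI allI)
    show "continuous_on UNIV (\<lambda>r. \<phi> (emb r))"
      using \<phi> by (intro ce) (simp add: test_function_def)
    show "\<exists>\<Phi>'. has_partial a (\<lambda>r. \<phi> (emb r)) \<Phi>' \<and> continuous_on UNIV \<Phi>'" for a
      using hp[of a] ce[of "partial_deriv 0 a \<phi>"] \<phi> by (auto simp: test_function_def)
    obtain R where "\<forall>x\<in>space (conf {..<1}). (\<exists>j<1. R < norm (x j)) \<longrightarrow> \<phi> x = 0"
      using \<phi> by (auto simp: test_function_def)
    then show "\<exists>K. \<forall>r. K < norm r \<longrightarrow> \<phi> (emb r) = 0"
      using emb_in_space by (intro exI[of _ R]) force
  qed
qed

text \<open>Test functions correspond in both directions: composition with evaluation at 0 one way,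
  composition with \<open>emb\<close> the other way. Partial derivatives match because
  \<open>shift\<close> moves only the coordinate 0.\<close>

lemma is_weak_partial_1_iff:
  assumes \<psi>: "\<psi> \<in> borel_measurable (conf {..<1})" and g: "g \<in> borel_measurable (conf {..<1})"
  shows "is_weak_partial 1 0 a \<psi> g \<longleftrightarrow> weak_partial a (\<lambda>r. \<psi> (emb r)) (\<lambda>r. g (emb r))"
proof
  assume w: "is_weak_partial 1 0 a \<psi> g"
  show "weak_partial a (\<lambda>r. \<psi> (emb r)) (\<lambda>r. g (emb r))"
    unfolding weak_partial_def
  proof (intro allI impI)
    fix \<Phi> \<Phi>' assume \<Phi>: "test_fun \<Phi>" "has_partial a \<Phi> \<Phi>'"
    have [measurable]: "\<Phi> \<in> borel_measurable borel" "\<Phi>' \<in> borel_measurable borel"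
      using test_funE[OF \<Phi>(1)] test_fun_partialE[OF \<Phi>] by metis+
    note [measurable] = \<psi> g
    have "(LINT x|conf {..<1}. \<Phi>' (x 0) *\<^sub>R \<psi> x) = - (LINT x|conf {..<1}. \<Phi> (x 0) *\<^sub>R g x)"
      using w test_function_comp_coordinate_0[OF \<Phi>(1)]
      by (simp add: is_weak_partial_def flip: partial_deriv_comp_coordinate_0(1)[OF \<Phi>(2)])
    then show "(LINT r|lborel. \<Phi>' r *\<^sub>R \<psi> (emb r)) = - (LINT r|lborel. \<Phi> r *\<^sub>R g (emb r))"
      by (simp add: integral_conf)
  qed
next
  assume w: "weak_partial a (\<lambda>r. \<psi> (emb r)) (\<lambda>r. g (emb r))"
  show "is_weak_partial 1 0 a \<psi> g"
    unfolding is_weak_partial_def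
  proof (intro allI impI)
    fix \<phi> assume \<phi>: "test_function 1 \<phi>"
    note \<Phi> = test_function_emb[OF \<phi>]
    have [measurable]: "\<phi> \<in> borel_measurable (conf {..<1})" "partial_deriv 0 a \<phi> \<in> borel_measurable (conf {..<1})"
      using test_funE[OF \<Phi>(1)] test_fun_partialE[OF \<Phi>] unfolding borel_measurable_conf_iff by metis+
    note [measurable] = \<psi> g
    show "(LINT x|conf {..<1}. partial_deriv 0 a \<phi> x *\<^sub>R \<psi> x) = - (LINT x|conf {..<1}. \<phi> x *\<^sub>R g x)"
      using weak_partialD[OF w \<Phi>] by (simp add: integral_conf)
  qed
qed

lemma L2_1_D:
  assumes "\<psi> \<in> L2 1"
  shows "\<psi> \<in> borel_measurable (conf {..<1})" "(\<lambda>r. \<psi> (emb r)) \<in> borel_measurable borel"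
    "integrable lborel (\<lambda>r. (cmod (\<psi> (emb r)))\<^sup>2)"
  using assms by (auto simp: L2_1_iff borel_measurable_conf_iff)

lemma wgrad_1:
  assumes "\<psi> \<in> H1 1"
  shows "wgrad 1 \<psi> 0 a \<in> L2 1" "weak_partial a (\<lambda>r. \<psi> (emb r)) (\<lambda>r. wgrad 1 \<psi> 0 a (emb r))"
proof -
  have "\<exists>g. g \<in> L2 1 \<and> is_weak_partial 1 0 a \<psi> g"
    using assms by (auto simp: H1_def)
  from someI_ex[OF this] have w: "wgrad 1 \<psi> 0 a \<in> L2 1" "is_weak_partial 1 0 a \<psi> (wgrad 1 \<psi> 0 a)"
    by (auto simp: wgrad_def)
  then show "wgrad 1 \<psi> 0 a \<in> L2 1" "weak_partial a (\<lambda>r. \<psi> (emb r)) (\<lambda>r. wgrad 1 \<psi> 0 a (emb r))"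
    using assms is_weak_partial_1_iff[of \<psi> "wgrad 1 \<psi> 0 a" a] by (auto simp: H1_def L2_def)
qed

lemma wgrad_1_eq:
  assumes \<psi>: "\<psi> \<in> H1 1" and w: "weak_partial a (\<lambda>r. \<psi> (emb r)) g"
    and g: "g \<in> borel_measurable borel" "integrable lborel (\<lambda>r. (cmod (g r))\<^sup>2)"
  shows "AE r in lborel. wgrad 1 \<psi> 0 a (emb r) = g r"
  by (rule weak_partial_unique[OF wgrad_1(2)[OF \<psi>] w L2_1_D(2,3)[OF wgrad_1(1)[OF \<psi>]] g])

lemma H1_1_lift:
  assumes u: "u \<in> borel_measurable borel" "integrable lborel (\<lambda>r. (cmod (u r))\<^sup>2)"
    and w: "\<And>a. weak_partial a u (u' a)"
    and u': "\<And>a. u' a \<in> borel_measurable borel" "\<And>a. integrable lborel (\<lambda>r. (cmod (u' a r))\<^sup>2)"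
  shows "(\<lambda>x. u (x 0)) \<in> H1 1"
proof -
  have L2: "(\<lambda>x. f (x 0)) \<in> L2 1" if "f \<in> borel_measurable borel" "integrable lborel (\<lambda>r. (cmod (f r))\<^sup>2)" for f
    using that by (simp add: L2_1_iff)
  have "is_weak_partial 1 0 a (\<lambda>x. u (x 0)) (\<lambda>x. u' a (x 0))" for a
    using w[of a] u u' by (subst is_weak_partial_1_iff) (auto simp: borel_measurable_conf_iff)
  with L2[OF u] L2[OF u'] show ?thesis
    by (auto simp: H1_def)
qed

lemma kinetic_1:
  assumes \<psi>: "\<psi> \<in> H1 1" and [measurable]: "A \<in> borel_measurable borel"
  shows "kinetic 1 A \<psi> = (\<Sum>a\<in>UNIV. \<integral>\<^sup>+r. ennreal (1/2 * (cmod (- \<i> * wgrad 1 \<psi> 0 a (emb r) + of_real (A r $ a) * \<psi> (emb r)))\<^sup>2) \<partial>lborel)"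
proof -
  have [measurable]: "\<psi> \<in> borel_measurable (conf {..<1})" "wgrad 1 \<psi> 0 a \<in> borel_measurable (conf {..<1})" for a
    using \<psi> wgrad_1(1)[OF \<psi>] L2_1_D by (auto simp: H1_def)
  have sum_1: "(\<Sum>j<1. h j) = h 0" for h :: "nat \<Rightarrow> ennreal"
    by (simp add: lessThan_1)
  have "(\<integral>\<^sup>+x. ennreal (1/2 * (cmod (- \<i> * wgrad 1 \<psi> 0 a x + of_real (A (x 0) $ a) * \<psi> x))\<^sup>2) \<partial>conf {..<1})
      = (\<integral>\<^sup>+r. ennreal (1/2 * (cmod (- \<i> * wgrad 1 \<psi> 0 a (emb r) + of_real (A r $ a) * \<psi> (emb r)))\<^sup>2) \<partial>lborel)" for a
    by (subst nn_integral_conf) simp_all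
  then show ?thesis
    unfolding kinetic_def by (simp only: sum_1)
qed

text \<open>For one electron no variables remain to be integrated out: the configuration space of
  the others is a single point of mass 1. Density and current thus become pointwise
  expressions.\<close>

lemma conf_empty: "conf {1..<1} = count_space {\<lambda>_. undefined}"
  by (simp add: conf_def PiM_empty)

lemma pure_density_1: "pure_density 1 \<psi> r = (cmod (\<psi> (emb r)))\<^sup>2"
  unfolding pure_density_def conf_empty by (simp add: lebesgue_integral_count_space_finite emb_def fun_upd_def)

lemma pure_current_1: "pure_current 1 \<psi> r = (\<chi> a. Im (cnj (\<psi> (emb r)) * wgrad 1 \<psi> 0 a (emb r)))"
  unfolding pure_current_def conf_empty by (simp add: lebesgue_integral_count_space_finite emb_def fun_upd_def)

lemma coulomb_1: "coulomb 1 \<psi> = 0"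
  by (simp add: coulomb_def)

lemma antisymmetric_1: "antisymmetric 1 \<psi>"
  by (simp add: antisymmetric_def lessThan_1 permutes_sing)

declare measurable_coordinate_0 [measurable del]

subsection \<open>Half a flux quantum\<close>

text \<open>A continuously differentiable step from 0 to pi, constant outside
  \<open>{-1..1}\<close>. The two squares in the denominator never vanish together. Beyond the step
  \<open>cis phase\<close> is \<open>- 1\<close>, while \<open>cis (2 * phase)\<close> is 1 on both
  sides.\<close>

definition phase :: "real \<Rightarrow> real" where
  "phase y = pi * (pos2 (1 + y) / (pos2 (1 + y) + pos2 (1 - y)))"

definition phase_deriv :: "real \<Rightarrow> real" where
  "phase_deriv y = pi * ((2 * max 0 (1 + y) * pos2 (1 - y) + pos2 (1 + y) * (2 * max 0 (1 - y)))
     / (pos2 (1 + y) + pos2 (1 - y))\<^sup>2)"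

lemma phase_denominator_nonzero: "pos2 (1 + y) + pos2 (1 - y) \<noteq> 0"
proof -
  have "0 < pos2 (1 + y) \<or> 0 < pos2 (1 - y)"
    by (auto simp: pos2_pos_iff)
  then show ?thesis
    using pos2_ge_0[of "1 + y"] pos2_ge_0[of "1 - y"] by linarith
qed

lemma DERIV_phase: "(phase has_real_derivative phase_deriv y) (at y)"
  unfolding phase_def[abs_def] phase_deriv_def using phase_denominator_nonzero[of y]
  by (auto intro!: derivative_eq_intros simp: power2_eq_square algebra_simps)

lemma continuous_on_phase_deriv: "continuous_on S phase_deriv"
  unfolding phase_deriv_def[abs_def]
  by (intro continuous_intros) (simp_all add: phase_denominator_nonzero)

lemma phase_le: "y \<le> -1 \<Longrightarrow> phase y = 0" "y \<le> -1 \<Longrightarrow> phase_deriv y = 0"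
  by (simp_all add: phase_def phase_deriv_def pos2_eq_0)

lemma phase_ge: "1 \<le> y \<Longrightarrow> phase y = pi" "1 \<le> y \<Longrightarrow> phase_deriv y = 0"
  using phase_denominator_nonzero[of y] by (simp_all add: phase_def phase_deriv_def pos2_eq_0)

lemma borel_measurable_phase [measurable]: "phase \<in> borel_measurable borel" "phase_deriv \<in> borel_measurable borel"
  by (intro borel_measurable_continuous_onI continuous_on_phase_deriv continuous_at_imp_continuous_on ballI DERIV_isCont[OF DERIV_phase])+

lemma phase_deriv_bounded:
  obtains M where "\<And>y. \<bar>phase_deriv y\<bar> \<le> M" "0 \<le> M"
proof -
  have "compact (phase_deriv ` {-1..1})"
    by (intro compact_continuous_image continuous_on_phase_deriv) auto
  then obtain M where M: "\<And>y. y \<in> {-1..1} \<Longrightarrow> \<bar>phase_deriv y\<bar> \<le> M"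
    using compact_imp_bounded bounded_iff by (metis imageI real_norm_def)
  have "\<bar>phase_deriv y\<bar> \<le> max 0 M" for y
    using M[of y] phase_le(2)[of y] phase_ge(2)[of y] by (cases "y \<le> -1"; cases "1 \<le> y") auto
  then show thesis by (intro that[of "max 0 M"]) auto
qed

text \<open>
  Half a flux quantum through the segment \<open>x = 0, \<bar>y\<bar> \<le> 1\<close>: the line integral of the potential along
  a loop around this segment is \<open>\<pi>\<close>.
\<close>

definition half_flux :: field where
  "half_flux r = (if 0 < r $ 1 then phase_deriv (r $ 2) else 0) *\<^sub>R axis 2 1"

lemma half_flux_component:
  "half_flux r $ 1 = 0" "half_flux r $ 2 = (if 0 < r $ 1 then phase_deriv (r $ 2) else 0)" "half_flux r $ 3 = 0"
  by (simp_all add: half_flux_def axis_def)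

lemma borel_measurable_half_flux [measurable]: "half_flux \<in> borel_measurable borel"
  unfolding half_flux_def[abs_def] by measurable

lemma has_partial_coordinate:
  fixes h h' :: "real \<Rightarrow> 'b::real_normed_vector"
  assumes "\<And>x. (h has_vector_derivative h' x) (at x)"
  shows "has_partial a (\<lambda>r::real^'n. h (r $ b)) (\<lambda>r. if a = b then h' (r $ b) else 0)"
  unfolding has_partial_def
proof
  fix r :: "real^'n"
  show "((\<lambda>t. h ((r + t *\<^sub>R axis a 1) $ b)) has_vector_derivative (if a = b then h' (r $ b) else 0)) (at 0)"
  proof (cases "a = b")
    case True
    have "((h \<circ> (\<lambda>t. r $ b + t)) has_vector_derivative 1 *\<^sub>R h' (r $ b)) (at 0)"
      by (intro vector_diff_chain_at) (use assms[of "r $ b"] in \<open>auto intro!: derivative_eq_intros\<close>)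
    with True show ?thesis
      by (simp add: o_def axis_def)
  qed (simp add: axis_def)
qed

text \<open>Used with \<open>s = 1\<close> to gauge the potential away in the loop estimate and with
  \<open>s = - 2\<close> for the twisted state.\<close>

lemma phase_factor:
  fixes s :: real
  defines "c \<equiv> \<lambda>r::point. cis (s * phase (r $ 2))"
    and "c' \<equiv> \<lambda>b (r::point). if b = 2 then of_real (s * phase_deriv (r $ 2)) * \<i> * cis (s * phase (r $ 2)) else 0"
  shows "has_partial b c (c' b)" "continuous_on UNIV c" "continuous_on UNIV (c' b)"
proof -
  have "((\<lambda>y. cis (s * phase y)) has_vector_derivative of_real (s * phase_deriv y) * \<i> * cis (s * phase y)) (at y)" for y
  proof -
    have "((\<lambda>y. s * phase y) has_real_derivative s * phase_deriv y) (at y)"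
      by (auto intro!: derivative_eq_intros DERIV_phase)
    moreover have "(cis has_vector_derivative \<i> * cis x) (at x)" for x
      unfolding cis_conv_exp
      by (rule has_vector_derivative_eq_rhs, rule field_vector_diff_chain_at[where g = exp, unfolded o_def])
         (auto intro!: derivative_eq_intros)
    ultimately have "((cis \<circ> (\<lambda>y. s * phase y)) has_vector_derivative (s * phase_deriv y) *\<^sub>R (\<i> * cis (s * phase y))) (at y)"
      by (intro vector_diff_chain_at) (auto simp: has_real_derivative_iff_has_vector_derivative)
    then show ?thesis
      by (simp add: o_def scaleR_conv_of_real mult.assoc)
  qed
  from has_partial_coordinate[OF this, of b 2] show "has_partial b c (c' b)"
    by (simp add: c_def c'_def eq_commute[of 2])
  have ph: "continuous_on UNIV (\<lambda>r::point. phase (r $ 2))"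
    by (rule continuous_on_compose2[of UNIV phase])
       (auto intro!: continuous_intros continuous_at_imp_continuous_on DERIV_isCont[OF DERIV_phase])
  have ph': "continuous_on UNIV (\<lambda>r::point. phase_deriv (r $ 2))"
    by (rule continuous_on_compose2[of UNIV phase_deriv]) (auto intro!: continuous_intros continuous_on_phase_deriv)
  show "continuous_on UNIV c"
    unfolding c_def by (intro continuous_intros ph)
  show "continuous_on UNIV (c' b)"
    unfolding c'_def by (cases "b = 2") (auto intro!: continuous_intros ph ph')
qed

section \<open>Lower bound by transport around a loop\<close>

definition flux_box :: "real \<Rightarrow> point set" where
  "flux_box R = {r. R \<le> r $ 1 \<and> r $ 1 \<le> 2 * R \<and> -2 * R \<le> r $ 2 \<and> r $ 2 \<le> - R}"

lemma flux_box_sets [measurable]: "flux_box R \<in> sets borel"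
  unfolding flux_box_def by measurable

text \<open>Cauchy-Schwarz for four summands costs a factor 4, which the square of the 2 on the left
  cancels.\<close>

lemma norm_sum4_power2_le:
  fixes a b c d :: complex
  assumes "- 2 * z = a + b + c - d"
  shows "(cmod z)\<^sup>2 \<le> (cmod a)\<^sup>2 + (cmod b)\<^sup>2 + (cmod c)\<^sup>2 + (cmod d)\<^sup>2"
proof -
  have "2 * cmod z = cmod (a + b + c - d)"
    using arg_cong[OF assms, of cmod] by (simp add: norm_mult)
  also have "\<dots> \<le> cmod a + cmod b + cmod c + cmod d"
    using norm_triangle_ineq4[of "a + b + c" d] norm_triangle_ineq[of "a + b" c] norm_triangle_ineq[of a b] by linarith
  finally have "(2 * cmod z)\<^sup>2 \<le> (cmod a + cmod b + cmod c + cmod d)\<^sup>2"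
    by (intro power_mono) auto
  also have "\<dots> \<le> 4 * ((cmod a)\<^sup>2 + (cmod b)\<^sup>2 + (cmod c)\<^sup>2 + (cmod d)\<^sup>2)"
  proof -
    have "2 * x * y \<le> x\<^sup>2 + y\<^sup>2" for x y :: real
      by (rule sum_squares_bound)
    from this[of "cmod a" "cmod b"] this[of "cmod a" "cmod c"] this[of "cmod a" "cmod d"]
      this[of "cmod b" "cmod c"] this[of "cmod b" "cmod d"] this[of "cmod c" "cmod d"]
    show ?thesis
      unfolding power2_eq_square by (simp add: algebra_simps)
  qed
  finally show ?thesis
    by (simp add: power_mult_distrib)
qed

text \<open>
  Transport around the square loop with corners \<open>r\<close>, \<open>r + 3 R e\<^sub>2\<close>, \<open>r + 3 R (e\<^sub>2 - e\<^sub>1)\<close>, \<open>r - 3 R e\<^sub>1\<close>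
  multiplies \<open>\<psi>\<close> by \<open>- 1\<close>, so \<open>2 \<psi>(r)\<close> is a sum of increments along the four sides.
\<close>

lemma flux_box_estimate:
  fixes \<psi> g1 g2 :: "point \<Rightarrow> complex"
  assumes w: "weak_partial 1 \<psi> g1" "weak_partial 2 \<psi> g2" and R: "1 \<le> R"
    and \<psi>: "\<psi> \<in> borel_measurable borel" "integrable lborel (\<lambda>r. (cmod (\<psi> r))\<^sup>2)"
    and g1: "g1 \<in> borel_measurable borel" "integrable lborel (\<lambda>r. (cmod (g1 r))\<^sup>2)"
    and g2: "g2 \<in> borel_measurable borel" "integrable lborel (\<lambda>r. (cmod (g2 r))\<^sup>2)"
  shows "(\<integral>\<^sup>+r. indicator (flux_box R) r * ennreal ((cmod (\<psi> r))\<^sup>2) \<partial>lborel) \<le>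
    ennreal (9 * R\<^sup>2) * (2 * (\<integral>\<^sup>+r. ennreal ((cmod (g1 r))\<^sup>2) \<partial>lborel) +
      (\<integral>\<^sup>+r. ennreal ((cmod (g2 r + \<i> * of_real (half_flux r $ 2) * \<psi> r))\<^sup>2) \<partial>lborel))"
proof -
  note [measurable] = \<psi>(1) g1(1) g2(1)
  define len where "len = 3 * R"
  have len: "0 \<le> len" using R by (simp add: len_def)
  \<comment> \<open>Gauge factor for the half-space where the potential lives: the ordinary
    derivative of \<open>c \<psi>\<close> in direction 2 is \<open>c\<close> times the covariant
    derivative of \<open>\<psi>\<close>, with the same modulus.\<close>
  define c where "c = (\<lambda>r::point. cis (1 * phase (r $ 2)))"
  define c' where "c' b = (\<lambda>r::point. if b = 2 then of_real (1 * phase_deriv (r $ 2)) * \<i> * cis (1 * phase (r $ 2)) else 0)" for b :: 3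
  have c: "has_partial b c (c' b)" "continuous_on UNIV c" "continuous_on UNIV (c' b)" for b
    unfolding c_def c'_def by (rule phase_factor)+
  have [measurable]: "c \<in> borel_measurable borel" "c' b \<in> borel_measurable borel" for b
    by (intro borel_measurable_continuous_onI c)+
  have c_norm: "cmod (c r) = 1" for r
    by (simp add: c_def)
  define \<eta> where "\<eta> r = c r * \<psi> r" for r
  define h where "h r = c' 2 r * \<psi> r + c r * g2 r" for r
  have h_eq: "h r = c r * (g2 r + \<i> * of_real (phase_deriv (r $ 2)) * \<psi> r)" for r
    by (simp add: h_def c_def c'_def algebra_simps)
  have [measurable]: "\<eta> \<in> borel_measurable borel" "h \<in> borel_measurable borel"
    unfolding \<eta>_def h_def by measurable
  have \<eta>: "weak_partial 2 \<eta> h"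
    unfolding \<eta>_def h_def by (rule weak_partial_mult[OF w(2) \<psi> g2 c(2) _ c(1)]) (use c in blast)
  have \<eta>_L2: "integrable lborel (\<lambda>r. (cmod (\<eta> r))\<^sup>2)"
    using \<psi>(2) by (simp add: \<eta>_def norm_mult c_norm)
  obtain M where M: "\<And>y. \<bar>phase_deriv y\<bar> \<le> M" "0 \<le> M"
    by (rule phase_deriv_bounded) (rule that)
  have h_L2: "integrable lborel (\<lambda>r. (cmod (h r))\<^sup>2)"
  proof (rule Bochner_Integration.integrable_bound)
    show "integrable lborel (\<lambda>r. 2 * (cmod (g2 r))\<^sup>2 + 2 * M\<^sup>2 * (cmod (\<psi> r))\<^sup>2)"
      using g2(2) \<psi>(2) by simp
    have "(cmod (h r))\<^sup>2 \<le> 2 * (cmod (g2 r))\<^sup>2 + 2 * M\<^sup>2 * (cmod (\<psi> r))\<^sup>2" for r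
    proof -
      have "cmod (h r) \<le> cmod (g2 r) + M * cmod (\<psi> r)"
      proof -
        have "cmod (h r) \<le> cmod (g2 r) + \<bar>phase_deriv (r $ 2)\<bar> * cmod (\<psi> r)"
          unfolding h_eq norm_mult c_norm
          using norm_triangle_ineq[of "g2 r" "\<i> * of_real (phase_deriv (r $ 2)) * \<psi> r"] by (simp add: norm_mult)
        also have "\<dots> \<le> cmod (g2 r) + M * cmod (\<psi> r)"
          using M by (intro add_left_mono mult_right_mono) auto
        finally show ?thesis .
      qed
      then have "(cmod (h r))\<^sup>2 \<le> (cmod (g2 r) + M * cmod (\<psi> r))\<^sup>2"
        by (intro power_mono) auto
      also have "\<dots> \<le> 2 * (cmod (g2 r))\<^sup>2 + 2 * (M * cmod (\<psi> r))\<^sup>2"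
        using sum_squares_bound[of "cmod (g2 r)" "M * cmod (\<psi> r)"] by (simp add: power2_sum)
      finally show ?thesis by (simp add: power_mult_distrib)
    qed
    then show "AE r in lborel. norm ((cmod (h r))\<^sup>2) \<le> norm (2 * (cmod (g2 r))\<^sup>2 + 2 * M\<^sup>2 * (cmod (\<psi> r))\<^sup>2)"
      by (intro AE_I2) (simp add: abs_of_nonneg)
    show "(\<lambda>r. (cmod (h r))\<^sup>2) \<in> borel_measurable lborel"
      by measurable
  qed
  \<comment> \<open>Vertical sides of the loop run inside one of these half-spaces: in
    \<open>E\<close> the gauged function \<open>\<eta>\<close> is used, in \<open>W\<close> the
    potential is zero and \<open>\<psi>\<close> itself serves. Horizontal sides need no gauge
    because the potential has no first component.\<close>
  define E W where "E = {r::point. 0 < r $ 1}" and "W = {r::point. r $ 1 \<le> 0}"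
  have [measurable]: "E \<in> sets borel" "W \<in> sets borel"
    unfolding E_def W_def by measurable
  have inv: "r + s *\<^sub>R axis 2 1 \<in> E \<longleftrightarrow> r \<in> E" "r + s *\<^sub>R axis 2 1 \<in> W \<longleftrightarrow> r \<in> W" for r s
    by (simp_all add: E_def W_def axis_def)
  define e1 e2 where "e1 = (axis 1 1 :: point)" and "e2 = (axis 2 1 :: point)"
  define D1 where "D1 r = indicator E r * ennreal ((cmod (\<eta> (r + len *\<^sub>R e2) - \<eta> r))\<^sup>2)" for r
  define D2 where "D2 r = ennreal ((cmod (\<psi> (r + len *\<^sub>R e1) - \<psi> r))\<^sup>2)" for r
  define D3 where "D3 r = indicator W r * ennreal ((cmod (\<psi> (r + len *\<^sub>R e2) - \<psi> r))\<^sup>2)" for r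
  have [measurable]: "D1 \<in> borel_measurable borel" "D2 \<in> borel_measurable borel" "D3 \<in> borel_measurable borel"
    unfolding D1_def D2_def D3_def by measurable
  have I1: "(\<integral>\<^sup>+r. D1 r \<partial>lborel) \<le> ennreal (len\<^sup>2) * (\<integral>\<^sup>+r. indicator E r * ennreal ((cmod (h r))\<^sup>2) \<partial>lborel)"
    unfolding D1_def e2_def by (rule weak_partial_translation[OF \<eta> len _ \<eta>_L2 _ h_L2 _ inv(1)]) measurable
  have I2: "(\<integral>\<^sup>+r. D2 r \<partial>lborel) \<le> ennreal (len\<^sup>2) * (\<integral>\<^sup>+r. ennreal ((cmod (g1 r))\<^sup>2) \<partial>lborel)"
    using weak_partial_translation[OF w(1) len \<psi> g1, of UNIV] by (simp add: D2_def e1_def)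
  have I3: "(\<integral>\<^sup>+r. D3 r \<partial>lborel) \<le> ennreal (len\<^sup>2) * (\<integral>\<^sup>+r. indicator W r * ennreal ((cmod (g2 r))\<^sup>2) \<partial>lborel)"
    unfolding D3_def e2_def by (rule weak_partial_translation[OF w(2) len \<psi> g2 _ inv(2)]) measurable
  have pointwise: "indicator (flux_box R) r * ennreal ((cmod (\<psi> r))\<^sup>2) \<le>
      D1 r + D2 (r + (len *\<^sub>R e2 - len *\<^sub>R e1)) + D3 (r + (- len) *\<^sub>R e1) + D2 (r + (- len) *\<^sub>R e1)" for r
  proof (cases "r \<in> flux_box R")
    case True
    then have r: "R \<le> r $ 1" "r $ 1 \<le> 2 * R" "-2 * R \<le> r $ 2" "r $ 2 \<le> - R"
      by (auto simp: flux_box_def)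
    \<comment> \<open>A point of the box has first coordinate in [R, 2R] and second in [-2R, -R].
      Moving by \<open>3 R\<close> to the left or upwards lands in [-2R, -R] and [R, 2R]
      respectively, so with \<open>R \<ge> 1\<close> the loop encloses the slit.\<close>
    have "r \<in> E" "r + (- len) *\<^sub>R e1 \<in> W"
      using r R by (auto simp: E_def W_def e1_def axis_def len_def)
    \<comment> \<open>The origin of the sign: along the right side the gauge factor runs from 1 to
      \<open>- 1\<close>, so the increment of \<open>\<eta>\<close> is minus the sum of the end
      values of \<open>\<psi>\<close>. The other three sides telescope.\<close>
    have "phase (r $ 2) = 0" "phase ((r + len *\<^sub>R e2) $ 2) = pi"
      using r R by (auto intro!: phase_le phase_ge simp: e2_def axis_def len_def)
    then have "c r = 1" "c (r + len *\<^sub>R e2) = - 1"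
      by (simp_all add: c_def)
    then have \<eta>_corner: "\<eta> (r + len *\<^sub>R e2) - \<eta> r = - \<psi> (r + len *\<^sub>R e2) - \<psi> r"
      by (simp add: \<eta>_def)
    let ?a = "- \<psi> (r + len *\<^sub>R e2) - \<psi> r" and ?b = "\<psi> (r + len *\<^sub>R e2) - \<psi> (r + (len *\<^sub>R e2 - len *\<^sub>R e1))"
      and ?c = "\<psi> (r + (len *\<^sub>R e2 - len *\<^sub>R e1)) - \<psi> (r + (- len) *\<^sub>R e1)" and ?d = "\<psi> r - \<psi> (r + (- len) *\<^sub>R e1)"
    have "(cmod (\<psi> r))\<^sup>2 \<le> (cmod ?a)\<^sup>2 + (cmod ?b)\<^sup>2 + (cmod ?c)\<^sup>2 + (cmod ?d)\<^sup>2"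
      by (rule norm_sum4_power2_le) simp
    then have "ennreal ((cmod (\<psi> r))\<^sup>2) \<le> ennreal ((cmod ?a)\<^sup>2 + (cmod ?b)\<^sup>2 + (cmod ?c)\<^sup>2 + (cmod ?d)\<^sup>2)"
      by (rule ennreal_leI)
    also have "\<dots> = ennreal ((cmod ?a)\<^sup>2) + ennreal ((cmod ?b)\<^sup>2) + ennreal ((cmod ?c)\<^sup>2) + ennreal ((cmod ?d)\<^sup>2)"
      by (simp add: ennreal_plus)
    also have "ennreal ((cmod ?a)\<^sup>2) = D1 r"
      using \<open>r \<in> E\<close> by (simp add: D1_def \<eta>_corner)
    also have "ennreal ((cmod ?b)\<^sup>2) = D2 (r + (len *\<^sub>R e2 - len *\<^sub>R e1))"
      by (simp add: D2_def algebra_simps)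
    also have "ennreal ((cmod ?c)\<^sup>2) = D3 (r + (- len) *\<^sub>R e1)"
      using \<open>r + (- len) *\<^sub>R e1 \<in> W\<close> by (simp add: D3_def algebra_simps)
    also have "ennreal ((cmod ?d)\<^sup>2) = D2 (r + (- len) *\<^sub>R e1)"
      by (simp add: D2_def)
    finally show ?thesis
      using True by simp
  qed simp
  have "(\<integral>\<^sup>+r. indicator (flux_box R) r * ennreal ((cmod (\<psi> r))\<^sup>2) \<partial>lborel) \<le>
      (\<integral>\<^sup>+r. D1 r + D2 (r + (len *\<^sub>R e2 - len *\<^sub>R e1)) + D3 (r + (- len) *\<^sub>R e1) + D2 (r + (- len) *\<^sub>R e1) \<partial>lborel)"
    by (intro nn_integral_mono pointwise)
  also have "\<dots> = (\<integral>\<^sup>+r. D1 r \<partial>lborel) + (\<integral>\<^sup>+r. D2 (r + (len *\<^sub>R e2 - len *\<^sub>R e1)) \<partial>lborel)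
      + (\<integral>\<^sup>+r. D3 (r + (- len) *\<^sub>R e1) \<partial>lborel) + (\<integral>\<^sup>+r. D2 (r + (- len) *\<^sub>R e1) \<partial>lborel)"
    by (simp add: nn_integral_add)
  also have "\<dots> = (\<integral>\<^sup>+r. D1 r \<partial>lborel) + (\<integral>\<^sup>+r. D2 r \<partial>lborel) + (\<integral>\<^sup>+r. D3 r \<partial>lborel) + (\<integral>\<^sup>+r. D2 r \<partial>lborel)"
    by (subst (1 2 3) lborel_nn_integral_translate) simp_all
  also have "\<dots> \<le> ennreal (len\<^sup>2) * (\<integral>\<^sup>+r. indicator E r * ennreal ((cmod (h r))\<^sup>2) \<partial>lborel)
      + ennreal (len\<^sup>2) * (\<integral>\<^sup>+r. ennreal ((cmod (g1 r))\<^sup>2) \<partial>lborel)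
      + ennreal (len\<^sup>2) * (\<integral>\<^sup>+r. indicator W r * ennreal ((cmod (g2 r))\<^sup>2) \<partial>lborel)
      + ennreal (len\<^sup>2) * (\<integral>\<^sup>+r. ennreal ((cmod (g1 r))\<^sup>2) \<partial>lborel)"
    by (intro add_mono I1 I2 I3)
  also have "\<dots> = ennreal (len\<^sup>2) * (2 * (\<integral>\<^sup>+r. ennreal ((cmod (g1 r))\<^sup>2) \<partial>lborel) +
      ((\<integral>\<^sup>+r. indicator E r * ennreal ((cmod (h r))\<^sup>2) \<partial>lborel) + (\<integral>\<^sup>+r. indicator W r * ennreal ((cmod (g2 r))\<^sup>2) \<partial>lborel)))"
    by (simp add: distrib_left mult_2 ac_simps)
  also have "(\<integral>\<^sup>+r. indicator E r * ennreal ((cmod (h r))\<^sup>2) \<partial>lborel) + (\<integral>\<^sup>+r. indicator W r * ennreal ((cmod (g2 r))\<^sup>2) \<partial>lborel)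
      = (\<integral>\<^sup>+r. indicator E r * ennreal ((cmod (h r))\<^sup>2) + indicator W r * ennreal ((cmod (g2 r))\<^sup>2) \<partial>lborel)"
    by (rule nn_integral_add[symmetric]) measurable
  \<comment> \<open>The two half-space terms are the two cases in the definition of
    \<open>half_flux\<close>, glued along \<open>r $ 1 = 0\<close>.\<close>
  also have "\<dots> = (\<integral>\<^sup>+r. ennreal ((cmod (g2 r + \<i> * of_real (half_flux r $ 2) * \<psi> r))\<^sup>2) \<partial>lborel)"
    by (intro nn_integral_cong) (auto simp: h_eq norm_mult c_norm half_flux_component E_def W_def indicator_def)
  finally show ?thesis
    by (simp add: len_def power_mult_distrib)
qed

lemma kinetic_half_flux_ge:
  assumes \<psi>: "\<psi> \<in> H1 1" and R: "1 \<le> R"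
  shows "(\<integral>\<^sup>+r. indicator (flux_box R) r * ennreal ((cmod (\<psi> (emb r)))\<^sup>2) \<partial>lborel)
    \<le> ennreal (36 * R\<^sup>2) * kinetic 1 half_flux \<psi>"
proof -
  define u where "u r = \<psi> (emb r)" for r
  define g where "g a r = wgrad 1 \<psi> 0 a (emb r)" for a r
  have u: "u \<in> borel_measurable borel" "integrable lborel (\<lambda>r. (cmod (u r))\<^sup>2)"
    unfolding u_def using \<psi> L2_1_D(2,3)[of \<psi>] by (auto simp: H1_def)
  have g: "g a \<in> borel_measurable borel" "integrable lborel (\<lambda>r. (cmod (g a r))\<^sup>2)" for a
    unfolding g_def using L2_1_D(2,3)[OF wgrad_1(1)[OF \<psi>]] by auto
  have w: "weak_partial a u (g a)" for a
    unfolding u_def g_def by (rule wgrad_1(2)[OF \<psi>])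
  note [measurable] = u(1) g(1)
  define X where "X a = (\<integral>\<^sup>+r. ennreal ((cmod (g a r + \<i> * of_real (half_flux r $ a) * u r))\<^sup>2) \<partial>lborel)" for a
  have half: "(\<integral>\<^sup>+r. ennreal (1/2 * (cmod (- \<i> * g a r + of_real (half_flux r $ a) * u r))\<^sup>2) \<partial>lborel) = ennreal (1/2) * X a" for a
  proof -
    have "- \<i> * g a r + of_real (half_flux r $ a) * u r = - \<i> * (g a r + \<i> * of_real (half_flux r $ a) * u r)" for r
      by (simp add: algebra_simps)
    then have eq: "cmod (- \<i> * g a r + of_real (half_flux r $ a) * u r) = cmod (g a r + \<i> * of_real (half_flux r $ a) * u r)" for r
      by (simp add: norm_mult)
    have "(\<integral>\<^sup>+r. ennreal (1/2 * (cmod (- \<i> * g a r + of_real (half_flux r $ a) * u r))\<^sup>2) \<partial>lborel)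
        = (\<integral>\<^sup>+r. ennreal (1/2) * ennreal ((cmod (g a r + \<i> * of_real (half_flux r $ a) * u r))\<^sup>2) \<partial>lborel)"
      unfolding eq by (intro nn_integral_cong ennreal_mult') simp
    also have "\<dots> = ennreal (1/2) * X a"
      unfolding X_def by (rule nn_integral_cmult) measurable
    finally show ?thesis .
  qed
  have kin: "kinetic 1 half_flux \<psi> = ennreal (1/2) * (X 1 + X 2 + X 3)"
    unfolding kinetic_1[OF \<psi> borel_measurable_half_flux] half[unfolded g_def u_def]
    by (simp add: sum_3 distrib_left)
  have "(\<integral>\<^sup>+r. indicator (flux_box R) r * ennreal ((cmod (u r))\<^sup>2) \<partial>lborel) \<le>
      ennreal (9 * R\<^sup>2) * (2 * (\<integral>\<^sup>+r. ennreal ((cmod (g 1 r))\<^sup>2) \<partial>lborel) + X 2)"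
    unfolding X_def by (rule flux_box_estimate[OF w w R u g g])
  also have "(\<integral>\<^sup>+r. ennreal ((cmod (g 1 r))\<^sup>2) \<partial>lborel) = X 1"
    by (simp add: X_def half_flux_component)
  \<comment> \<open>Raising all coefficients to 2 recovers the full kinetic energy; with the 1/2 in
    front of it, the constant becomes 9 * 2 * 2 = 36.\<close>
  also have "ennreal (9 * R\<^sup>2) * (2 * X 1 + X 2) \<le> ennreal (9 * R\<^sup>2) * (2 * (X 1 + X 2 + X 3))"
    by (intro mult_left_mono) (auto simp: mult_2 ac_simps intro!: add_mono add_increasing2)
  also have "\<dots> = ennreal (36 * R\<^sup>2) * (ennreal (1/2) * (X 1 + X 2 + X 3))"
  proof -
    have "ennreal (9 * R\<^sup>2) * 2 = ennreal (36 * R\<^sup>2) * ennreal (1/2)"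
    proof -
      have "ennreal (9 * R\<^sup>2) * 2 = ennreal (9 * R\<^sup>2 * 2)"
        by (subst ennreal_mult') simp_all
      also have "9 * R\<^sup>2 * 2 = 36 * R\<^sup>2 * (1/2)"
        by simp
      also have "ennreal (36 * R\<^sup>2 * (1/2)) = ennreal (36 * R\<^sup>2) * ennreal (1/2)"
        by (rule ennreal_mult') simp
      finally show ?thesis .
    qed
    then show ?thesis
      by (simp only: mult.assoc[symmetric])
  qed
  finally show ?thesis
    by (simp add: kin u_def)
qed

text \<open>Both sides of the orbital estimate are quadratic in the orbital, so it may be weighted
  and summed over the spectral resolution. This works for any mixed state, not only for pure
  ones.\<close>

lemma energy_half_flux_ge:
  assumes \<Gamma>: "\<Gamma> \<in> states_with_density 1 \<rho>" and R: "1 \<le> R"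
  shows "(\<integral>\<^sup>+r. indicator (flux_box R) r * ennreal (\<rho> r) \<partial>lborel) \<le> ennreal (36 * R\<^sup>2) * energy 1 half_flux \<Gamma>"
proof -
  obtain w \<psi> where \<Gamma>_eq: "\<Gamma> = (w, \<psi>)" by (cases \<Gamma>)
  have dm: "density_matrix 1 (w, \<psi>)" and dens: "AE r in lborel. state_density 1 (w, \<psi>) r = \<rho> r"
    using \<Gamma> by (auto simp: states_with_density_def states_def \<Gamma>_eq)
  have w0: "0 \<le> w i" and H1: "w i > 0 \<Longrightarrow> \<psi> i \<in> H1 1"
    and norm1: "w i > 0 \<Longrightarrow> inner_L2 1 (\<psi> i) (\<psi> i) = 1" for i
    using dm by (auto simp: density_matrix_def)
  have w1: "w sums 1"
    using dm by (simp add: density_matrix_def)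
  define q where "q i r = w i * (cmod (\<psi> i (emb r)))\<^sup>2" for i r
  have q0: "0 \<le> q i r" for i r
    using w0 by (simp add: q_def)
  have [measurable]: "q i \<in> borel_measurable borel" for i
  \<comment> \<open>Orbitals of weight 0 are unconstrained and may fail to be measurable, but they
    contribute the zero function.\<close>
  proof (cases "w i > 0")
    case True
    then have [measurable]: "(\<lambda>r. \<psi> i (emb r)) \<in> borel_measurable borel"
      using H1[of i] L2_1_D(2) by (auto simp: H1_def)
    show ?thesis unfolding q_def by measurable
  next
    case False
    then have "w i = 0" using w0[of i] by linarith
    then show ?thesis by (simp add: q_def[abs_def])
  qed
  have mass: "(\<integral>\<^sup>+r. ennreal (q i r) \<partial>lborel) = ennreal (w i)" for i
  proof (cases "w i > 0")
    case True
    have L2: "\<psi> i \<in> L2 1"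
      using H1[OF True] by (simp add: H1_def)
    have "inner_L2 1 (\<psi> i) (\<psi> i) = (LINT x|conf {..<1}. complex_of_real ((cmod (\<psi> i x))\<^sup>2))"
      unfolding inner_L2_def by (intro Bochner_Integration.integral_cong refl) (simp only: complex_norm_square mult.commute)
    also have "\<dots> = complex_of_real (LINT x|conf {..<1}. (cmod (\<psi> i x))\<^sup>2)"
      by (rule integral_complex_of_real)
    also have "(LINT x|conf {..<1}. (cmod (\<psi> i x))\<^sup>2) = (LINT r|lborel. (cmod (\<psi> i (emb r)))\<^sup>2)"
      using L2_1_D(1)[OF L2] by (intro integral_conf) measurable
    finally have "(LINT r|lborel. (cmod (\<psi> i (emb r)))\<^sup>2) = 1"
      using norm1[OF True] by (metis of_real_1 of_real_eq_iff)
    then have "(\<integral>\<^sup>+r. ennreal (q i r) \<partial>lborel) = ennreal (w i * 1)"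
      unfolding q_def using L2_1_D(3)[OF L2] w0[of i]
      by (subst nn_integral_eq_integral) auto
    then show ?thesis by simp
  next
    case False
    then have "w i = 0" using w0[of i] by linarith
    then show ?thesis by (simp add: q_def)
  qed
  have "(\<integral>\<^sup>+r. (\<Sum>i. ennreal (q i r)) \<partial>lborel) = (\<Sum>i. ennreal (w i))"
    by (subst nn_integral_suminf) (simp_all add: mass)
  also have "\<dots> = ennreal 1"
    using w1 w0 by (subst suminf_ennreal2) (auto simp: sums_iff)
  \<comment> \<open>\<open>state_density\<close> is a real \<open>suminf\<close>, meaningful only
    where the series converges. Total mass 1 gives convergence almost everywhere, and there it
    agrees with the extended sum.\<close>
  finally have "AE r in lborel. (\<Sum>i. ennreal (q i r)) \<noteq> \<infinity>"
    by (intro nn_integral_noteq_infinite) auto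
  with dens have \<rho>: "AE r in lborel. ennreal (\<rho> r) = (\<Sum>i. ennreal (q i r))"
  proof eventually_elim
    case (elim r)
    have "summable (\<lambda>i. q i r)"
      using elim q0 by (intro summable_suminf_not_top) (auto simp: top_ennreal_def infinity_ennreal_def)
    then have "(\<Sum>i. ennreal (q i r)) = ennreal (\<Sum>i. q i r)"
      using q0 by (intro suminf_ennreal2) auto
    with elim show ?case
      by (simp add: state_density_def pure_density_1 q_def)
  qed
  have "(\<integral>\<^sup>+r. indicator (flux_box R) r * ennreal (\<rho> r) \<partial>lborel)
      = (\<integral>\<^sup>+r. (\<Sum>i. indicator (flux_box R) r * ennreal (q i r)) \<partial>lborel)"
    using \<rho> by (intro nn_integral_cong_AE) (auto elim: eventually_mono)
  also have "\<dots> = (\<Sum>i. \<integral>\<^sup>+r. indicator (flux_box R) r * ennreal (q i r) \<partial>lborel)"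
    by (rule nn_integral_suminf) measurable
  also have "\<dots> \<le> (\<Sum>i. ennreal (36 * R\<^sup>2) * (ennreal (w i) * pure_energy 1 half_flux (\<psi> i)))"
  proof (intro suminf_le summableI)
    fix i
    show "(\<integral>\<^sup>+r. indicator (flux_box R) r * ennreal (q i r) \<partial>lborel)
        \<le> ennreal (36 * R\<^sup>2) * (ennreal (w i) * pure_energy 1 half_flux (\<psi> i))"
    proof (cases "w i > 0")
      case True
      have [measurable]: "(\<lambda>r. \<psi> i (emb r)) \<in> borel_measurable borel"
        using H1[OF True] L2_1_D(2) by (auto simp: H1_def)
      have "(\<integral>\<^sup>+r. indicator (flux_box R) r * ennreal (q i r) \<partial>lborel)
          = (\<integral>\<^sup>+r. ennreal (w i) * (indicator (flux_box R) r * ennreal ((cmod (\<psi> i (emb r)))\<^sup>2)) \<partial>lborel)"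
        unfolding q_def using w0[of i] by (intro nn_integral_cong) (simp add: ennreal_mult' ac_simps)
      also have "\<dots> = ennreal (w i) * (\<integral>\<^sup>+r. indicator (flux_box R) r * ennreal ((cmod (\<psi> i (emb r)))\<^sup>2) \<partial>lborel)"
        by (rule nn_integral_cmult) measurable
      also have "\<dots> \<le> ennreal (w i) * (ennreal (36 * R\<^sup>2) * kinetic 1 half_flux (\<psi> i))"
        by (intro mult_left_mono kinetic_half_flux_ge H1 True R) simp
      finally show ?thesis
        by (simp add: pure_energy_def coulomb_1 ac_simps)
    next
      case False
      then have "w i = 0" using w0[of i] by linarith
      then show ?thesis by (simp add: q_def)
    qed
  qed
  also have "\<dots> = ennreal (36 * R\<^sup>2) * energy 1 half_flux \<Gamma>"
    by (simp add: energy_def \<Gamma>_eq ennreal_suminf_cmult)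
  finally show ?thesis .
qed

text \<open>Repeating the same orbital is harmless, since orthonormality is asked only of entries
  with positive weight.\<close>

definition pure_state :: "wavefun \<Rightarrow> mixed" where
  "pure_state \<psi> = (\<lambda>i. if i = 0 then 1 else 0, \<lambda>_. \<psi>)"

lemma energy_pure_state: "energy N A (pure_state \<psi>) = pure_energy N A \<psi>"
proof -
  have "(\<lambda>i. ennreal (if i = 0 then 1 else 0) * pure_energy N A \<psi>) = (\<lambda>i. if i = (0::nat) then pure_energy N A \<psi> else 0)"
    by auto
  then show ?thesis
    using sums_unique[OF sums_single[of 0 "\<lambda>_. pure_energy N A \<psi>"]] by (simp add: energy_def pure_state_def)
qed

lemma state_density_pure_state: "state_density N (pure_state \<psi>) r = pure_density N \<psi> r"
proof -
  have "(\<lambda>i. (if i = 0 then 1 else 0) * pure_density N \<psi> r) = (\<lambda>i. if i = (0::nat) then pure_density N \<psi> r else 0)"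
    by auto
  then show ?thesis
    using sums_unique[OF sums_single[of 0 "\<lambda>_. pure_density N \<psi> r"]] by (simp add: state_density_def pure_state_def)
qed

lemma state_current_pure_state: "state_current N (pure_state \<psi>) r = pure_current N \<psi> r"
proof -
  have "(\<lambda>i. (if i = 0 then 1 else 0) *\<^sub>R pure_current N \<psi> r) = (\<lambda>i. if i = (0::nat) then pure_current N \<psi> r else 0)"
    by auto
  then show ?thesis
    using sums_unique[OF sums_single[of 0 "\<lambda>_. pure_current N \<psi> r"]] by (simp add: state_current_def pure_state_def)
qed

section \<open>Explicit pure states given by classical functions\<close>

lemma integrable_power2_bounded_support:
  fixes v :: "real^'n \<Rightarrow> complex"
  assumes [measurable]: "v \<in> borel_measurable borel"
    and "\<And>r. cmod (v r) \<le> C" "\<And>r. K < norm r \<Longrightarrow> v r = 0"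
  shows "integrable lborel (\<lambda>r. (cmod (v r))\<^sup>2)"
proof (rule Bochner_Integration.integrable_bound)
  show "integrable lborel (\<lambda>r::real^'n. indicator (cball 0 K) r * C\<^sup>2)"
    by (intro integrable_mult_left integrable_real_indicator) (use emeasure_lborel_cball_finite in \<open>auto simp: infinity_ennreal_def\<close>)
  have "(cmod (v r))\<^sup>2 \<le> indicator (cball 0 K) r * C\<^sup>2" for r
    using assms(2)[of r] assms(3)[of r] by (cases "K < norm r") (auto intro: power_mono)
  then show "AE r in lborel. norm ((cmod (v r))\<^sup>2) \<le> norm (indicator (cball 0 K) r * C\<^sup>2)"
    by (intro AE_I2) (simp add: abs_of_nonneg)
  show "(\<lambda>r. (cmod (v r))\<^sup>2) \<in> borel_measurable lborel"
    by measurable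
qed

locale one_particle_state =
  fixes u :: "point \<Rightarrow> complex" and u' :: "3 \<Rightarrow> point \<Rightarrow> complex" and C K :: real
  assumes partial: "has_partial a u (u' a)"
    and meas [measurable]: "u \<in> borel_measurable borel" "u' a \<in> borel_measurable borel"
    and bound: "cmod (u r) \<le> C" "cmod (u' a r) \<le> C"
    and support: "K < norm r \<Longrightarrow> u r = 0"
    and normalized: "(LINT r|lborel. (cmod (u r))\<^sup>2) = 1"
begin

definition \<psi> :: wavefun where "\<psi> x = u (x 0)"

lemma u_L2: "integrable lborel (\<lambda>r. (cmod (u r))\<^sup>2)"
  by (rule integrable_power2_bounded_support) (auto intro: bound support)

lemma u'_L2: "integrable lborel (\<lambda>r. (cmod (u' a r))\<^sup>2)"
  by (rule integrable_power2_bounded_support) (auto intro: bound has_partial_zero_outside[OF partial support])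

lemma weak_partial_u: "weak_partial a u (u' a)"
  by (rule weak_partial_classical[OF partial _ _ bound u_L2 u'_L2]) measurable

lemma \<psi>_H1: "\<psi> \<in> H1 1"
  unfolding \<psi>_def[abs_def] by (rule H1_1_lift[OF _ u_L2 weak_partial_u _ u'_L2]) measurable

lemma \<psi>_emb: "\<psi> (emb r) = u r"
  by (simp add: \<psi>_def)

lemma wgrad_\<psi>: "AE r in lborel. wgrad 1 \<psi> 0 a (emb r) = u' a r"
  by (rule wgrad_1_eq[OF \<psi>_H1 _ _ u'_L2]) (simp_all add: \<psi>_emb weak_partial_u)

lemma energy_\<psi>: "energy 1 (\<lambda>_. 0) (pure_state \<psi>) = ennreal (\<Sum>a\<in>UNIV. 1/2 * (LINT r|lborel. (cmod (u' a r))\<^sup>2))"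
proof -
  have "(\<integral>\<^sup>+r. ennreal (1/2 * (cmod (- \<i> * wgrad 1 \<psi> 0 a (emb r) + of_real (0 $ a) * \<psi> (emb r)))\<^sup>2) \<partial>lborel)
      = (\<integral>\<^sup>+r. ennreal (1/2 * (cmod (u' a r))\<^sup>2) \<partial>lborel)" for a
    using wgrad_\<psi>[of a] by (intro nn_integral_cong_AE) (auto simp: norm_mult elim!: eventually_mono)
  also have "(\<integral>\<^sup>+r. ennreal (1/2 * (cmod (u' a r))\<^sup>2) \<partial>lborel) = ennreal (1/2 * (LINT r|lborel. (cmod (u' a r))\<^sup>2))" for a
    using u'_L2[of a] by (subst nn_integral_eq_integral) auto
  finally show ?thesis
    by (simp add: energy_pure_state pure_energy_def coulomb_1 kinetic_1[OF \<psi>_H1] sum_ennreal del: One_nat_def)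
qed

lemma pure_state_\<psi>: "pure_state \<psi> \<in> states_with_density 1 (\<lambda>r. (cmod (u r))\<^sup>2)"
proof -
  have [measurable]: "\<psi> \<in> borel_measurable (conf {..<1})"
    using \<psi>_H1 by (simp add: H1_def L2_def)
  have "inner_L2 1 \<psi> \<psi> = (LINT x|conf {..<1}. complex_of_real ((cmod (\<psi> x))\<^sup>2))"
    unfolding inner_L2_def by (intro Bochner_Integration.integral_cong refl) (simp only: complex_norm_square mult.commute)
  also have "\<dots> = complex_of_real (LINT x|conf {..<1}. (cmod (\<psi> x))\<^sup>2)"
    by (rule integral_complex_of_real)
  also have "(LINT x|conf {..<1}. (cmod (\<psi> x))\<^sup>2) = (LINT r|lborel. (cmod (\<psi> (emb r)))\<^sup>2)"
    by (intro integral_conf) measurable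
  finally have "inner_L2 1 \<psi> \<psi> = 1"
    by (simp add: \<psi>_emb normalized)
  moreover have "(\<lambda>i::nat. if i = 0 then 1 else 0 :: real) sums 1"
    using sums_single[of 0 "\<lambda>_. 1::real"] by simp
  ultimately have "density_matrix 1 (pure_state \<psi>)"
    by (auto simp: density_matrix_def pure_state_def \<psi>_H1 antisymmetric_1 split: if_splits)
  then show ?thesis
    by (simp add: states_with_density_def states_def energy_\<psi> state_density_pure_state pure_density_1 \<psi>_emb)
qed

lemma current_\<psi>: "AE r in lborel. state_current 1 (pure_state \<psi>) r = (\<chi> a. Im (cnj (u r) * u' a r))"
proof -
  have "AE r in lborel. \<forall>a. wgrad 1 \<psi> 0 a (emb r) = u' a r"
    unfolding AE_all_countable using wgrad_\<psi> by blast
  then show ?thesis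
    by eventually_elim (simp add: state_current_pure_state pure_current_1 \<psi>_emb)
qed

end

subsection \<open>Upper bound for the maximin functional\<close>

text \<open>In \<open>hole\<close> the radius 2 leaves room around the slit
  \<open>r $ 1 = 0\<close>, \<open>|r $ 2| \<le> 1\<close> that carries the flux: \<open>f\<close>
  vanishes in a whole neighbourhood of it, so a phase that jumps across the slit does no
  harm.\<close>

locale amplitude =
  fixes f :: "point \<Rightarrow> real" and f' :: "3 \<Rightarrow> point \<Rightarrow> real" and C K :: real
  assumes partial: "has_partial a f (f' a)"
    and meas [measurable]: "f \<in> borel_measurable borel" "f' a \<in> borel_measurable borel"
    and bound: "\<bar>f r\<bar> \<le> C" "\<bar>f' a r\<bar> \<le> C"
    and support: "K < norm r \<Longrightarrow> f r = 0"
    and normalized: "(LINT r|lborel. (f r)\<^sup>2) = 1"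
    and hole: "(r $ 1)\<^sup>2 + (r $ 2)\<^sup>2 < 4 \<Longrightarrow> f r = 0"
begin

definition \<rho> :: "point \<Rightarrow> real" where "\<rho> r = (f r)\<^sup>2"

definition dirichlet :: real where "dirichlet = (\<Sum>a\<in>UNIV. 1/2 * (LINT r|lborel. (f' a r)\<^sup>2))"

text \<open>The phase winding once around the tube. It equals 1 on the half-plane
  \<open>r $ 1 = 0\<close> away from the slit because \<open>2 * phase\<close> is 0 or 2 pi there,
  so its only jump lies in the hole of \<open>f\<close>.\<close>

definition twist :: "point \<Rightarrow> complex" where
  "twist r = (if 0 < r $ 1 then cis (- 2 * phase (r $ 2)) else 1)"

definition twisted :: "point \<Rightarrow> complex" where
  "twisted r = twist r * of_real (f r)"

definition twisted' :: "3 \<Rightarrow> point \<Rightarrow> complex" where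
  "twisted' a r = twist r * (of_real (f' a r) - 2 * \<i> * of_real (half_flux r $ a) * of_real (f r))"

lemma \<rho>_nonneg: "0 \<le> \<rho> r"
  by (simp add: \<rho>_def)

lemma borel_measurable_\<rho> [measurable]: "\<rho> \<in> borel_measurable borel"
  unfolding \<rho>_def[abs_def] by measurable

lemma norm_twist: "cmod (twist r) = 1"
  by (simp add: twist_def)

lemma borel_measurable_twist [measurable]: "twist \<in> borel_measurable borel"
proof -
  have "(\<lambda>r::point. cis (- 2 * phase (r $ 2))) \<in> borel_measurable borel"
    by (intro borel_measurable_continuous_onI phase_factor(2))
  then have [measurable]: "(\<lambda>r::point. cis (- 2 * phase (r $ 2))) \<in> borel_measurable borel" .
  show ?thesis
    unfolding twist_def[abs_def] by measurable
qed

lemma has_partial_of_real: "has_partial a (\<lambda>r. of_real (f r) :: complex) (\<lambda>r. of_real (f' a r))"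
  using partial[of a] unfolding has_partial_def
  by (intro allI bounded_linear.has_vector_derivative[OF bounded_linear_of_real]) simp

lemma has_partial_twisted: "has_partial a twisted (twisted' a)"
  unfolding has_partial_def
proof
  fix r :: point
  let ?e = "axis a 1 :: point"
  have f: "((\<lambda>h. of_real (f (r + h *\<^sub>R ?e)) :: complex) has_vector_derivative of_real (f' a r)) (at 0)"
    using has_partial_of_real[of a] by (simp add: has_partial_def)
  show "((\<lambda>h. twisted (r + h *\<^sub>R ?e)) has_vector_derivative twisted' a r) (at 0)"
  proof (cases "0 < r $ 1")
    case True
    define c where "c = (\<lambda>r::point. cis (- 2 * phase (r $ 2)))"
    have "((\<lambda>h. c (r + h *\<^sub>R ?e)) has_vector_derivative
        (if a = 2 then of_real (- 2 * phase_deriv (r $ 2)) * \<i> * cis (- 2 * phase (r $ 2)) else 0)) (at 0)"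
      using phase_factor(1)[of a "- 2"] unfolding has_partial_def c_def by blast
    from has_vector_derivative_mult[OF this f]
    have "((\<lambda>h. c (r + h *\<^sub>R ?e) * of_real (f (r + h *\<^sub>R ?e))) has_vector_derivative twisted' a r) (at 0)"
      by (rule has_vector_derivative_eq_rhs)
        (use True exhaust_3[of a] in \<open>auto simp: twisted'_def twist_def c_def half_flux_component algebra_simps\<close>)
    then show ?thesis
    proof (rule has_vector_derivative_transform_within_open)
      show "open {h. 0 < (r + h *\<^sub>R ?e) $ 1}"
        by (intro open_Collect_less continuous_intros)
    qed (use True in \<open>auto simp: twisted_def twist_def c_def\<close>)
  next
    case False
    then have derivative: "twisted' a r = of_real (f' a r)"
      using exhaust_3[of a] by (auto simp: twisted'_def twist_def half_flux_component)
    \<comment> \<open>To the left of the interface, \<open>\<delta>\<close> is the distance to it.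
      On the interface, a step shorter than 1 either stays where \<open>|r $ 2| \<ge> 1\<close> and
      the phase is trivial, or remains in the hole because the squares add up to less than
      2.\<close>
    define \<delta> where "\<delta> = (if r $ 1 < 0 then - (r $ 1) else 1)"
    have eq: "twisted (r + h *\<^sub>R ?e) = of_real (f (r + h *\<^sub>R ?e))" if h: "\<bar>h\<bar> < \<delta>" for h
    proof (cases "0 < (r + h *\<^sub>R ?e) $ 1")
      case True
      then have a: "a = 1" and r1: "r $ 1 = 0"
        using False h by (auto simp: axis_def \<delta>_def split: if_splits)
      have r2: "(r + h *\<^sub>R ?e) $ 1 = h" "(r + h *\<^sub>R ?e) $ 2 = r $ 2"
        using a r1 by (simp_all add: axis_def)
      show ?thesis
      proof (cases "\<bar>r $ 2\<bar> < 1")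
        case True
        then have "(r $ 2)\<^sup>2 < 1" "h\<^sup>2 < 1"
          using h r1 by (auto simp: abs_square_less_1 \<delta>_def)
        then have "f (r + h *\<^sub>R ?e) = 0"
          by (intro hole) (simp only: r2)
        then show ?thesis by (simp add: twisted_def)
      next
        case False
        then have "r $ 2 \<le> -1 \<or> 1 \<le> r $ 2" by linarith
        then have "cis (- 2 * phase (r $ 2)) = 1"
          by (auto simp: phase_le phase_ge cis.ctr complex_eq_iff)
        then show ?thesis unfolding twisted_def twist_def r2 by simp
      qed
    qed (simp add: twisted_def twist_def)
    show ?thesis
      unfolding derivative
    proof (rule has_vector_derivative_transform_within_open[OF f])
      show "open {-\<delta><..<\<delta>}" by simp
      show "0 \<in> {-\<delta><..<\<delta>}" by (auto simp: \<delta>_def)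
    qed (use eq in auto)
  qed
qed

text \<open>Up to the unimodular \<open>twist\<close>, the derivative of \<open>f\<close> is real
  and the gauge term imaginary, so there is no cross term.\<close>

lemma norm_twisted': "(cmod (twisted' a r))\<^sup>2 = (f' a r)\<^sup>2 + 4 * ((half_flux r $ a)\<^sup>2 * \<rho> r)"
  by (simp add: twisted'_def norm_mult norm_twist cmod_power2 \<rho>_def power_mult_distrib)

sublocale plain: one_particle_state "\<lambda>r. of_real (f r)" "\<lambda>a r. of_real (f' a r)" C K
  by standard (auto simp: has_partial_of_real bound support normalized)

lemma half_flux_bounded: obtains M where "\<And>r a. \<bar>half_flux r $ a\<bar> \<le> M" "0 \<le> M"
proof -
  obtain M where M: "\<And>y. \<bar>phase_deriv y\<bar> \<le> M" "0 \<le> M"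
    by (rule phase_deriv_bounded) (rule that)
  have "\<bar>half_flux r $ a\<bar> \<le> M" for r a
    using exhaust_3[of a] M by (auto simp: half_flux_component)
  with M(2) show thesis by (rule that[rotated])
qed

lemma twisted_state: obtains C' where "one_particle_state twisted twisted' C' K"
proof -
  obtain M where M: "\<And>r a. \<bar>half_flux r $ a\<bar> \<le> M" "0 \<le> M"
    by (rule half_flux_bounded) (rule that)
  have C0: "0 \<le> C" using bound(1)[of 0] by linarith
  have "one_particle_state twisted twisted' (C + 2 * M * C) K"
  proof
    show "cmod (twisted r) \<le> C + 2 * M * C" for r
      using bound(1)[of r] M(2) C0 by (simp add: twisted_def norm_mult norm_twist add_increasing2)
    show "cmod (twisted' a r) \<le> C + 2 * M * C" for a r
    proof -
      have "cmod (twisted' a r) \<le> \<bar>f' a r\<bar> + 2 * \<bar>half_flux r $ a\<bar> * \<bar>f r\<bar>"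
        using norm_triangle_ineq4[of "of_real (f' a r)" "2 * \<i> * of_real (half_flux r $ a) * of_real (f r)"]
        by (simp add: twisted'_def norm_mult norm_twist)
      also have "\<dots> \<le> C + 2 * M * C"
        using bound(1)[of r] bound(2)[of a r] M(1)[of r a] M(2) C0 by (intro add_mono mult_mono) auto
      finally show ?thesis .
    qed
    show "twisted \<in> borel_measurable borel" "twisted' a \<in> borel_measurable borel" for a
      unfolding twisted_def[abs_def] twisted'_def[abs_def] by measurable
    show "(LINT r|lborel. (cmod (twisted r))\<^sup>2) = 1"
      using normalized by (simp add: twisted_def norm_mult norm_twist)
  qed (simp_all add: has_partial_twisted support twisted_def)
  then show thesis by (rule that)
qed

lemma integrable_\<rho>: "integrable lborel \<rho>"
  using plain.u_L2 by (simp add: \<rho>_def[abs_def])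

lemma integrable_\<rho>_half_flux_component: "integrable lborel (\<lambda>r. (half_flux r $ a)\<^sup>2 * \<rho> r)"
proof -
  obtain M where M: "\<And>r a. \<bar>half_flux r $ a\<bar> \<le> M" "0 \<le> M"
    by (rule half_flux_bounded) (rule that)
  show ?thesis
  proof (rule Bochner_Integration.integrable_bound)
    show "integrable lborel (\<lambda>r. M\<^sup>2 * \<rho> r)"
      by (intro integrable_mult_right integrable_\<rho>)
    show "AE r in lborel. norm ((half_flux r $ a)\<^sup>2 * \<rho> r) \<le> norm (M\<^sup>2 * \<rho> r)"
      using M by (intro AE_I2) (auto simp: abs_mult \<rho>_nonneg intro!: mult_right_mono power2_le_iff_abs_le[THEN iffD2])
    show "(\<lambda>r. (half_flux r $ a)\<^sup>2 * \<rho> r) \<in> borel_measurable lborel"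
      by measurable
  qed
qed

lemma norm_point_power2: "(norm (v :: point))\<^sup>2 = (\<Sum>a\<in>UNIV. (v $ a)\<^sup>2)"
  by (simp add: norm_vec_def L2_set_def sum_nonneg)

lemma vector_potential_half_flux: "vector_potential \<rho> half_flux"
proof -
  have "\<rho> r * (norm (half_flux r))\<^sup>2 = (\<Sum>a\<in>UNIV. (half_flux r $ a)\<^sup>2 * \<rho> r)" for r
    by (simp add: norm_point_power2 sum_distrib_left mult.commute)
  then show ?thesis
    by (simp add: vector_potential_def integrable_\<rho>_half_flux_component)
qed

definition diamagnetic :: real where "diamagnetic = (LINT r|lborel. \<rho> r * (norm (half_flux r))\<^sup>2)"

lemma electron_number_\<rho>: "electron_number \<rho> = 1"
  unfolding electron_number_def \<rho>_def using normalized by (auto intro!: the_equality)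

lemma electron_density_\<rho>: "electron_density \<rho>"
proof -
  have "states_with_density 1 \<rho> \<noteq> {}"
    using plain.pure_state_\<psi> by (auto simp: \<rho>_def[abs_def])
  moreover have "real 1 = (LINT r|lborel. \<rho> r)"
    using normalized by (simp add: \<rho>_def)
  ultimately show ?thesis
    unfolding electron_density_def using \<rho>_nonneg integrable_\<rho> by (metis zero_less_one)
qed

text \<open>The real state \<open>f\<close> is the competitor: it carries no paramagnetic current,
  and its energy is the Dirichlet integral.\<close>

lemma F_VR_plain: "F_VR \<rho> (\<lambda>_. 0) \<le> ereal dirichlet"
proof -
  have "pure_state plain.\<psi> \<in> states_with_density_current 1 \<rho> (\<lambda>_. 0)"
    using plain.pure_state_\<psi> plain.current_\<psi>
    by (auto simp: states_with_density_current_def \<rho>_def[abs_def] vec_eq_iff)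
  then have "F_VR \<rho> (\<lambda>_. 0) \<le> enn2ereal (energy 1 (\<lambda>_. 0) (pure_state plain.\<psi>))"
    unfolding F_VR_def electron_number_\<rho> by (rule INF_lower)
  also have "\<dots> = ereal dirichlet"
    by (simp add: plain.energy_\<psi> dirichlet_def sum_nonneg enn2ereal_ennreal del: sum_divide_distrib)
  finally show ?thesis .
qed

text \<open>The competitor is the twisted state: the gradient of its phase is \<open>- 2 A\<close>,
  which adds half of \<open>4 \<rho> |A|^2\<close> to the energy density.\<close>

lemma F_VR_twisted: "F_VR \<rho> (\<lambda>r. (- 2 * \<rho> r) *\<^sub>R half_flux r) \<le> ereal (dirichlet + 2 * diamagnetic)"
proof -
  obtain C' where "one_particle_state twisted twisted' C' K"
    by (rule twisted_state) (rule that)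
  then interpret t: one_particle_state twisted twisted' C' K .
  have density: "(cmod (twisted r))\<^sup>2 = \<rho> r" for r
    by (simp add: twisted_def norm_mult norm_twist \<rho>_def)
  have current: "(\<chi> a. Im (cnj (twisted r) * twisted' a r)) = (- 2 * \<rho> r) *\<^sub>R half_flux r" for r
  proof -
    have unimodular: "cnj (twist r) * twist r = 1"
      using complex_norm_square[of "twist r"] by (simp add: norm_twist mult.commute)
    have "cnj (twisted r) * twisted' a r = (cnj (twist r) * twist r) * (of_real (f r) * (of_real (f' a r) - 2 * \<i> * of_real (half_flux r $ a) * of_real (f r)))" for a
      by (simp add: twisted_def twisted'_def)
    then show ?thesis
      unfolding unimodular by (simp add: vec_eq_iff \<rho>_def power2_eq_square)
  qed
  have "pure_state t.\<psi> \<in> states_with_density_current 1 \<rho> (\<lambda>r. (- 2 * \<rho> r) *\<^sub>R half_flux r)"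
    using t.pure_state_\<psi> t.current_\<psi> unfolding density current
    by (simp add: states_with_density_current_def)
  then have "F_VR \<rho> (\<lambda>r. (- 2 * \<rho> r) *\<^sub>R half_flux r) \<le> enn2ereal (energy 1 (\<lambda>_. 0) (pure_state t.\<psi>))"
    unfolding F_VR_def electron_number_\<rho> by (rule INF_lower)
  also have "\<dots> = ereal (\<Sum>a\<in>UNIV. 1/2 * (LINT r|lborel. (cmod (twisted' a r))\<^sup>2))"
    by (simp add: t.energy_\<psi> sum_nonneg enn2ereal_ennreal del: sum_divide_distrib)
  also have "(\<Sum>a\<in>UNIV. 1/2 * (LINT r|lborel. (cmod (twisted' a r))\<^sup>2))
      = (\<Sum>a\<in>UNIV. 1/2 * (LINT r|lborel. (f' a r)\<^sup>2) + 2 * (LINT r|lborel. (half_flux r $ a)\<^sup>2 * \<rho> r))"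
    using plain.u'_L2 integrable_\<rho>_half_flux_component by (simp add: norm_twisted' distrib_left)
  also have "\<dots> = dirichlet + 2 * (\<Sum>a\<in>UNIV. LINT r|lborel. (half_flux r $ a)\<^sup>2 * \<rho> r)"
    by (simp add: dirichlet_def sum.distrib sum_distrib_left)
  also have "(\<Sum>a\<in>UNIV. LINT r|lborel. (half_flux r $ a)\<^sup>2 * \<rho> r) = (LINT r|lborel. (\<Sum>a\<in>UNIV. (half_flux r $ a)\<^sup>2 * \<rho> r))"
    using integrable_\<rho>_half_flux_component by simp
  also have "\<dots> = diamagnetic"
    by (simp add: diamagnetic_def norm_point_power2 sum_distrib_left mult.commute)
  finally show ?thesis .
qed

text \<open>Expanding the second square, the right side exceeds the left by exactly
  \<open>|k|^2 / \<rho>\<close> where \<open>\<rho> > 0\<close>, with both sides read as real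
  numbers. This is the cancellation that removes the diamagnetic energy.\<close>

lemma diamagnetic_trade_off:
  "ennreal (2 * (\<rho> r * (norm (half_flux r))\<^sup>2) + 2 * (k r \<bullet> half_flux r)) \<le>
    ennreal ((norm (0 - k r))\<^sup>2) / ennreal (2 * \<rho> r) +
    ennreal ((norm ((- 2 * \<rho> r) *\<^sub>R half_flux r - k r))\<^sup>2) / ennreal (2 * \<rho> r)"
proof (cases "\<rho> r = 0")
  \<comment> \<open>Where the density vanishes, the division convention makes the right side
    infinite unless \<open>k r = 0\<close>, and then both sides are 0.\<close>
  case True
  then show ?thesis
    by (cases "k r = 0") (simp_all add: ennreal_divide_zero divide_ennreal_def ennreal_mult_eq_top_iff)
next
  case False
  then have pos: "0 < \<rho> r" using \<rho>_nonneg[of r] by linarith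
  have "(norm ((- 2 * \<rho> r) *\<^sub>R half_flux r - k r))\<^sup>2 = 4 * (\<rho> r)\<^sup>2 * (norm (half_flux r))\<^sup>2 + 4 * \<rho> r * (k r \<bullet> half_flux r) + (norm (k r))\<^sup>2"
    unfolding power2_norm_eq_inner by (simp add: inner_diff inner_commute algebra_simps power2_eq_square)
  then have "(norm (0 - k r))\<^sup>2 / (2 * \<rho> r) + (norm ((- 2 * \<rho> r) *\<^sub>R half_flux r - k r))\<^sup>2 / (2 * \<rho> r)
      = (norm (k r))\<^sup>2 / \<rho> r + 2 * (\<rho> r * (norm (half_flux r))\<^sup>2) + 2 * (k r \<bullet> half_flux r)"
    using pos by (simp add: field_simps power2_eq_square)
  moreover have "0 \<le> (norm (k r))\<^sup>2 / \<rho> r"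
    using pos by simp
  ultimately have "2 * (\<rho> r * (norm (half_flux r))\<^sup>2) + 2 * (k r \<bullet> half_flux r)
      \<le> (norm (0 - k r))\<^sup>2 / (2 * \<rho> r) + (norm ((- 2 * \<rho> r) *\<^sub>R half_flux r - k r))\<^sup>2 / (2 * \<rho> r)"
    by linarith
  then have "ennreal (2 * (\<rho> r * (norm (half_flux r))\<^sup>2) + 2 * (k r \<bullet> half_flux r))
      \<le> ennreal ((norm (0 - k r))\<^sup>2 / (2 * \<rho> r) + (norm ((- 2 * \<rho> r) *\<^sub>R half_flux r - k r))\<^sup>2 / (2 * \<rho> r))"
    by (rule ennreal_leI)
  also have "\<dots> = ennreal ((norm (0 - k r))\<^sup>2 / (2 * \<rho> r)) + ennreal ((norm ((- 2 * \<rho> r) *\<^sub>R half_flux r - k r))\<^sup>2 / (2 * \<rho> r))"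
    using pos by (intro ennreal_plus) auto
  also have "\<dots> = ennreal ((norm (0 - k r))\<^sup>2) / ennreal (2 * \<rho> r) + ennreal ((norm ((- 2 * \<rho> r) *\<^sub>R half_flux r - k r))\<^sup>2) / ennreal (2 * \<rho> r)"
    using pos by (simp only: divide_ennreal zero_le_power2 mult_pos_pos zero_less_numeral)
  finally show ?thesis .
qed

lemma F_D_le:
  assumes "j \<in> borel_measurable borel" "F_VR \<rho> j \<le> ereal e"
  shows "F_D \<rho> k \<le> ereal e - enn2ereal (current_distance \<rho> j k)"
proof -
  have "F_D \<rho> k \<le> F_VR \<rho> j - enn2ereal (current_distance \<rho> j k)"
    unfolding F_D_def by (rule INF_lower[OF assms(1)])
  also have "\<dots> \<le> ereal e - enn2ereal (current_distance \<rho> j k)"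
    by (intro ereal_minus_mono assms(2)) simp
  finally show ?thesis .
qed

text \<open>Integrating the trade-off shows that the two upper bounds for
  \<open>F_D \<rho> k + \<integral> k \<bullet> A\<close> add up to at most twice
  \<open>dirichlet\<close>, so for each \<open>k\<close> at least one of them is at most
  \<open>dirichlet\<close>.\<close>

theorem G_D_le: "G_D \<rho> half_flux \<le> ereal dirichlet"
  unfolding G_D_def
proof (rule SUP_least)
  fix k assume "k \<in> {k \<in> borel_measurable borel. integrable lborel (\<lambda>r. k r \<bullet> half_flux r)}"
  then have [measurable]: "k \<in> borel_measurable borel" and int_k: "integrable lborel (\<lambda>r. k r \<bullet> half_flux r)"
    by auto
  define j :: field where "j r = (- 2 * \<rho> r) *\<^sub>R half_flux r" for r
  have [measurable]: "j \<in> borel_measurable borel"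
    unfolding j_def[abs_def] by measurable
  define d0 d1 where "d0 = current_distance \<rho> (\<lambda>_. 0) k" and "d1 = current_distance \<rho> j k"
  have F0: "F_D \<rho> k \<le> ereal dirichlet - enn2ereal d0"
    unfolding d0_def by (rule F_D_le[OF _ F_VR_plain]) simp
  have F1: "F_D \<rho> k \<le> ereal (dirichlet + 2 * diamagnetic) - enn2ereal d1"
    unfolding d1_def by (rule F_D_le) (use F_VR_twisted in \<open>simp_all add: j_def[abs_def]\<close>)
  let ?I = "LINT r|lborel. k r \<bullet> half_flux r"
  have int_\<rho>: "integrable lborel (\<lambda>r. \<rho> r * (norm (half_flux r))\<^sup>2)"
    using vector_potential_half_flux by (simp add: vector_potential_def)
  let ?h = "\<lambda>r. 2 * (\<rho> r * (norm (half_flux r))\<^sup>2) + 2 * (k r \<bullet> half_flux r)"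
  have int_h: "integrable lborel ?h"
    using int_\<rho> int_k by simp
  have integral_h: "(LINT r|lborel. ?h r) = 2 * diamagnetic + 2 * ?I"
    using int_\<rho> int_k by (simp add: diamagnetic_def)
  have "(\<integral>\<^sup>+r. ennreal (?h r) \<partial>lborel) \<le> (\<integral>\<^sup>+r. ennreal ((norm (0 - k r))\<^sup>2) / ennreal (2 * \<rho> r) +
      ennreal ((norm (j r - k r))\<^sup>2) / ennreal (2 * \<rho> r) \<partial>lborel)"
    unfolding j_def by (intro nn_integral_mono diamagnetic_trade_off)
  also have "\<dots> = d0 + d1"
    unfolding d0_def d1_def current_distance_def by (rule nn_integral_add) measurable
  finally have d: "(\<integral>\<^sup>+r. ennreal (?h r) \<partial>lborel) \<le> d0 + d1" .
  show "F_D \<rho> k + ereal ?I \<le> ereal dirichlet"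
  proof (cases "d0 = \<infinity> \<or> d1 = \<infinity>")
    case True
    then have "F_D \<rho> k \<le> - \<infinity>"
      using F0 F1 by auto
    then show ?thesis by simp
  next
    case False
    then obtain x0 x1 where x: "d0 = ennreal x0" "0 \<le> x0" "d1 = ennreal x1" "0 \<le> x1"
      by (metis ennreal_cases infinity_ennreal_def)
    \<comment> \<open>The integrand may be negative; the conversion to \<open>ennreal\<close> keeps
      its positive part, which can only enlarge the integral.\<close>
    have "2 * diamagnetic + 2 * ?I \<le> enn2real (\<integral>\<^sup>+r. ennreal (?h r) \<partial>lborel)"
      unfolding integral_h[symmetric] real_lebesgue_integral_def[OF int_h] by simp
    also have "\<dots> \<le> enn2real (ennreal (x0 + x1))"
      using d x by (intro enn2real_mono) (auto simp: ennreal_plus)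
    finally have le: "2 * diamagnetic + 2 * ?I \<le> x0 + x1"
      using x by (simp flip: ennreal_plus)
    have F0': "F_D \<rho> k \<le> ereal (dirichlet - x0)" and F1': "F_D \<rho> k \<le> ereal (dirichlet + 2 * diamagnetic - x1)"
      using F0 F1 x by (simp_all add: enn2ereal_ennreal)
    show ?thesis
    \<comment> \<open>Decides which of the two states gives the useful bound: the plain one if the
      coupling is at most its distance, otherwise the twisted one by \<open>le\<close>.\<close>
    proof (cases "?I \<le> x0")
      case True
      have "F_D \<rho> k + ereal ?I \<le> ereal (dirichlet - x0) + ereal ?I"
        by (intro add_right_mono F0')
      also have "\<dots> \<le> ereal dirichlet" using True by simp
      finally show ?thesis .
    next
      case False
      have "F_D \<rho> k + ereal ?I \<le> ereal (dirichlet + 2 * diamagnetic - x1) + ereal ?I"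
        by (intro add_right_mono F1')
      also have "\<dots> \<le> ereal dirichlet" using False le by simp
      finally show ?thesis .
    qed
  qed
qed

theorem G_ge:
  assumes R: "1 \<le> R" and V: "0 \<le> V" "ennreal (36 * R\<^sup>2 * V) \<le> (\<integral>\<^sup>+r. indicator (flux_box R) r * ennreal (\<rho> r) \<partial>lborel)"
  shows "ereal V \<le> G \<rho> half_flux"
  unfolding G_def electron_number_\<rho>
proof (rule INF_greatest)
  fix \<Gamma> assume \<Gamma>: "\<Gamma> \<in> states_with_density 1 \<rho>"
  have "ennreal (36 * R\<^sup>2) * ennreal V = ennreal (36 * R\<^sup>2 * V)"
    using V by (simp add: ennreal_mult')
  also have "\<dots> \<le> ennreal (36 * R\<^sup>2) * energy 1 half_flux \<Gamma>"
    using V(2) energy_half_flux_ge[OF \<Gamma> R] by (rule order_trans)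
  finally have "ennreal V \<le> energy 1 half_flux \<Gamma>"
    using R by (subst (asm) ennreal_mult_le_mult_iff) auto
  then have "enn2ereal (ennreal V) \<le> enn2ereal (energy 1 half_flux \<Gamma>)"
    by (simp add: less_eq_ennreal.rep_eq)
  then show "ereal V \<le> enn2ereal (energy 1 half_flux \<Gamma>)"
    using V by (simp add: enn2ereal_ennreal)
qed

end

subsection \<open>Logarithmic cutoff\<close>

definition bump :: "real \<Rightarrow> real" where
  "bump s = pos2 (1 - s\<^sup>2)"

definition bump_deriv :: "real \<Rightarrow> real" where
  "bump_deriv s = - 4 * s * max 0 (1 - s\<^sup>2)"

lemma DERIV_bump: "(bump has_real_derivative bump_deriv s) (at s)"
  unfolding bump_def[abs_def] bump_deriv_def by (auto intro!: derivative_eq_intros)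

lemma continuous_on_bump [continuous_intros]: "continuous_on S f \<Longrightarrow> continuous_on S (\<lambda>x. bump (f x))"
  unfolding bump_def by (intro continuous_intros)

lemma continuous_on_bump_deriv [continuous_intros]: "continuous_on S f \<Longrightarrow> continuous_on S (\<lambda>x. bump_deriv (f x))"
  unfolding bump_deriv_def by (intro continuous_intros)

lemma bump_outside: "1 \<le> \<bar>s\<bar> \<Longrightarrow> bump s = 0" "1 \<le> \<bar>s\<bar> \<Longrightarrow> bump_deriv s = 0"
proof -
  assume "1 \<le> \<bar>s\<bar>"
  then have "1 \<le> s\<^sup>2"
    using abs_square_less_1[of s] by linarith
  then show "bump s = 0" "bump_deriv s = 0"
    by (simp_all add: bump_def bump_deriv_def pos2_eq_0)
qed

lemma bump_bounds: "0 \<le> bump s" "bump s \<le> 1" "\<bar>bump_deriv s\<bar> \<le> 4"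
proof -
  show "0 \<le> bump s" by (simp add: bump_def pos2_ge_0)
  have m: "0 \<le> max 0 (1 - s\<^sup>2)" "max 0 (1 - s\<^sup>2) \<le> 1" by auto
  then show "bump s \<le> 1"
    unfolding bump_def pos2_def by (rule power_le_one)
  show "\<bar>bump_deriv s\<bar> \<le> 4"
  proof (cases "1 \<le> \<bar>s\<bar>")
    case False
    then have "\<bar>s\<bar> * max 0 (1 - s\<^sup>2) \<le> 1 * 1"
      using m by (intro mult_mono) auto
    then show ?thesis
      using m by (simp add: bump_deriv_def abs_mult)
  qed (simp add: bump_outside)
qed

lemma bump_ge: "\<bar>s\<bar> \<le> 1/2 \<Longrightarrow> 1/2 \<le> bump s"
proof -
  assume "\<bar>s\<bar> \<le> 1/2"
  then have "s\<^sup>2 \<le> (1/2)\<^sup>2"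
    by (simp add: abs_le_square_iff[symmetric])
  then have "3/4 \<le> 1 - s\<^sup>2"
    by (simp add: power2_eq_square)
  then have "(3/4)\<^sup>2 \<le> (1 - s\<^sup>2)\<^sup>2" "0 \<le> 1 - s\<^sup>2"
    by (auto intro: power_mono)
  then show ?thesis
    by (simp add: bump_def pos2_eq_power2 power2_eq_square)
qed

definition axis_sq :: "point \<Rightarrow> real" where
  "axis_sq r = (r $ 1)\<^sup>2 + (r $ 2)\<^sup>2"

lemma axis_sq_nonneg: "0 \<le> axis_sq r"
  by (simp add: axis_sq_def)

lemma one_plus_axis_sq_pos: "0 < 1 + axis_sq r"
  using axis_sq_nonneg[of r] by linarith

lemma measure_cbox_3:
  assumes "a1 \<le> b1" "a2 \<le> b2" "a3 \<le> b3"
  shows "measure lborel (cbox (vector [a1, a2, a3]) (vector [b1, b2, b3]) :: point set) = (b1 - a1) * (b2 - a2) * (b3 - a3)"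
proof -
  have ne: "cbox (vector [a1, a2, a3]) (vector [b1, b2, b3]) \<noteq> ({} :: point set)"
    using assms by (simp add: interval_ne_empty_cart forall_3)
  show ?thesis
    unfolding content_cbox_cart[OF ne] UNIV_3 by simp
qed

text \<open>
  A line has capacity zero: spreading the cutoff over a logarithmic scale makes the Dirichlet
  integral per unit length of the axis of order \<open>1 / L\<close>, while the lower bound at scale
  \<open>exp (L / 2)\<close> does not depend on \<open>L\<close>.
\<close>

locale cutoff =
  fixes L Z :: real
  assumes L: "20 \<le> L" and Z: "1 \<le> Z"
begin

text \<open>In the variable \<open>ln (1 + axis_sq r)\<close> the interval \<open>|s| < 1\<close> is
  (2, 2 L - 2), centred at \<open>L\<close>, that is at radius about \<open>exp (L / 2)\<close>. The
  lower end 2 creates the hole, and adding 1 keeps the logarithm finite on the axis.\<close>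

definition s :: "point \<Rightarrow> real" where
  "s r = (ln (1 + axis_sq r) - L) / (L - 2)"

definition f :: "point \<Rightarrow> real" where
  "f r = bump (s r) * bump (r $ 3 / Z)"

definition f' :: "3 \<Rightarrow> point \<Rightarrow> real" where
  "f' a r = (if a = 3 then bump (s r) * (bump_deriv (r $ 3 / Z) / Z)
     else bump_deriv (s r) * (2 * r $ a / (1 + axis_sq r) / (L - 2)) * bump (r $ 3 / Z))"

lemma DERIV_log_profile:
  "((\<lambda>h. (ln (1 + ((x + h)\<^sup>2 + y\<^sup>2)) - L) / (L - 2)) has_real_derivative 2 * x / (1 + (x\<^sup>2 + y\<^sup>2)) / (L - 2)) (at 0)"
proof (rule DERIV_cdivide)
  have "0 < 1 + (x\<^sup>2 + y\<^sup>2)"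
    by (simp add: add_pos_nonneg)
  then show "((\<lambda>h. ln (1 + ((x + h)\<^sup>2 + y\<^sup>2)) - L) has_real_derivative 2 * x / (1 + (x\<^sup>2 + y\<^sup>2))) (at 0)"
    by (auto intro!: derivative_eq_intros)
qed

lemma has_partial_f: "has_partial a f (f' a)"
  unfolding has_partial_def has_real_derivative_iff_has_vector_derivative[symmetric]
proof
  fix r :: point
  consider "a = 1" | "a = 2" | "a = 3" using exhaust_3[of a] by blast
  then show "((\<lambda>h. f (r + h *\<^sub>R axis a 1)) has_real_derivative f' a r) (at 0)"
  proof cases
    case 1
    show ?thesis
      using DERIV_cmult_right[OF DERIV_chain2[OF DERIV_bump DERIV_log_profile[of "r $ 1" "r $ 2"]], of "bump (r $ 3 / Z)"] 1
      by (simp add: f_def f'_def s_def axis_sq_def axis_def)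
  next
    case 2
    have swap: "(r $ 1)\<^sup>2 + x = x + (r $ 1)\<^sup>2" for x
      by (rule add.commute)
    show ?thesis
      using DERIV_cmult_right[OF DERIV_chain2[OF DERIV_bump DERIV_log_profile[of "r $ 2" "r $ 1"]], of "bump (r $ 3 / Z)"] 2
      by (simp add: f_def f'_def s_def axis_sq_def axis_def swap)
  next
    case 3
    have "((\<lambda>h. bump (s r) * bump ((r $ 3 + h) / Z)) has_real_derivative bump (s r) * (bump_deriv ((r $ 3 + 0) / Z) / Z)) (at 0)"
      using Z by (auto intro!: derivative_eq_intros DERIV_chain2[OF DERIV_bump])
    then show ?thesis
      using 3 by (simp add: f_def f'_def s_def axis_sq_def axis_def)
  qed
qed

lemma continuous_f: "continuous_on UNIV f" "continuous_on UNIV (f' a)"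
proof -
  have s: "continuous_on UNIV s"
    unfolding s_def[abs_def] axis_sq_def using L one_plus_axis_sq_pos
    by (intro continuous_intros) (auto simp: axis_sq_def less_imp_neq[THEN not_sym])
  have nz: "1 + axis_sq r \<noteq> 0" for r
    using one_plus_axis_sq_pos[of r] by simp
  have q: "continuous_on UNIV (\<lambda>r. 1 + axis_sq r)"
    unfolding axis_sq_def by (intro continuous_intros)
  show "continuous_on UNIV f"
    unfolding f_def[abs_def] using Z by (intro continuous_intros s) auto
  show "continuous_on UNIV (f' a)"
    unfolding f'_def[abs_def] using L Z
    by (cases "a = 3") (auto intro!: continuous_intros s q simp: nz)
qed

lemma borel_measurable_f [measurable]: "f \<in> borel_measurable borel" "f' a \<in> borel_measurable borel"
  by (intro borel_measurable_continuous_onI continuous_f)+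

lemma f_support:
  assumes "f r \<noteq> 0 \<or> f' a r \<noteq> 0"
  shows "1 + axis_sq r < exp (2 * L)" "4 \<le> axis_sq r" "\<bar>r $ 3\<bar> \<le> Z"
proof -
  have s: "\<bar>s r\<bar> < 1" and z: "\<bar>r $ 3 / Z\<bar> < 1"
    using assms bump_outside[of "s r"] bump_outside[of "r $ 3 / Z"]
    by (auto simp: f_def f'_def not_less[symmetric] split: if_splits)
  have L2: "0 < L - 2" using L by simp
  have "ln (1 + axis_sq r) - L < L - 2" "- (L - 2) < ln (1 + axis_sq r) - L"
    using s L2 by (auto simp: s_def abs_less_iff field_simps)
  then have ln: "ln (1 + axis_sq r) < 2 * L" "2 < ln (1 + axis_sq r)"
    by auto
  show "1 + axis_sq r < exp (2 * L)"
    using ln(1) one_plus_axis_sq_pos[of r] by (metis exp_less_cancel_iff exp_ln)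
  have "exp 2 < 1 + axis_sq r"
    using ln(2) one_plus_axis_sq_pos[of r] by (metis exp_less_cancel_iff exp_ln)
  \<comment> \<open>The quadratic Taylor polynomial of \<open>exp\<close> at 2 is 1 + 2 + 2;
    removing the 1 from \<open>1 + axis_sq r\<close> leaves the squared hole radius 4.\<close>
  moreover have "(5::real) \<le> exp 2"
    using exp_lower_Taylor_quadratic[of "2::real"] by simp
  ultimately show "4 \<le> axis_sq r" by simp
  show "\<bar>r $ 3\<bar> \<le> Z"
    using z Z by (simp add: abs_divide)
qed

lemma f_bounds: "\<bar>f r\<bar> \<le> 4" "\<bar>f' a r\<bar> \<le> 4"
proof -
  have "f r \<le> 1 * 1"
    unfolding f_def by (intro mult_mono bump_bounds) auto
  then show "\<bar>f r\<bar> \<le> 4"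
    using bump_bounds by (simp add: f_def abs_mult)
  show "\<bar>f' a r\<bar> \<le> 4"
  proof (cases "a = 3")
    case True
    have "\<bar>bump (s r)\<bar> * (\<bar>bump_deriv (r $ 3 / Z)\<bar> / Z) \<le> 1 * (4 / 1)"
      using Z bump_bounds by (intro mult_mono frac_le) auto
    then show ?thesis
      using True Z by (simp add: f'_def abs_mult)
  next
    case False
    have "2 * \<bar>r $ a\<bar> \<le> 1 + (r $ a)\<^sup>2"
      using sum_squares_bound[of 1 "\<bar>r $ a\<bar>"] by simp
    also have "\<dots> \<le> 1 + axis_sq r"
      using False exhaust_3[of a] by (auto simp: axis_sq_def)
    finally have "2 * \<bar>r $ a\<bar> / (1 + axis_sq r) \<le> 1"
      using one_plus_axis_sq_pos[of r] by simp
    then have "2 * \<bar>r $ a\<bar> / (1 + axis_sq r) / (L - 2) \<le> 1 / 1"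
      using L one_plus_axis_sq_pos[of r] by (intro frac_le) auto
    then have "\<bar>bump_deriv (s r)\<bar> * (2 * \<bar>r $ a\<bar> / (1 + axis_sq r) / (L - 2)) * \<bar>bump (r $ 3 / Z)\<bar> \<le> 4 * 1 * 1"
      using bump_bounds L one_plus_axis_sq_pos[of r] by (intro mult_mono) (auto intro!: mult_nonneg_nonneg divide_nonneg_nonneg)
    then show ?thesis
      using False L one_plus_axis_sq_pos[of r] by (simp add: f'_def abs_mult)
  qed
qed

lemma f_radius: obtains K where "\<And>r. K < norm r \<Longrightarrow> f r = 0"
proof -
  have "norm r \<le> 2 * exp (2 * L) + Z" if "f r \<noteq> 0" for r
  proof -
    have x: "\<bar>x\<bar> \<le> 1 + x\<^sup>2" for x :: real
      using sum_squares_bound[of 1 "\<bar>x\<bar>"] abs_ge_zero[of x] by simp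
    have one_le: "1 \<le> exp (2 * L)"
      using L by simp
    have "norm r \<le> (\<Sum>i\<in>UNIV. \<bar>r $ i\<bar>)"
      by (rule norm_le_l1_cart)
    also have "\<dots> \<le> (1 + (r $ 1)\<^sup>2) + (1 + (r $ 2)\<^sup>2) + Z"
      unfolding sum_3 using f_support(3)[of r] that by (intro add_mono x) auto
    also have "\<dots> \<le> 2 * exp (2 * L) + Z"
    proof -
      have "1 + axis_sq r < exp (2 * L)"
        using f_support(1)[of r] that by simp
      then show ?thesis
        using one_le unfolding axis_sq_def by linarith
    qed
    finally show ?thesis .
  qed
  then show thesis
    by (intro that[of "2 * exp (2 * L) + Z"]) force
qed

lemma integrable_f_power2: "integrable lborel (\<lambda>r. (f r)\<^sup>2)" "integrable lborel (\<lambda>r. (f' a r)\<^sup>2)"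
proof -
  obtain K where K: "\<And>r. K < norm r \<Longrightarrow> f r = 0"
    by (rule f_radius) (rule that)
  have "integrable lborel (\<lambda>r. (cmod (of_real (f r)))\<^sup>2)"
    by (rule integrable_power2_bounded_support[where C = 4 and K = K]) (auto simp: f_bounds K)
  then show "integrable lborel (\<lambda>r. (f r)\<^sup>2)" by simp
  have "integrable lborel (\<lambda>r. (cmod (of_real (f' a r)))\<^sup>2)"
    by (rule integrable_power2_bounded_support[where C = 4 and K = K])
       (auto simp: f_bounds has_partial_zero_outside[OF has_partial_f K])
  then show "integrable lborel (\<lambda>r. (f' a r)\<^sup>2)" by simp
qed

section \<open>Upper bounds for the Dirichlet integral\<close>

definition slab :: "real \<Rightarrow> point set" where
  "slab t = cbox (vector [-t, -t, -Z]) (vector [t, t, Z])"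

lemma mem_slab: "r \<in> slab t \<longleftrightarrow> \<bar>r $ 1\<bar> \<le> t \<and> \<bar>r $ 2\<bar> \<le> t \<and> \<bar>r $ 3\<bar> \<le> Z"
  by (auto simp: slab_def mem_box_cart forall_3)

lemma measure_slab: "0 \<le> t \<Longrightarrow> measure lborel (slab t) = 8 * t\<^sup>2 * Z"
  using Z unfolding slab_def by (simp add: measure_cbox_3 power2_eq_square)

lemma integral_slab: "0 \<le> t \<Longrightarrow> (LINT r|lborel. indicator (slab t) r * c) = 8 * t\<^sup>2 * Z * c"
  and integrable_slab: "integrable lborel (\<lambda>r. indicator (slab t) r * (c::real))"
proof -
  show i: "integrable lborel (\<lambda>r. indicator (slab t) r * (c::real))"
    unfolding slab_def by (intro integrable_mult_left integrable_real_indicator)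
      (use emeasure_lborel_cbox_finite in \<open>auto simp: infinity_ennreal_def\<close>)
  show "0 \<le> t \<Longrightarrow> (LINT r|lborel. indicator (slab t) r * c) = 8 * t\<^sup>2 * Z * c"
    by (simp add: measure_slab slab_def[symmetric])
qed

text \<open>The support has volume at most \<open>8 * exp (2 * L) * Z\<close> and the squared
  derivative is at most \<open>16 / Z^2\<close>. A cutoff much longer than \<open>exp L\<close>
  makes this small compared with \<open>Z\<close>.\<close>

lemma axial_integral_le: "(LINT r|lborel. (f' 3 r)\<^sup>2) \<le> 128 * exp (2 * L) / Z"
proof -
  have pointwise: "(f' 3 r)\<^sup>2 \<le> indicator (slab (exp L)) r * (16 / Z\<^sup>2)" for r
  proof (cases "f' 3 r = 0")
    case False
    have "axis_sq r \<le> (exp L)\<^sup>2"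
      using f_support(1)[of r 3] False by (simp add: exp_double[symmetric])
    then have "(r $ 1)\<^sup>2 \<le> (exp L)\<^sup>2" "(r $ 2)\<^sup>2 \<le> (exp L)\<^sup>2"
      using zero_le_power2[of "r $ 1"] zero_le_power2[of "r $ 2"] unfolding axis_sq_def by linarith+
    then have "r \<in> slab (exp L)"
      using f_support(3)[of r 3] False by (simp add: mem_slab power2_le_iff_abs_le)
    have "bump (s r) * \<bar>bump_deriv (r $ 3 / Z)\<bar> \<le> 1 * 4"
      by (intro mult_mono bump_bounds) auto
    then have "\<bar>f' 3 r\<bar> \<le> 4 / Z"
      using Z bump_bounds(1)[of "s r"] by (simp add: f'_def abs_mult divide_right_mono)
    then have "\<bar>f' 3 r\<bar>\<^sup>2 \<le> (4 / Z)\<^sup>2"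
      by (intro power_mono) auto
    with \<open>r \<in> slab (exp L)\<close> show ?thesis
      by (simp add: power_divide)
  qed simp
  have "(LINT r|lborel. (f' 3 r)\<^sup>2) \<le> (LINT r|lborel. indicator (slab (exp L)) r * (16 / Z\<^sup>2))"
    by (intro integral_mono integrable_f_power2 integrable_slab pointwise)
  also have "\<dots> = 8 * (exp L)\<^sup>2 * Z * (16 / Z\<^sup>2)"
    by (rule integral_slab) simp
  also have "\<dots> = 128 * exp (2 * L) / Z"
    unfolding exp_double using Z by (simp add: power2_eq_square)
  finally show ?thesis .
qed

text \<open>The support is cut into shells on which \<open>1 + axis_sq r\<close> grows by a factor
  e. Volume grows like \<open>exp k\<close> and the squared gradient decays like
  \<open>exp (- k) / L^2\<close>, so all shells contribute alike; about \<open>2 L\<close> shells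
  give order \<open>Z / L\<close>.\<close>

lemma radial_integral_le:
  assumes n: "2 * L \<le> real n"
  shows "(LINT r|lborel. (f' 1 r)\<^sup>2) + (LINT r|lborel. (f' 2 r)\<^sup>2) \<le> 1536 * real n * Z / (L - 2)\<^sup>2"
proof -
  \<comment> \<open>The constant 64 is the squared bound 4 for \<open>bump_deriv\<close> times the
    squared factor 2 from differentiating \<open>axis_sq\<close>.\<close>
  define c where "c = 64 / (L - 2)\<^sup>2"
  have c: "0 \<le> c" by (simp add: c_def)
  have L2: "0 < L - 2" using L by simp
  define t where "t k = exp (real (Suc k) / 2)" for k
  have t: "0 \<le> t k" "(t k)\<^sup>2 = exp (real (Suc k))" for k
    by (simp_all add: t_def exp_double[symmetric])
  \<comment> \<open>Each shell is enlarged to a full box around the axis. The boxes overlap, but the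
    geometric decay of the heights makes this cost only a constant.\<close>
  define M where "M r = (\<Sum>k<n. indicator (slab (t k)) r * (c * exp (- real k)))" for r
  have pointwise: "(f' 1 r)\<^sup>2 + (f' 2 r)\<^sup>2 \<le> M r" for r
  proof (cases "f' 1 r = 0 \<and> f' 2 r = 0")
    case True
    then show ?thesis
      using c by (auto simp: M_def intro!: sum_nonneg)
  next
    case False
    then have supp: "1 + axis_sq r < exp (2 * L)" "\<bar>r $ 3\<bar> \<le> Z"
      using f_support(1,3)[of r] by auto
    define q where "q = 1 + axis_sq r"
    have q: "1 \<le> q" "q < exp (2 * L)"
      using supp(1) axis_sq_nonneg[of r] by (simp_all add: q_def)
    define k where "k = nat \<lfloor>ln q\<rfloor>"
    have k: "real k \<le> ln q" "ln q < real (Suc k)"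
      using q(1) unfolding k_def by (simp_all add: le_floor_iff) linarith+
    have "ln q < 2 * L"
      using q by (metis exp_less_cancel_iff exp_ln less_le_trans zero_less_one)
    then have "k < n"
      using k(1) n by linarith
    have exp_k: "exp (real k) \<le> q" "q \<le> exp (real (Suc k))"
      using k q(1) exp_le_cancel_iff[of "real k" "ln q"] exp_le_cancel_iff[of "ln q" "real (Suc k)"] by (simp_all del: of_nat_Suc)
    have "(r $ 1)\<^sup>2 \<le> (t k)\<^sup>2" "(r $ 2)\<^sup>2 \<le> (t k)\<^sup>2"
      using exp_k(2) zero_le_power2[of "r $ 1"] zero_le_power2[of "r $ 2"]
      unfolding t(2) q_def axis_sq_def by linarith+
    then have slab: "r \<in> slab (t k)"
      using supp(2) t(1)[of k] by (simp add: mem_slab power2_le_iff_abs_le)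
    have bump_le: "(bump_deriv (s r))\<^sup>2 \<le> 4\<^sup>2" "(bump (r $ 3 / Z))\<^sup>2 \<le> 1\<^sup>2"
      using power_mono[OF bump_bounds(3) abs_ge_zero, of "s r" 2] power_mono[OF bump_bounds(2,1), of "r $ 3 / Z" 2]
      by simp_all
    have square: "(f' a r)\<^sup>2 = (bump_deriv (s r))\<^sup>2 * (bump (r $ 3 / Z))\<^sup>2 * (4 * (r $ a)\<^sup>2 / q\<^sup>2 / (L - 2)\<^sup>2)" if "a \<noteq> 3" for a
      using that by (simp add: f'_def q_def[symmetric] power_mult_distrib power_divide)
    have "(f' 1 r)\<^sup>2 + (f' 2 r)\<^sup>2 = (bump_deriv (s r))\<^sup>2 * (bump (r $ 3 / Z))\<^sup>2 * (4 * axis_sq r / q\<^sup>2 / (L - 2)\<^sup>2)"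
      using square[of 1] square[of 2] by (simp add: axis_sq_def distrib_left add_divide_distrib)
    also have "\<dots> \<le> 4\<^sup>2 * 1\<^sup>2 * (4 * q / q\<^sup>2 / (L - 2)\<^sup>2)"
      using axis_sq_nonneg[of r] q by (intro mult_mono bump_le divide_right_mono) (auto simp: q_def)
    also have "\<dots> = c * (1 / q)"
      using q(1) L2 by (simp add: c_def power2_eq_square)
    also have "\<dots> \<le> c * exp (- real k)"
      using exp_k(1) q(1) c by (intro mult_left_mono) (simp_all add: exp_minus inverse_eq_divide frac_le)
    also have "\<dots> = indicator (slab (t k)) r * (c * exp (- real k))"
      using slab by simp
    also have "\<dots> \<le> M r"
      unfolding M_def using \<open>k < n\<close> c by (intro member_le_sum) auto
    finally show ?thesis .
  qed
  have "(LINT r|lborel. (f' 1 r)\<^sup>2) + (LINT r|lborel. (f' 2 r)\<^sup>2) = (LINT r|lborel. (f' 1 r)\<^sup>2 + (f' 2 r)\<^sup>2)"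
    by (simp add: integrable_f_power2)
  also have "\<dots> \<le> (LINT r|lborel. M r)"
    unfolding M_def
    by (intro integral_mono Bochner_Integration.integrable_add Bochner_Integration.integrable_sum
        integrable_f_power2 integrable_slab) (use pointwise in \<open>simp add: M_def\<close>)
  also have "\<dots> = (\<Sum>k<n. 8 * (t k)\<^sup>2 * Z * (c * exp (- real k)))"
    unfolding M_def by (simp only: Bochner_Integration.integral_sum[OF integrable_slab] integral_slab[OF t(1)])
  also have "\<dots> = (\<Sum>k<n. 8 * exp 1 * Z * c)"
  proof (rule sum.cong[OF refl])
    fix k
    have "(t k)\<^sup>2 * exp (- real k) = exp 1"
      unfolding t(2) exp_add[symmetric] by simp
    then show "8 * (t k)\<^sup>2 * Z * (c * exp (- real k)) = 8 * exp 1 * Z * c"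
      by (simp add: mult.assoc mult.left_commute[of _ c])
  qed
  also have "\<dots> = 8 * exp 1 * Z * c * real n"
    by simp
  \<comment> \<open>With e at most 3 the constant becomes 8 * 3 * 64 = 1536.\<close>
  also have "\<dots> \<le> 8 * 3 * Z * c * real n"
    using Z c exp_le by (intro mult_right_mono mult_left_mono) auto
  finally show ?thesis
    by (simp add: c_def ac_simps)
qed

text \<open>With \<open>R = exp (L / 2)\<close> the box lies at the centre of the logarithmic scale:
  \<open>1 + axis_sq r\<close> is between \<open>exp L\<close> and \<open>9 * exp L\<close>, so its
  logarithm differs from \<open>L\<close> by at most 8. As \<open>L \<ge> 20\<close>,
  \<open>s\<close> stays below 1/2 and both bumps are at least 1/2.\<close>

lemma f_ge_on_flux_box:
  assumes r: "r \<in> flux_box (exp (L / 2))" and z: "\<bar>r $ 3\<bar> \<le> Z / 2"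
  shows "1/4 \<le> f r"
proof -
  define R where "R = exp (L / 2)"
  have R: "0 < R" "R\<^sup>2 = exp L"
    by (simp_all add: R_def exp_double[symmetric])
  have "0 \<le> L" using L by simp
  then have "1 \<le> R\<^sup>2"
    using R(2) by simp
  have "R \<le> r $ 1" "r $ 1 \<le> 2 * R" "- (r $ 2) \<le> 2 * R" "0 \<le> r $ 1" "0 \<le> - (r $ 2)"
    using r R(1) by (auto simp: flux_box_def R_def[symmetric])
  then have "R\<^sup>2 \<le> (r $ 1)\<^sup>2" "(r $ 1)\<^sup>2 \<le> (2 * R)\<^sup>2" "(- (r $ 2))\<^sup>2 \<le> (2 * R)\<^sup>2"
    using R(1) power_mono by (blast intro: less_imp_le)+
  then have q: "exp L \<le> 1 + axis_sq r" "1 + axis_sq r \<le> 9 * exp L"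
    using \<open>1 \<le> R\<^sup>2\<close> zero_le_power2[of "r $ 2"] four_x_squared[of R]
    unfolding axis_sq_def R(2)[symmetric] power2_minus by linarith+
  have "L \<le> ln (1 + axis_sq r)"
    using q(1) one_plus_axis_sq_pos[of r] by (simp add: ln_ge_iff)
  moreover have "ln (1 + axis_sq r) \<le> ln (9 * exp L)"
    using q(2) one_plus_axis_sq_pos[of r] by (subst ln_le_cancel_iff) auto
  moreover have "ln (9 * exp L) \<le> 8 + L"
    using ln_le_minus_one[of 9] by (simp add: ln_mult)
  ultimately have "\<bar>s r\<bar> \<le> 8 / (L - 2)"
    using L by (simp add: s_def abs_divide divide_right_mono)
  also have "\<dots> \<le> 1/2"
    using L by (simp add: field_simps)
  finally have "1/2 \<le> bump (s r)"
    by (rule bump_ge)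
  moreover have "1/2 \<le> bump (r $ 3 / Z)"
    using z Z by (intro bump_ge) (simp add: abs_divide field_simps)
  ultimately have "1/2 * (1/2) \<le> bump (s r) * bump (r $ 3 / Z)"
    by (intro mult_mono) auto
  then show ?thesis
    by (simp add: f_def)
qed

section \<open>Mass in the flux box, normalisation and comparison\<close>

definition core :: "point set" where
  "core = cbox (vector [exp (L / 2), - 2 * exp (L / 2), - Z / 2]) (vector [2 * exp (L / 2), - exp (L / 2), Z / 2])"

lemma core_subset: "r \<in> core \<Longrightarrow> r \<in> flux_box (exp (L / 2)) \<and> \<bar>r $ 3\<bar> \<le> Z / 2"
  by (auto simp: core_def flux_box_def mem_box_cart forall_3)

lemma measure_core: "measure lborel core = exp L * Z"
proof -
  have "measure lborel core = (2 * exp (L / 2) - exp (L / 2)) * (- exp (L / 2) - - 2 * exp (L / 2)) * (Z / 2 - - Z / 2)"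
    unfolding core_def using Z by (intro measure_cbox_3) auto
  also have "\<dots> = (exp (L / 2))\<^sup>2 * Z"
    by (simp add: power2_eq_square)
  finally show ?thesis
    by (simp add: exp_double[symmetric])
qed

lemma emeasure_core: "emeasure lborel core = ennreal (exp L * Z)"
  unfolding measure_core[symmetric] core_def
  by (intro emeasure_eq_ennreal_measure) (use emeasure_lborel_cbox_finite in \<open>auto simp: infinity_ennreal_def less_top\<close>)

lemma core_le: "indicator core r * ennreal (1/16) \<le> indicator (flux_box (exp (L / 2))) r * ennreal ((f r)\<^sup>2)"
proof (cases "r \<in> core")
  case True
  then have "1/4 \<le> f r"
    using f_ge_on_flux_box core_subset by blast
  then have "(1/4)\<^sup>2 \<le> (f r)\<^sup>2"
    by (rule power_mono) simp
  then show ?thesis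
    using True core_subset by (auto simp: power2_eq_square intro!: ennreal_leI)
qed simp

definition mass :: real where "mass = (LINT r|lborel. (f r)\<^sup>2)"

lemma nn_integral_flux_box_ge:
  "ennreal (exp L * Z / 16) \<le> (\<integral>\<^sup>+r. indicator (flux_box (exp (L / 2))) r * ennreal ((f r)\<^sup>2) \<partial>lborel)"
proof -
  have [measurable]: "core \<in> sets borel"
    by (simp add: core_def)
  have "(\<integral>\<^sup>+r. indicator core r * ennreal (1/16) \<partial>lborel) = ennreal (exp L * Z) * ennreal (1/16)"
    by (subst nn_integral_multc) (simp_all add: emeasure_core)
  also have "\<dots> = ennreal (exp L * Z * (1/16))"
    using Z by (intro ennreal_mult'[symmetric]) simp
  finally have "ennreal (exp L * Z / 16) = (\<integral>\<^sup>+r. indicator core r * ennreal (1/16) \<partial>lborel)"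
    by simp
  also have "\<dots> \<le> (\<integral>\<^sup>+r. indicator (flux_box (exp (L / 2))) r * ennreal ((f r)\<^sup>2) \<partial>lborel)"
    by (intro nn_integral_mono core_le)
  finally show ?thesis .
qed

lemma mass_pos: "0 < mass"
proof -
  have "ennreal (exp L * Z / 16) \<le> (\<integral>\<^sup>+r. indicator (flux_box (exp (L / 2))) r * ennreal ((f r)\<^sup>2) \<partial>lborel)"
    by (rule nn_integral_flux_box_ge)
  also have "\<dots> \<le> (\<integral>\<^sup>+r. ennreal ((f r)\<^sup>2) \<partial>lborel)"
    by (intro nn_integral_mono) (auto simp: indicator_def)
  also have "\<dots> = ennreal mass"
    unfolding mass_def by (rule nn_integral_eq_integral) (auto intro: integrable_f_power2)
  finally have "ennreal (exp L * Z / 16) \<le> ennreal mass" .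
  moreover have "0 < exp L * Z / 16"
    using Z by simp
  ultimately show ?thesis
    by (metis ennreal_le_iff2 less_le_trans not_le)
qed

text \<open>The support radius is only known to exist, while the locale expects a term;
  \<open>SOME\<close> supplies one.\<close>

sublocale amplitude "\<lambda>r. f r / sqrt mass" "\<lambda>a r. f' a r / sqrt mass" "4 / sqrt mass" "SOME K. \<forall>r. K < norm r \<longrightarrow> f r = 0"
proof
  have pos: "0 < sqrt mass" using mass_pos by simp
  show "has_partial a (\<lambda>r. f r / sqrt mass) (\<lambda>r. f' a r / sqrt mass)" for a
    using has_partial_f[of a] unfolding has_partial_def has_real_derivative_iff_has_vector_derivative[symmetric]
    by (auto intro: DERIV_cdivide)
  show "\<bar>f r / sqrt mass\<bar> \<le> 4 / sqrt mass" "\<bar>f' a r / sqrt mass\<bar> \<le> 4 / sqrt mass" for r a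
    using f_bounds pos by (auto simp: abs_divide intro!: divide_right_mono)
  obtain K where "\<forall>r. K < norm r \<longrightarrow> f r = 0"
    by (rule f_radius) blast
  then have "\<forall>r. (SOME K. \<forall>r. K < norm r \<longrightarrow> f r = 0) < norm r \<longrightarrow> f r = 0"
    by (rule someI[of "\<lambda>K. \<forall>r. K < norm r \<longrightarrow> f r = 0"])
  then show "f r / sqrt mass = 0" if "(SOME K. \<forall>r. K < norm r \<longrightarrow> f r = 0) < norm r" for r
    using that by simp
  show "(LINT r|lborel. (f r / sqrt mass)\<^sup>2) = 1"
    using mass_pos by (simp add: power_divide mass_def[symmetric])
  show "f r / sqrt mass = 0" if "(r $ 1)\<^sup>2 + (r $ 2)\<^sup>2 < 4" for r
    using that f_support(2)[of r] by (auto simp: axis_sq_def)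
qed measurable

lemma dirichlet_le:
  assumes n: "2 * L \<le> real n"
  shows "dirichlet \<le> (768 * real n * Z / (L - 2)\<^sup>2 + 64 * exp (2 * L) / Z) / mass"
proof -
  have "dirichlet = 1/2 * ((LINT r|lborel. (f' 1 r)\<^sup>2) + (LINT r|lborel. (f' 2 r)\<^sup>2) + (LINT r|lborel. (f' 3 r)\<^sup>2)) / mass"
    using mass_pos by (simp add: dirichlet_def sum_3 power_divide add_divide_distrib)
  also have "\<dots> \<le> 1/2 * (1536 * real n * Z / (L - 2)\<^sup>2 + 128 * exp (2 * L) / Z) / mass"
    using mass_pos radial_integral_le[OF n] axial_integral_le
    by (intro divide_right_mono mult_left_mono add_mono) auto
  finally show ?thesis
    by (simp add: distrib_left ac_simps)
qed

text \<open>The mass in the flux box is at least \<open>exp L * Z / 16\<close> before normalisation,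
  and the loop estimate divides by \<open>36 * exp L\<close>. The scale cancels and 36 * 16 = 576
  remains.\<close>

lemma G_lower_bound: "ereal (Z / 576 / mass) \<le> G \<rho> half_flux"
proof (rule G_ge)
  let ?R = "exp (L / 2)"
  show "1 \<le> ?R" using L by simp
  show "0 \<le> Z / 576 / mass" using Z mass_pos by simp
  have R: "?R\<^sup>2 = exp L" by (simp add: exp_double[symmetric])
  have "ennreal (36 * ?R\<^sup>2 * (Z / 576 / mass)) = ennreal (1 / mass * (exp L * Z / 16))"
    unfolding R by (simp add: field_simps)
  also have "\<dots> = ennreal (1 / mass) * ennreal (exp L * Z / 16)"
    using mass_pos by (intro ennreal_mult') simp
  also have "\<dots> \<le> ennreal (1 / mass) * (\<integral>\<^sup>+r. indicator (flux_box ?R) r * ennreal ((f r)\<^sup>2) \<partial>lborel)"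
    by (intro mult_left_mono nn_integral_flux_box_ge) simp
  also have "\<dots> = (\<integral>\<^sup>+r. ennreal (1 / mass) * (indicator (flux_box ?R) r * ennreal ((f r)\<^sup>2)) \<partial>lborel)"
    by (rule nn_integral_cmult[symmetric]) measurable
  also have "\<dots> = (\<integral>\<^sup>+r. indicator (flux_box ?R) r * ennreal (\<rho> r) \<partial>lborel)"
  proof (rule nn_integral_cong)
    fix r
    have "\<rho> r = 1 / mass * (f r)\<^sup>2"
      using mass_pos by (simp add: \<rho>_def power_divide)
    then have "ennreal (\<rho> r) = ennreal (1 / mass) * ennreal ((f r)\<^sup>2)"
      using mass_pos by (simp only:) (rule ennreal_mult', simp)
    then show "ennreal (1 / mass) * (indicator (flux_box ?R) r * ennreal ((f r)\<^sup>2)) = indicator (flux_box ?R) r * ennreal (\<rho> r)"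
      by (simp only: mult.left_commute)
  qed
  finally show "ennreal (36 * ?R\<^sup>2 * (Z / 576 / mass)) \<le> (\<integral>\<^sup>+r. indicator (flux_box ?R) r * ennreal (\<rho> r) \<partial>lborel)" .
qed

end

theorem proposition2:
  shows "\<exists>\<rho> A. electron_density \<rho> \<and> vector_potential \<rho> A \<and> G \<rho> A > G_D \<rho> A"
proof -
  \<comment> \<open>In units of \<open>Z / mass\<close>, \<open>L\<close> brings the radial part,
    with \<open>2 L\<close> = 8000000 shells, below 1/2000, and \<open>Z\<close> brings the axial
    part to 64/90000. The total is about 0.00121, below 1/576, which is about 0.00174.\<close>
  define L Z :: real where "L = 4000000" and "Z = 300 * exp L"
  interpret cutoff L Z
  proof
    show "20 \<le> L" by (simp add: L_def)
    have "1 \<le> exp L" by (simp add: L_def)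
    then show "1 \<le> Z" unfolding Z_def by linarith
  qed
  have "dirichlet \<le> (768 * real 8000000 * Z / (L - 2)\<^sup>2 + 64 * exp (2 * L) / Z) / mass"
    by (rule dirichlet_le) (simp add: L_def)
  also have "64 * exp (2 * L) / Z = 64 / 90000 * Z"
    unfolding Z_def exp_double by (simp add: power2_eq_square)
  also have "768 * real 8000000 * Z / (L - 2)\<^sup>2 \<le> 1/2000 * Z"
  proof -
    have "768 * 8000000 / (L - 2)\<^sup>2 \<le> 1/2000"
      by (simp add: L_def power2_eq_square)
    then have "768 * 8000000 / (L - 2)\<^sup>2 * Z \<le> 1/2000 * Z"
      using Z by (intro mult_right_mono) auto
    then show ?thesis by simp
  qed
  finally have "dirichlet \<le> (1/2000 * Z + 64 / 90000 * Z) / mass"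
    using mass_pos by (simp add: divide_right_mono)
  also have "\<dots> < Z / 576 / mass"
    using Z mass_pos by (intro divide_strict_right_mono) auto
  finally have "ereal dirichlet < ereal (Z / 576 / mass)"
    by simp
  then have "G_D \<rho> half_flux < G \<rho> half_flux"
    using G_D_le G_lower_bound by (meson le_less_trans less_le_trans)
  then show ?thesis
    using electron_density_\<rho> vector_potential_half_flux by blast
qed

end
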